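(* Let $m>0$ and $c>0$, and let $B_\varepsilon>0$ be a bit budget depending on the noise level $\varepsilon>0$. Let $R_\varepsilon(m,c,B_\varepsilon)$ be the quantized minimax risk over the Sobolev ellipsoid $\Theta(m,c)$, and let $\mathsf P_{m,c}$, $\mathsf V_{m,c,d}$, $\mathsf Q_{m,c,d}$ be the constants, all as defined in the context. (i) If $B_\varepsilon\,\varepsilon^{\frac{2}{2m+1}}\to\infty$ as $\varepsilon\to0$, then $$\liminf_{\varepsilon\to 0}\ \varepsilon^{-\frac{4m}{2m+1}}R_\varepsilon(m,c,B_\varepsilon)\ \ge\ \mathsf P_{m,c}.$$ (ii) If $B_\varepsilon\,\varepsilon^{\frac{2}{2m+1}}\to d$ for some constant $d>0$ as $\varepsilon\to0$, then $$\liminf_{\varepsilon\to 0}\ \varepsilon^{-\frac{4m}{2m+1}}R_\varepsilon(m,c,B_\varepsilon)\ \ge\ \mathsf P_{m,c}+\mathsf Q_{m,c,d}\ =\ \mathsf V_{m,c,d}.$$ (iii) If $B_\varepsilon\,\varepsilon^{\frac{2}{2m+1}}\to0$ and $B_\varepsilon\to\infty$ as $\varepsilon\to 0$, then $$\liminf_{\varepsilon\to 0}\ B_\varepsilon^{2m}\,R_\varepsilon(m,c,B_\varepsilon)\ \ge\ \frac{c^2m^{2m}}{\pi^{2m}}.$$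
   Context: Model: for $\theta=(\theta_j)_{j\ge1}\in\ell_2$ one observes $Y=(Y_j)_{j\ge1}$ with independent $Y_j\sim\mathcal N(\theta_j,\varepsilon^2)$. The Sobolev ellipsoid is $$\Theta(m,c)=\Big\{\theta\in\ell_2:\ \sum_{j=1}^\infty a_j^2\theta_j^2\le \frac{c^2}{\pi^{2m}}\Big\},\qquad a_j=j^m .$$ Quantized estimators: an estimator $\hat\theta$ (a measurable function of $Y$ with values in $\ell_2$) satisfies $C(\hat\theta)\le B$ if it has the form $\hat\theta=\psi\circ\phi$ where the encoder $\phi$ maps the data to an index set with at most $2^{B}$ elements and the decoder $\psi$ maps indices to $\ell_2$; that is, $\hat\theta$ takes at most $2^{B}$ different values. The quantized minimax risk is $$R_\varepsilon(m,c,B)=\inf_{\hat\theta:\,C(\hat\theta)\le B}\ \sup_{\theta\in\Theta(m,c)}\mathbb E_\theta\|\theta-\hat\theta\|_2^2 .$$ Pinsker's constant: $$\mathsf P_{m,c}=\left(\frac{c^2(2m+1)}{\pi^{2m}}\right)^{\frac1{2m+1}}\left(\frac{m}{m+1}\right)^{\frac{2m}{2m+1}} .$$ Variational constant ($\log$ is the natural logarithm): $\mathsf V_{m,c,d}$ is the value (supremum) of $$\int_0^{x_0}\frac{\sigma^2(x)}{\sigma^2(x)+1}\,dx+x_0\exp\left(\frac1{x_0}\int_0^{x_0}\log\frac{\sigma^4(x)}{\sigma^2(x)+1}\,dx-\frac{2d}{x_0}\right)$$ over all $x_0>0$ and all positive decreasing (non-increasing) functions $\sigma^2(\cdot)$ on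 $(0,x_0]$, with $\sigma^4=(\sigma^2)^2$, satisfying $$\int_0^{x_0}x^{2m}\sigma^2(x)\,dx\le\frac{c^2}{\pi^{2m}}$$ and $$\frac{\sigma^4(x)}{\sigma^2(x)+1}\ \ge\ \exp\left(\frac1{x_0}\int_0^{x_0}\log\frac{\sigma^4(y)}{\sigma^2(y)+1}\,dy-\frac{2d}{x_0}\right)\quad\text{for all }x\le x_0 .$$ Finally $\mathsf Q_{m,c,d}=\mathsf V_{m,c,d}-\mathsf P_{m,c}$. *)

theory Defs
  imports "HOL-Probability.Probability"
begin

text \<open>
  Sequences $(\theta_j)_{j \ge 1}$ are functions on \<^typ>\<open>nat\<close> with the index shifted by one:
  the value at \<open>j\<close> is $\theta_{j+1}$. The Sobolev weight at \<open>j\<close> is therefore $(j+1)^m$.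
\<close>

definition ell2 :: "(nat \<Rightarrow> real) set" where
  "ell2 = {\<theta>. summable (\<lambda>j. (\<theta> j)\<^sup>2)}"

definition sobolev_weight :: "real \<Rightarrow> nat \<Rightarrow> real" where
  "sobolev_weight m j = real (Suc j) powr m"

definition sobolev_ellipsoid :: "real \<Rightarrow> real \<Rightarrow> (nat \<Rightarrow> real) set" where
  "sobolev_ellipsoid m c =
     {\<theta> \<in> ell2. summable (\<lambda>j. (sobolev_weight m j)\<^sup>2 * (\<theta> j)\<^sup>2) \<and>
        (\<Sum>j. (sobolev_weight m j)\<^sup>2 * (\<theta> j)\<^sup>2) \<le> c\<^sup>2 / pi powr (2 * m)}"

definition gaussian_sequence :: "real \<Rightarrow> (nat \<Rightarrow> real) \<Rightarrow> (nat \<Rightarrow> real) measure" where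
  "gaussian_sequence \<epsilon> \<theta> =
     (\<Pi>\<^sub>M j\<in>UNIV. density lborel (\<lambda>y. ennreal (normal_density (\<theta> j) \<epsilon> y)))"

text \<open>
  Measurability of an estimator is with respect to the product \<open>\<sigma>\<close>-algebra. On the target side,
  its trace on \<^const>\<open>ell2\<close> is the Borel \<open>\<sigma>\<close>-algebra of the norm topology, as
  $\ell_2$ is separable and distances to a fixed point are measurable functions of the coordinates.
\<close>

definition estimators :: "((nat \<Rightarrow> real) \<Rightarrow> (nat \<Rightarrow> real)) set" where
  "estimators =
     {est \<in> measurable (\<Pi>\<^sub>M j\<in>UNIV. borel) (\<Pi>\<^sub>M j\<in>UNIV. borel). \<forall>y. est y \<in> ell2}"

text \<open>The budget \<open>B\<close> is a real number; the index set is \<open>{..<N}\<close> with \<open>N \<le> 2\<^sup>B\<close>.\<close>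

definition within_budget :: "real \<Rightarrow> ((nat \<Rightarrow> real) \<Rightarrow> (nat \<Rightarrow> real)) \<Rightarrow> bool" where
  "within_budget B est \<longleftrightarrow>
     (\<exists>(N::nat) (\<phi> :: (nat \<Rightarrow> real) \<Rightarrow> nat) (\<psi> :: nat \<Rightarrow> (nat \<Rightarrow> real)).
        real N \<le> 2 powr B \<and> (\<forall>y. \<phi> y < N) \<and> (\<forall>i<N. \<psi> i \<in> ell2) \<and> est = \<psi> \<circ> \<phi>)"

definition sq_risk ::
    "real \<Rightarrow> ((nat \<Rightarrow> real) \<Rightarrow> (nat \<Rightarrow> real)) \<Rightarrow> (nat \<Rightarrow> real) \<Rightarrow> ennreal" where
  "sq_risk \<epsilon> est \<theta> =
     (\<integral>\<^sup>+ y. ennreal (\<Sum>j. (\<theta> j - est y j)\<^sup>2) \<partial>gaussian_sequence \<epsilon> \<theta>)"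

definition quantized_minimax_risk :: "real \<Rightarrow> real \<Rightarrow> real \<Rightarrow> real \<Rightarrow> ennreal" where
  "quantized_minimax_risk \<epsilon> m c B =
     (INF est \<in> {est \<in> estimators. within_budget B est}.
        SUP \<theta> \<in> sobolev_ellipsoid m c. sq_risk \<epsilon> est \<theta>)"

definition pinsker_const :: "real \<Rightarrow> real \<Rightarrow> real" where
  "pinsker_const m c =
     (c\<^sup>2 * (2 * m + 1) / pi powr (2 * m)) powr (1 / (2 * m + 1)) *
     (m / (m + 1)) powr (2 * m / (2 * m + 1))"

text \<open>
  In the variational problem the variable \<open>s\<close> stands for the function $\sigma^2(\cdot)$, so that
  $\sigma^4 = s^2$; only its values on $(0, x_0]$ matter.
\<close>

definition quantization_level :: "real \<Rightarrow> real \<Rightarrow> (real \<Rightarrow> real) \<Rightarrow> real" where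
  "quantization_level d x0 s =
     exp (1 / x0 * (LBINT x:{0<..x0}. ln ((s x)\<^sup>2 / (s x + 1))) - 2 * d / x0)"

text \<open>
  Integrability in the moment constraint is explicit because the Bochner integral of a
  non-integrable function is 0. The other two integrands are then automatically integrable: the
  first is bounded, and monotonicity with the moment constraint gives
  $s(x) = O(x^{-(2m+1)})$ near 0, so that the logarithm is integrable.
\<close>

definition variational_feasible :: "real \<Rightarrow> real \<Rightarrow> real \<Rightarrow> real \<Rightarrow> (real \<Rightarrow> real) \<Rightarrow> bool" where
  "variational_feasible m c d x0 s \<longleftrightarrow>
     x0 > 0 \<and> (\<forall>x\<in>{0<..x0}. s x > 0) \<and> antimono_on {0<..x0} s \<and>
     set_integrable lborel {0<..x0} (\<lambda>x. x powr (2 * m) * s x) \<and>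
     (LBINT x:{0<..x0}. x powr (2 * m) * s x) \<le> c\<^sup>2 / pi powr (2 * m) \<and>
     (\<forall>x\<in>{0<..x0}. (s x)\<^sup>2 / (s x + 1) \<ge> quantization_level d x0 s)"

definition variational_objective :: "real \<Rightarrow> real \<Rightarrow> (real \<Rightarrow> real) \<Rightarrow> real" where
  "variational_objective d x0 s =
     (LBINT x:{0<..x0}. s x / (s x + 1)) + x0 * quantization_level d x0 s"

definition variational_const :: "real \<Rightarrow> real \<Rightarrow> real \<Rightarrow> ereal" where
  "variational_const m c d =
     (SUP (x0, s) \<in> {(x0, s). variational_feasible m c d x0 s}.
        ereal (variational_objective d x0 s))"

definition quantization_excess :: "real \<Rightarrow> real \<Rightarrow> real \<Rightarrow> ereal" where
  "quantization_excess m c d = variational_const m c d - ereal (pinsker_const m c)"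

end

theory Submission
  imports Defs "HOL-Real_Asymp.Real_Asymp"
begin

text \<open>
  Take the prior under which finitely many coordinates are independent centred Gaussians. Given the
  data, the squared loss splits into the posterior variance and the error made in quantizing the
  posterior mean, a Gaussian vector. With \<open>N\<close> code words the latter is at least \<open>n\<close> times the geometric
  mean of its variances times \<open>N powr (- 2 / n)\<close>.
  The prior leaves the ellipsoid with exponentially small probability if the expected weighted norm
  is kept strictly below the radius, and estimators may be clipped to the box containing the
  ellipsoid. Sampling a profile \<open>s\<close> at multiples of \<open>\<epsilon> powr (2 / (2 * m + 1))\<close> gives (ii), the Pinsker
  profile \<open>(y / x) powr m - 1\<close> gives (i), and variances proportional to \<open>j powr (- 2 * m)\<close> on about
  \<open>B / m\<close> coordinates give (iii).
\<close>

subsection \<open>Infinite product measures\<close>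

text \<open>The encoder may look at the whole infinite observation, so conditioning is carried out
  on laws of full sequences: the pair (parameter, observation) is rewritten, one coordinate at a
  time, as (posterior mean plus independent error, observation). This replaces conditional
  expectations by an equality of two product measures. Beyond the support of the prior the
  observation is pure noise and enters only as extra randomness.

  An exponentially small error requires every coordinate to carry only a share of order
  \<open>1 / n\<close> of the weighted norm. For a sampled profile this share is controlled by the
  supremum of the profile, so discretization is done for bounded profiles; those that blow up at 0
  are reached by truncation and dominated convergence.

  The budget counts bits, whereas the constants are those of a budget in nats. In (ii) the factor
  \<open>ln 2 < 1\<close> is simply discarded. In (iii) it pays for a fixed slack in the radius.
  There \<open>B / m\<close> coordinates are natural because \<open>n = B / m\<close> maximizes
  \<open>n powr (- 2 * m) * exp (2 * m - 2 * B / n)\<close>, with value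
  \<open>(m / B) powr (2 * m)\<close>.\<close>

lemma nn_integral_PiM_prod:
  assumes M: "\<And>i. i \<in> I \<Longrightarrow> prob_space (M i)"
    and J: "finite J" "J \<subseteq> I" and f: "\<And>i. i \<in> J \<Longrightarrow> f i \<in> borel_measurable (M i)"
  shows "(\<integral>\<^sup>+x. (\<Prod>i\<in>J. f i (x i)) \<partial>PiM I M) = (\<Prod>i\<in>J. \<integral>\<^sup>+x. f i x \<partial>M i)"
proof -
  \<comment> \<open>The locale \<open>product_prob_space\<close> wants a probability space at every
    index; a one-point space is filled in outside \<open>I\<close>.\<close>
  let ?M = "\<lambda>i. if i \<in> I then M i else count_space {undefined}"
  interpret M': prob_space "?M i" for i
    using M by (cases "i \<in> I") (auto intro!: prob_spaceI)
  interpret product_prob_space ?M I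
    by unfold_locales
  have f': "f i \<in> borel_measurable (?M i)" if "i \<in> J" for i
    using f[OF that] that J by auto
  have meas: "(\<lambda>x. \<Prod>i\<in>J. f i (x i)) \<in> borel_measurable (PiM J ?M)"
    using f' by (intro borel_measurable_prod_ennreal measurable_compose[OF measurable_component_singleton])
      auto
  have "(\<integral>\<^sup>+x. (\<Prod>i\<in>J. f i (x i)) \<partial>PiM I M) = (\<integral>\<^sup>+x. (\<Prod>i\<in>J. f i (x i)) \<partial>PiM I ?M)"
    by (intro arg_cong2[where f = nn_integral] PiM_cong) auto
  \<comment> \<open>The integrand sees only the coordinates in \<open>J\<close>, so the integral can
    be pushed forward to the finite product over \<open>J\<close>, where it factors.\<close>
  also have "\<dots> = (\<integral>\<^sup>+x. (\<Prod>i\<in>J. f i (restrict x J i)) \<partial>PiM I ?M)"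
    by (intro nn_integral_cong prod.cong) auto
  also have "\<dots> = (\<integral>\<^sup>+x. (\<Prod>i\<in>J. f i (x i)) \<partial>distr (PiM I ?M) (PiM J ?M) (\<lambda>x. restrict x J))"
    using J meas by (intro nn_integral_distr[symmetric] measurable_restrict_subset) auto
  also have "\<dots> = (\<Prod>i\<in>J. \<integral>\<^sup>+x. f i x \<partial>?M i)"
    unfolding distr_PiM_restrict_finite[OF J]
    using f' by (intro product_nn_integral_prod J) auto
  also have "\<dots> = (\<Prod>i\<in>J. \<integral>\<^sup>+x. f i x \<partial>M i)"
    using J by (intro prod.cong) auto
  finally show ?thesis .
qed

lemma nn_integral_PiM_component:
  assumes "\<And>i. i \<in> I \<Longrightarrow> prob_space (M i)" "i \<in> I" "f \<in> borel_measurable (M i)"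
  shows "(\<integral>\<^sup>+x. f (x i) \<partial>PiM I M) = (\<integral>\<^sup>+x. f x \<partial>M i)"
  using nn_integral_PiM_prod[of I M "{i}" "\<lambda>_. f"] assms by simp

text \<open>Finite measures on an infinite product are determined by the cylinders over finite index
  sets, and on a cylinder both sides reduce to the same finite product of coordinate masses.\<close>

lemma distr_PiM_map:
  assumes M: "\<And>i. i \<in> I \<Longrightarrow> prob_space (M i)"
    and f: "\<And>i. i \<in> I \<Longrightarrow> f i \<in> measurable (M i) (N i)"
  shows "distr (PiM I M) (PiM I N) (\<lambda>x. \<lambda>i\<in>I. f i (x i)) = PiM I (\<lambda>i. distr (M i) (N i) (f i))"
proof (rule measure_eqI_PiM_infinite[symmetric, OF refl])
  have D: "prob_space (distr (M i) (N i) (f i))" if "i \<in> I" for i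
    using M f that by (intro prob_space.prob_space_distr) auto
  show "sets (distr (PiM I M) (PiM I N) (\<lambda>x. \<lambda>i\<in>I. f i (x i))) =
    sets (PiM I (\<lambda>i. distr (M i) (N i) (f i)))"
    by (simp cong: sets_PiM_cong)
  show "finite_measure (PiM I (\<lambda>i. distr (M i) (N i) (f i)))"
    using prob_space_PiM[of I "\<lambda>i. distr (M i) (N i) (f i)"] D prob_space.finite_measure by blast
  fix A J assume J: "finite J" "J \<subseteq> I"
    and A: "\<And>i. i \<in> J \<Longrightarrow> A i \<in> sets (distr (M i) (N i) (f i))"
  let ?E = "prod_emb I (\<lambda>i. distr (M i) (N i) (f i)) J (Pi\<^sub>E J A)"
  have g: "(\<lambda>x. \<lambda>i\<in>I. f i (x i)) \<in> measurable (PiM I M) (PiM I N)"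
    using f by (intro measurable_restrict measurable_compose[OF measurable_component_singleton]) auto
  have E: "?E \<in> sets (PiM I N)"
  proof -
    have "?E = prod_emb I N J (Pi\<^sub>E J A)" by (simp add: prod_emb_def)
    also have "\<dots> \<in> sets (PiM I N)" using J A by (intro sets_PiM_I) auto
    finally show ?thesis .
  qed
  have "emeasure (distr (PiM I M) (PiM I N) (\<lambda>x. \<lambda>i\<in>I. f i (x i))) ?E =
      (\<integral>\<^sup>+x. indicator ?E (\<lambda>i\<in>I. f i (x i)) \<partial>PiM I M)"
    using E by (subst nn_integral_distr[OF g, of "indicator ?E", symmetric]) auto
  also have "\<dots> = (\<integral>\<^sup>+x. (\<Prod>i\<in>J. indicator (A i) (f i (x i))) \<partial>PiM I M)"
  proof (rule nn_integral_cong)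
    fix x assume "x \<in> space (PiM I M)"
    then have *: "(\<lambda>i\<in>I. f i (x i)) \<in> space (PiM I N)"
      using g by (auto dest: measurable_space)
    have "(\<lambda>i\<in>I. f i (x i)) \<in> ?E \<longleftrightarrow> (\<forall>i\<in>J. f i (x i) \<in> A i)"
      using * J by (auto simp: prod_emb_def space_PiM PiE_iff subset_eq)
    then show "indicator ?E (\<lambda>i\<in>I. f i (x i)) = (\<Prod>i\<in>J. indicator (A i) (f i (x i)) :: ennreal)"
      using J by (auto simp: indicator_def)
  qed
  also have "\<dots> = (\<Prod>i\<in>J. \<integral>\<^sup>+x. indicator (A i) (f i x) \<partial>M i)"
  proof (intro nn_integral_PiM_prod[OF M J])
    fix i assume "i \<in> J"
    then show "(\<lambda>x. indicator (A i) (f i x)) \<in> borel_measurable (M i)"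
      using f[of i] J A[of i] by (intro measurable_compose[OF f borel_measurable_indicator]) auto
  qed
  also have "\<dots> = (\<Prod>i\<in>J. emeasure (distr (M i) (N i) (f i)) (A i))"
  proof (intro prod.cong refl)
    fix i assume "i \<in> J"
    then show "(\<integral>\<^sup>+x. indicator (A i) (f i x) \<partial>M i) = emeasure (distr (M i) (N i) (f i)) (A i)"
      using J A[of i] by (subst nn_integral_distr[OF f, of _ "indicator (A i)", symmetric]) auto
  qed
  also have "\<dots> = emeasure (PiM I (\<lambda>i. distr (M i) (N i) (f i))) ?E"
    using emeasure_PiM_emb[OF D J(2,1)] A by simp
  finally show "emeasure (PiM I (\<lambda>i. distr (M i) (N i) (f i))) ?E =
    emeasure (distr (PiM I M) (PiM I N) (\<lambda>x. \<lambda>i\<in>I. f i (x i))) ?E" ..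
qed

text \<open>A pair of independent sequences is a sequence of independent pairs. This lets a map that
  mixes the two sequences coordinate by coordinate be treated with \<open>distr_PiM_map\<close>.
  Again cylinders suffice, and Fubini splits each of them.\<close>

lemma distr_PiM_zip:
  assumes M: "\<And>i. i \<in> I \<Longrightarrow> prob_space (M i)" and N: "\<And>i. i \<in> I \<Longrightarrow> prob_space (N i)"
  shows "distr (PiM I M \<Otimes>\<^sub>M PiM I N) (\<Pi>\<^sub>M i\<in>I. M i \<Otimes>\<^sub>M N i) (\<lambda>(x, y). \<lambda>i\<in>I. (x i, y i)) =
    (\<Pi>\<^sub>M i\<in>I. M i \<Otimes>\<^sub>M N i)"
proof (rule measure_eqI_PiM_infinite[symmetric, OF refl])
  have MN: "prob_space (M i \<Otimes>\<^sub>M N i)" if "i \<in> I" for i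
    using M[OF that] N[OF that] by (rule prob_space_pair)
  interpret PN: prob_space "PiM I N" using N by (rule prob_space_PiM)
  show "finite_measure (\<Pi>\<^sub>M i\<in>I. M i \<Otimes>\<^sub>M N i)"
    using prob_space_PiM[of I "\<lambda>i. M i \<Otimes>\<^sub>M N i"] MN prob_space.finite_measure by blast
  fix A J assume J: "finite J" "J \<subseteq> I" and A: "\<And>i. i \<in> J \<Longrightarrow> A i \<in> sets (M i \<Otimes>\<^sub>M N i)"
  let ?E = "prod_emb I (\<lambda>i. M i \<Otimes>\<^sub>M N i) J (Pi\<^sub>E J A)"
  let ?g = "\<lambda>(x, y). \<lambda>i\<in>I. (x i, y i)"
  have g: "?g \<in> measurable (PiM I M \<Otimes>\<^sub>M PiM I N) (\<Pi>\<^sub>M i\<in>I. M i \<Otimes>\<^sub>M N i)"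
    by (simp add: split_beta') measurable
  have E: "?E \<in> sets (\<Pi>\<^sub>M i\<in>I. M i \<Otimes>\<^sub>M N i)"
    using J A by (intro sets_PiM_I) auto
  have sl: "(\<lambda>y. indicator (A i) (a, y) :: ennreal) \<in> borel_measurable (N i)"
    if "i \<in> J" "a \<in> space (M i)" for i a
    using that A[of i] by measurable
  have "emeasure (distr (PiM I M \<Otimes>\<^sub>M PiM I N) (\<Pi>\<^sub>M i\<in>I. M i \<Otimes>\<^sub>M N i) ?g) ?E =
      (\<integral>\<^sup>+z. indicator ?E (?g z) \<partial>(PiM I M \<Otimes>\<^sub>M PiM I N))"
    using E by (subst nn_integral_distr[OF g, of "indicator ?E", symmetric]) auto
  also have "\<dots> = (\<integral>\<^sup>+x. \<integral>\<^sup>+y. indicator ?E (?g (x, y)) \<partial>PiM I N \<partial>PiM I M)"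
    using E g by (subst PN.nn_integral_fst[symmetric]) (auto intro!: measurable_compose[OF g])
  also have "\<dots> = (\<integral>\<^sup>+x. \<integral>\<^sup>+y. (\<Prod>i\<in>J. indicator (A i) (x i, y i)) \<partial>PiM I N \<partial>PiM I M)"
  proof (intro nn_integral_cong)
    fix x y assume "x \<in> space (PiM I M)" "y \<in> space (PiM I N)"
    then have *: "?g (x, y) \<in> space (\<Pi>\<^sub>M i\<in>I. M i \<Otimes>\<^sub>M N i)"
      using measurable_space[OF g, of "(x, y)"] by (auto simp: space_pair_measure)
    have "?g (x, y) \<in> ?E \<longleftrightarrow> (\<forall>i\<in>J. (x i, y i) \<in> A i)"
      using * J by (auto simp: prod_emb_def space_PiM PiE_iff subset_eq)
    then show "indicator ?E (?g (x, y)) = (\<Prod>i\<in>J. indicator (A i) (x i, y i) :: ennreal)"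
      using J by (auto simp: indicator_def)
  qed
  also have "\<dots> = (\<integral>\<^sup>+x. (\<Prod>i\<in>J. \<integral>\<^sup>+b. indicator (A i) (x i, b) \<partial>N i) \<partial>PiM I M)"
    using J sl by (intro nn_integral_cong nn_integral_PiM_prod[OF N J]) (auto simp: space_PiM)
  also have "\<dots> = (\<Prod>i\<in>J. \<integral>\<^sup>+a. \<integral>\<^sup>+b. indicator (A i) (a, b) \<partial>N i \<partial>M i)"
  proof (intro nn_integral_PiM_prod[OF M J])
    fix i assume i: "i \<in> J"
    interpret prob_space "N i" using N i J by auto
    show "(\<lambda>a. \<integral>\<^sup>+b. indicator (A i) (a, b) \<partial>N i) \<in> borel_measurable (M i)"
      using A[OF i] by (intro borel_measurable_nn_integral) (simp add: split_beta')
  qed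
  also have "\<dots> = (\<Prod>i\<in>J. emeasure (M i \<Otimes>\<^sub>M N i) (A i))"
  proof (intro prod.cong refl)
    fix i assume i: "i \<in> J"
    interpret prob_space "N i" using N i J by auto
    show "(\<integral>\<^sup>+a. \<integral>\<^sup>+b. indicator (A i) (a, b) \<partial>N i \<partial>M i) = emeasure (M i \<Otimes>\<^sub>M N i) (A i)"
      using A[OF i] by (subst nn_integral_fst) auto
  qed
  also have "\<dots> = emeasure (\<Pi>\<^sub>M i\<in>I. M i \<Otimes>\<^sub>M N i) ?E"
    using emeasure_PiM_emb[OF MN J(2,1)] A by simp
  finally show "emeasure (\<Pi>\<^sub>M i\<in>I. M i \<Otimes>\<^sub>M N i) ?E =
    emeasure (distr (PiM I M \<Otimes>\<^sub>M PiM I N) (\<Pi>\<^sub>M i\<in>I. M i \<Otimes>\<^sub>M N i) ?g) ?E" ..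
qed simp

subsection \<open>Gaussian prior and posterior\<close>

definition gauss :: "real \<Rightarrow> real measure" where
  "gauss \<sigma> = density lborel (\<lambda>x. ennreal (normal_density 0 \<sigma> x))"

lemma sets_gauss [simp, measurable_cong]: "sets (gauss \<sigma>) = sets borel"
  and space_gauss [simp]: "space (gauss \<sigma>) = UNIV"
  by (simp_all add: gauss_def)

lemma prob_space_gauss: "\<sigma> > 0 \<Longrightarrow> prob_space (gauss \<sigma>)"
  unfolding gauss_def by (rule prob_space_normal_density)

lemma nn_integral_gauss:
  assumes "f \<in> borel_measurable borel"
  shows "(\<integral>\<^sup>+x. f x \<partial>gauss \<sigma>) = (\<integral>\<^sup>+x. ennreal (normal_density 0 \<sigma> x) * f x \<partial>lborel)"
  unfolding gauss_def using assms by (subst nn_integral_density) auto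

lemma nn_integral_lborel_shift:
  fixes f :: "real \<Rightarrow> ennreal"
  assumes "f \<in> borel_measurable borel"
  shows "(\<integral>\<^sup>+x. f (t + x) \<partial>lborel) = (\<integral>\<^sup>+x. f x \<partial>lborel)"
  using nn_integral_real_affine[OF assms, of 1 t] by simp

text \<open>Completing the square: the law of \<open>(x, \<rho> x + w)\<close> is factored through the posterior of \<open>x\<close>.\<close>

lemma normal_density_posterior:
  fixes \<sigma> \<epsilon> s :: real
  assumes "\<sigma> > 0" "\<epsilon> > 0" "s > 0" and s: "s\<^sup>2 = \<rho>\<^sup>2 * \<sigma>\<^sup>2 + \<epsilon>\<^sup>2"
  shows "normal_density 0 \<sigma> x * normal_density 0 \<epsilon> (y - \<rho> * x) =
    normal_density 0 s y * normal_density 0 (\<sigma> * \<epsilon> / s) (x - \<rho> * \<sigma>\<^sup>2 / s\<^sup>2 * y)"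
proof -
  have e: "x\<^sup>2 / \<sigma>\<^sup>2 + (y - \<rho> * x)\<^sup>2 / \<epsilon>\<^sup>2 =
      y\<^sup>2 / s\<^sup>2 + (x - \<rho> * \<sigma>\<^sup>2 / s\<^sup>2 * y)\<^sup>2 / (\<sigma> * \<epsilon> / s)\<^sup>2"
  proof -
    define S where "S = s\<^sup>2"
    have S: "S > 0" "\<sigma>\<^sup>2 > 0" "\<epsilon>\<^sup>2 > 0" using assms(1-3) by (auto simp: S_def)
    have *: "x\<^sup>2 * \<epsilon>\<^sup>2 * S + (y - \<rho> * x)\<^sup>2 * \<sigma>\<^sup>2 * S = y\<^sup>2 * \<sigma>\<^sup>2 * \<epsilon>\<^sup>2 + (S * x - \<rho> * \<sigma>\<^sup>2 * y)\<^sup>2"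
      unfolding S_def s by (simp add: power2_eq_square algebra_simps)
    have "(x - \<rho> * \<sigma>\<^sup>2 / S * y)\<^sup>2 / (\<sigma>\<^sup>2 * \<epsilon>\<^sup>2 / S) = (S * x - \<rho> * \<sigma>\<^sup>2 * y)\<^sup>2 / (S * \<sigma>\<^sup>2 * \<epsilon>\<^sup>2)"
    proof -
      have "x - \<rho> * \<sigma>\<^sup>2 / S * y = (S * x - \<rho> * \<sigma>\<^sup>2 * y) / S" using S by (simp add: field_simps)
      then show ?thesis using S by (simp add: power_divide) (simp add: power2_eq_square)
    qed
    moreover have "x\<^sup>2 / \<sigma>\<^sup>2 + (y - \<rho> * x)\<^sup>2 / \<epsilon>\<^sup>2 =
        (x\<^sup>2 * \<epsilon>\<^sup>2 * S + (y - \<rho> * x)\<^sup>2 * \<sigma>\<^sup>2 * S) / (S * \<sigma>\<^sup>2 * \<epsilon>\<^sup>2)"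
      using S by (simp add: add_divide_distrib)
    moreover have "y\<^sup>2 / S = y\<^sup>2 * \<sigma>\<^sup>2 * \<epsilon>\<^sup>2 / (S * \<sigma>\<^sup>2 * \<epsilon>\<^sup>2)"
      using S by simp
    ultimately show ?thesis
      unfolding * by (simp add: S_def add_divide_distrib power_divide power_mult_distrib)
  qed
  have p: "sqrt (2 * pi * \<sigma>\<^sup>2) * sqrt (2 * pi * \<epsilon>\<^sup>2) =
      sqrt (2 * pi * s\<^sup>2) * sqrt (2 * pi * (\<sigma> * \<epsilon> / s)\<^sup>2)"
    using assms(1-3) by (simp add: real_sqrt_mult power_divide real_sqrt_divide)
  have "normal_density 0 \<sigma> x * normal_density 0 \<epsilon> (y - \<rho> * x) =
      1 / (sqrt (2 * pi * \<sigma>\<^sup>2) * sqrt (2 * pi * \<epsilon>\<^sup>2)) *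
      exp (- (x\<^sup>2 / \<sigma>\<^sup>2 + (y - \<rho> * x)\<^sup>2 / \<epsilon>\<^sup>2) / 2)"
    unfolding normal_density_def
    by (simp add: exp_add[symmetric] add_divide_distrib diff_divide_distrib)
  also have "\<dots> = normal_density 0 s y * normal_density 0 (\<sigma> * \<epsilon> / s) (x - \<rho> * \<sigma>\<^sup>2 / s\<^sup>2 * y)"
    unfolding e p normal_density_def
    by (simp add: exp_add[symmetric] add_divide_distrib diff_divide_distrib)
  finally show ?thesis .
qed

text \<open>Two ways to generate one law on (parameter, observation): parameter first and then
  noise, or observation first with its marginal standard deviation \<open>s\<close>, and then the
  posterior mean plus an independent error of standard deviation
  \<open>\<sigma> * \<epsilon> / s\<close>. The factor \<open>\<rho>\<close> will be 1 where the
  signal is present and 0 where only noise is observed.\<close>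

lemma distr_gauss_posterior:
  fixes \<sigma> \<epsilon> s :: real
  assumes pos: "\<sigma> > 0" "\<epsilon> > 0" "s > 0" and s: "s\<^sup>2 = \<rho>\<^sup>2 * \<sigma>\<^sup>2 + \<epsilon>\<^sup>2"
  shows "distr (gauss \<sigma> \<Otimes>\<^sub>M gauss \<epsilon>) (borel \<Otimes>\<^sub>M borel) (\<lambda>(x, w). (x, \<rho> * x + w)) =
    distr (gauss s \<Otimes>\<^sub>M gauss (\<sigma> * \<epsilon> / s)) (borel \<Otimes>\<^sub>M borel)
      (\<lambda>(y, u). (\<rho> * \<sigma>\<^sup>2 / s\<^sup>2 * y + u, y))"
    (is "distr ?P _ ?f = distr ?Q _ ?g")
proof (rule measure_eqI)
  fix E assume "E \<in> sets (distr ?P (borel \<Otimes>\<^sub>M borel) ?f)"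
  then have E [measurable]: "E \<in> sets (borel \<Otimes>\<^sub>M borel)" by simp
  let ?v = "\<sigma> * \<epsilon> / s" and ?\<gamma> = "\<rho> * \<sigma>\<^sup>2 / s\<^sup>2"
  interpret pe: prob_space "gauss \<epsilon>" using pos by (simp add: prob_space_gauss)
  interpret pv: prob_space "gauss ?v" using pos by (simp add: prob_space_gauss)
  have f: "?f \<in> measurable ?P (borel \<Otimes>\<^sub>M borel)" and g: "?g \<in> measurable ?Q (borel \<Otimes>\<^sub>M borel)"
    by measurable
  have [measurable]: "indicator E \<in> borel_measurable (borel \<Otimes>\<^sub>M borel :: (real \<times> real) measure)"
    by simp
  have "emeasure (distr ?P (borel \<Otimes>\<^sub>M borel) ?f) E = (\<integral>\<^sup>+z. indicator E (?f z) \<partial>?P)"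
    by (subst nn_integral_distr[OF f, of "indicator E", symmetric]) auto
  also have "\<dots> = (\<integral>\<^sup>+x. \<integral>\<^sup>+w. indicator E (x, \<rho> * x + w) \<partial>gauss \<epsilon> \<partial>gauss \<sigma>)"
    by (subst pe.nn_integral_fst[symmetric]) (auto simp: split_beta')
  also have "\<dots> = (\<integral>\<^sup>+x. ennreal (normal_density 0 \<sigma> x) *
      (\<integral>\<^sup>+w. ennreal (normal_density 0 \<epsilon> w) * indicator E (x, \<rho> * x + w) \<partial>lborel) \<partial>lborel)"
    by (simp add: nn_integral_gauss)
  also have "\<dots> = (\<integral>\<^sup>+x. ennreal (normal_density 0 \<sigma> x) *
      (\<integral>\<^sup>+y. ennreal (normal_density 0 \<epsilon> (y - \<rho> * x)) * indicator E (x, y) \<partial>lborel) \<partial>lborel)"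
  proof (rule nn_integral_cong, rule arg_cong2[where f = "(*)", OF refl])
    fix x
    show "(\<integral>\<^sup>+w. ennreal (normal_density 0 \<epsilon> w) * indicator E (x, \<rho> * x + w) \<partial>lborel) =
        (\<integral>\<^sup>+y. ennreal (normal_density 0 \<epsilon> (y - \<rho> * x)) * indicator E (x, y) \<partial>lborel)"
      using nn_integral_lborel_shift[of "\<lambda>y. ennreal (normal_density 0 \<epsilon> (y - \<rho> * x)) * indicator E (x, y)" "\<rho> * x"]
      by simp
  qed
  also have "\<dots> = (\<integral>\<^sup>+x. \<integral>\<^sup>+y. ennreal (normal_density 0 \<sigma> x * normal_density 0 \<epsilon> (y - \<rho> * x)) *
      indicator E (x, y) \<partial>lborel \<partial>lborel)"
    by (subst nn_integral_cmult[symmetric]) (simp_all add: ennreal_mult mult_ac)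
  also have "\<dots> = (\<integral>\<^sup>+x. \<integral>\<^sup>+y. ennreal (normal_density 0 s y * normal_density 0 ?v (x - ?\<gamma> * y)) *
      indicator E (x, y) \<partial>lborel \<partial>lborel)"
    using normal_density_posterior[OF pos s] by simp
  \<comment> \<open>Here the order of generation is reversed: the observation becomes the outer
    variable.\<close>
  also have "\<dots> = (\<integral>\<^sup>+y. \<integral>\<^sup>+x. ennreal (normal_density 0 s y * normal_density 0 ?v (x - ?\<gamma> * y)) *
      indicator E (x, y) \<partial>lborel \<partial>lborel)"
    by (rule lborel_pair.Fubini'[symmetric]) measurable
  also have "\<dots> = (\<integral>\<^sup>+y. ennreal (normal_density 0 s y) *
      (\<integral>\<^sup>+x. ennreal (normal_density 0 ?v (x - ?\<gamma> * y)) * indicator E (x, y) \<partial>lborel) \<partial>lborel)"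
    by (subst nn_integral_cmult[symmetric]) (simp_all add: ennreal_mult mult_ac)
  also have "\<dots> = (\<integral>\<^sup>+y. ennreal (normal_density 0 s y) *
      (\<integral>\<^sup>+u. ennreal (normal_density 0 ?v u) * indicator E (?\<gamma> * y + u, y) \<partial>lborel) \<partial>lborel)"
  proof (rule nn_integral_cong, rule arg_cong2[where f = "(*)", OF refl])
    fix y
    show "(\<integral>\<^sup>+x. ennreal (normal_density 0 ?v (x - ?\<gamma> * y)) * indicator E (x, y) \<partial>lborel) =
        (\<integral>\<^sup>+u. ennreal (normal_density 0 ?v u) * indicator E (?\<gamma> * y + u, y) \<partial>lborel)"
      using nn_integral_lborel_shift[of "\<lambda>x. ennreal (normal_density 0 ?v (x - ?\<gamma> * y)) * indicator E (x, y)" "?\<gamma> * y"]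
      by simp
  qed
  also have "\<dots> = (\<integral>\<^sup>+y. \<integral>\<^sup>+u. indicator E (?\<gamma> * y + u, y) \<partial>gauss ?v \<partial>gauss s)"
    by (simp add: nn_integral_gauss)
  also have "\<dots> = (\<integral>\<^sup>+z. indicator E (?g z) \<partial>?Q)"
    by (subst pv.nn_integral_fst[symmetric]) (auto simp: split_beta')
  also have "\<dots> = emeasure (distr ?Q (borel \<Otimes>\<^sub>M borel) ?g) E"
    by (subst nn_integral_distr[OF g, of "indicator E", symmetric]) auto
  finally show "emeasure (distr ?P (borel \<Otimes>\<^sub>M borel) ?f) E = emeasure (distr ?Q (borel \<Otimes>\<^sub>M borel) ?g) E" .
qed simp

text \<open>Reduces a statement about two independent sequences to the laws of single coordinate
  pairs: the sequences are zipped and the maps \<open>f i\<close> are then absorbed into the factors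
  of the product.\<close>

lemma nn_integral_PiM_pair_map:
  fixes f :: "nat \<Rightarrow> real \<times> real \<Rightarrow> real \<times> real"
  assumes M: "\<And>i. prob_space (M i)" "\<And>i. sets (M i) = sets borel"
    and N: "\<And>i. prob_space (N i)" "\<And>i. sets (N i) = sets borel"
    and f: "\<And>i. f i \<in> measurable (borel \<Otimes>\<^sub>M borel) (borel \<Otimes>\<^sub>M borel)"
    and F: "F \<in> borel_measurable (\<Pi>\<^sub>M i\<in>UNIV. borel \<Otimes>\<^sub>M borel)"
  shows "(\<integral>\<^sup>+x. \<integral>\<^sup>+y. F (\<lambda>i. f i (x i, y i)) \<partial>PiM UNIV N \<partial>PiM UNIV M) =
    (\<integral>\<^sup>+z. F z \<partial>(\<Pi>\<^sub>M i\<in>UNIV. distr (M i \<Otimes>\<^sub>M N i) (borel \<Otimes>\<^sub>M borel) (f i)))"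
proof -
  note [measurable_cong] = M(2) N(2)
  let ?MN = "\<Pi>\<^sub>M i\<in>UNIV. M i \<Otimes>\<^sub>M N i" and ?B = "\<Pi>\<^sub>M i\<in>UNIV. borel \<Otimes>\<^sub>M borel :: (real \<times> real) measure"
  interpret PN: prob_space "PiM UNIV N" using N by (intro prob_space_PiM) auto
  have f' [measurable]: "f i \<in> measurable (M i \<Otimes>\<^sub>M N i) (borel \<Otimes>\<^sub>M borel)" for i
    using f by measurable
  have h: "(\<lambda>z i. f i (z i)) \<in> measurable ?MN ?B"
    by (rule measurable_PiM_single') (auto simp: space_PiM space_pair_measure)
  have g: "(\<lambda>(x, y) i. (x i, y i)) \<in> measurable (PiM UNIV M \<Otimes>\<^sub>M PiM UNIV N) ?MN"
    by (rule measurable_PiM_single') (auto simp: space_PiM space_pair_measure split_beta' M(2)[THEN sets_eq_imp_space_eq] N(2)[THEN sets_eq_imp_space_eq])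
  have Fh: "(\<lambda>z. F (\<lambda>i. f i (z i))) \<in> borel_measurable ?MN"
    using measurable_compose[OF h F] by simp
  have "(\<integral>\<^sup>+x. \<integral>\<^sup>+y. F (\<lambda>i. f i (x i, y i)) \<partial>PiM UNIV N \<partial>PiM UNIV M) =
      (\<integral>\<^sup>+p. F (\<lambda>i. f i ((\<lambda>(x, y) i. (x i, y i)) p i)) \<partial>(PiM UNIV M \<Otimes>\<^sub>M PiM UNIV N))"
    using measurable_compose[OF g Fh] by (subst PN.nn_integral_fst[symmetric]) auto
  also have "\<dots> = (\<integral>\<^sup>+z. F (\<lambda>i. f i (z i)) \<partial>distr (PiM UNIV M \<Otimes>\<^sub>M PiM UNIV N) ?MN (\<lambda>(x, y) i. (x i, y i)))"
    by (subst nn_integral_distr[OF g]) (use Fh in simp_all)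
  also have "\<dots> = (\<integral>\<^sup>+z. F (\<lambda>i. f i (z i)) \<partial>?MN)"
    using distr_PiM_zip[of UNIV M N] M(1) N(1) by (simp add: restrict_UNIV)
  also have "\<dots> = (\<integral>\<^sup>+z. F z \<partial>distr ?MN ?B (\<lambda>z i. f i (z i)))"
    by (subst nn_integral_distr[OF h]) (use F in simp_all)
  also have "distr ?MN ?B (\<lambda>z i. f i (z i)) = (\<Pi>\<^sub>M i\<in>UNIV. distr (M i \<Otimes>\<^sub>M N i) (borel \<Otimes>\<^sub>M borel) (f i))"
    using distr_PiM_map[of UNIV "\<lambda>i. M i \<Otimes>\<^sub>M N i" f "\<lambda>_. borel \<Otimes>\<^sub>M borel"] f' M(1) N(1)
    by (simp add: prob_space_pair restrict_UNIV)
  finally show ?thesis .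
qed

text \<open>Both iterated integrals are integrals of \<open>F\<close> against products of pair laws,
  and the factors agree by \<open>distr_gauss_posterior\<close>. \<open>F\<close> may depend on all
  coordinates of the observation jointly, as an encoder does.\<close>

lemma nn_integral_gauss_posterior:
  fixes \<sigma> \<rho> s :: "nat \<Rightarrow> real"
  assumes pos: "\<And>j. \<sigma> j > 0" "\<epsilon> > 0" "\<And>j. s j > 0" and s: "\<And>j. (s j)\<^sup>2 = (\<rho> j)\<^sup>2 * (\<sigma> j)\<^sup>2 + \<epsilon>\<^sup>2"
    and F: "F \<in> borel_measurable (\<Pi>\<^sub>M j\<in>UNIV. borel \<Otimes>\<^sub>M borel)"
  shows "(\<integral>\<^sup>+x. \<integral>\<^sup>+w. F (\<lambda>j. (x j, \<rho> j * x j + w j)) \<partial>(\<Pi>\<^sub>M j\<in>UNIV. gauss \<epsilon>) \<partial>(\<Pi>\<^sub>M j\<in>UNIV. gauss (\<sigma> j))) =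
    (\<integral>\<^sup>+y. \<integral>\<^sup>+u. F (\<lambda>j. (\<rho> j * (\<sigma> j)\<^sup>2 / (s j)\<^sup>2 * y j + u j, y j))
      \<partial>(\<Pi>\<^sub>M j\<in>UNIV. gauss (\<sigma> j * \<epsilon> / s j)) \<partial>(\<Pi>\<^sub>M j\<in>UNIV. gauss (s j)))"
  using nn_integral_PiM_pair_map[of "\<lambda>j. gauss (\<sigma> j)" "\<lambda>j. gauss \<epsilon>" "\<lambda>j (x, w). (x, \<rho> j * x + w)" F]
    nn_integral_PiM_pair_map[of "\<lambda>j. gauss (s j)" "\<lambda>j. gauss (\<sigma> j * \<epsilon> / s j)"
      "\<lambda>j (y, u). (\<rho> j * (\<sigma> j)\<^sup>2 / (s j)\<^sup>2 * y + u, y)" F]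
    distr_gauss_posterior[OF pos(1) pos(2) pos(3) s] F pos
  by (simp add: prob_space_gauss)

text \<open>Moving \<open>\<theta>\<close> out of the measure puts all data laws on one noise space,
  so that averaging the risk over a prior becomes an iterated integral over parameter and
  noise.\<close>

lemma gaussian_sequence_eq_distr:
  assumes "\<epsilon> > 0"
  shows "gaussian_sequence \<epsilon> \<theta> =
    distr (\<Pi>\<^sub>M j\<in>UNIV. gauss \<epsilon>) (\<Pi>\<^sub>M j\<in>UNIV. borel) (\<lambda>w j. \<theta> j + w j)"
proof -
  have "density lborel (\<lambda>y. ennreal (normal_density t \<epsilon> y)) = distr (gauss \<epsilon>) borel (\<lambda>w. t + w)" for t
  proof (rule measure_eqI)
    fix A assume "A \<in> sets (density lborel (\<lambda>y. ennreal (normal_density t \<epsilon> y)))"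
    then have [measurable]: "A \<in> sets borel" by simp
    have "emeasure (density lborel (\<lambda>y. ennreal (normal_density t \<epsilon> y))) A =
        (\<integral>\<^sup>+y. ennreal (normal_density t \<epsilon> y) * indicator A y \<partial>lborel)"
      by (subst emeasure_density) auto
    also have "\<dots> = (\<integral>\<^sup>+w. ennreal (normal_density 0 \<epsilon> w) * indicator A (t + w) \<partial>lborel)"
      by (subst nn_integral_lborel_shift[symmetric, where t = t]) (auto simp: normal_density_def)
    also have "\<dots> = (\<integral>\<^sup>+w. indicator A (t + w) \<partial>gauss \<epsilon>)"
      by (simp add: nn_integral_gauss)
    also have "\<dots> = (\<integral>\<^sup>+w. indicator A w \<partial>distr (gauss \<epsilon>) borel (\<lambda>w. t + w))"
      by (rule nn_integral_distr[symmetric]) auto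
    finally show "emeasure (density lborel (\<lambda>y. ennreal (normal_density t \<epsilon> y))) A =
        emeasure (distr (gauss \<epsilon>) borel (\<lambda>w. t + w)) A" by simp
  qed simp
  then show ?thesis
    unfolding gaussian_sequence_def
    using distr_PiM_map[of UNIV "\<lambda>_. gauss \<epsilon>" "\<lambda>j w. \<theta> j + w" "\<lambda>_. borel"] assms
    by (simp add: prob_space_gauss restrict_UNIV)
qed

subsection \<open>Bayes risk of a quantized estimator\<close>

lemma nn_integral_normal_density:
  assumes "\<sigma> > 0"
  shows "(\<integral>\<^sup>+x. ennreal (normal_density \<mu> \<sigma> x) \<partial>lborel) = 1"
  using assms by (subst nn_integral_eq_integral) auto

lemma nn_integral_gauss_power2:
  assumes "\<sigma> > 0"
  shows "(\<integral>\<^sup>+u. ennreal ((a + u)\<^sup>2) \<partial>gauss \<sigma>) = ennreal (a\<^sup>2 + \<sigma>\<^sup>2)"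
proof -
  have 1: "has_bochner_integral lborel (\<lambda>x. normal_density 0 \<sigma> x * x\<^sup>2) (\<sigma>\<^sup>2)"
    using normal_moment_even[OF assms, of 0 1] by simp
  have 2: "has_bochner_integral lborel (\<lambda>x. normal_density 0 \<sigma> x * x) 0"
    using normal_moment_nz_1[OF assms, of 0] by simp
  have 3: "has_bochner_integral lborel (normal_density 0 \<sigma>) 1"
    using assms by (simp add: has_bochner_integral_iff)
  have "has_bochner_integral lborel (\<lambda>x. normal_density 0 \<sigma> x * x\<^sup>2 +
      ((2 * a) * (normal_density 0 \<sigma> x * x) + a\<^sup>2 * normal_density 0 \<sigma> x)) (\<sigma>\<^sup>2 + ((2 * a) * 0 + a\<^sup>2 * 1))"
    by (intro has_bochner_integral_add has_bochner_integral_mult_right 1 2 3)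
  moreover have "(\<lambda>x. normal_density 0 \<sigma> x * x\<^sup>2 +
      ((2 * a) * (normal_density 0 \<sigma> x * x) + a\<^sup>2 * normal_density 0 \<sigma> x)) =
      (\<lambda>x. normal_density 0 \<sigma> x * (a + x)\<^sup>2)"
    by (rule ext) (simp add: power2_eq_square algebra_simps)
  ultimately have 4: "has_bochner_integral lborel (\<lambda>x. normal_density 0 \<sigma> x * (a + x)\<^sup>2) (a\<^sup>2 + \<sigma>\<^sup>2)"
    by (simp add: add.commute)
  have "(\<integral>\<^sup>+u. ennreal ((a + u)\<^sup>2) \<partial>gauss \<sigma>) =
      (\<integral>\<^sup>+u. ennreal (normal_density 0 \<sigma> u * (a + u)\<^sup>2) \<partial>lborel)"
    by (simp add: nn_integral_gauss ennreal_mult)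
  also have "\<dots> = ennreal (a\<^sup>2 + \<sigma>\<^sup>2)"
    using 4 by (subst nn_integral_eq_integral) (auto simp: has_bochner_integral_iff)
  finally show ?thesis .
qed

text \<open>Shannon's lower bound: the mixture of Gaussians of variance \<open>\<nu>\<close> centred at the code words
  has total mass 1, and \<open>1 + t \<le> exp t\<close> is applied to its log-density relative to the law of the source.\<close>

lemma quantization_error_ge:
  fixes \<gamma> s :: "nat \<Rightarrow> real" and q :: "nat \<Rightarrow> nat \<Rightarrow> real" and \<phi> :: "(nat \<Rightarrow> real) \<Rightarrow> nat"
  assumes s: "\<And>j. s j > 0" and \<gamma>: "\<And>j. j < n \<Longrightarrow> \<gamma> j > 0" and \<nu>: "\<nu> > 0"
    and \<phi>: "\<And>y. \<phi> y < N"
    and prod: "(\<Prod>j<n. \<gamma> j * s j) = real N * sqrt \<nu> ^ n"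
    and meas: "\<And>j. (\<lambda>y. q (\<phi> y) j) \<in> borel_measurable (\<Pi>\<^sub>M j\<in>UNIV. borel)"
  shows "ennreal (real n * \<nu>) \<le>
    (\<integral>\<^sup>+y. ennreal (\<Sum>j<n. (\<gamma> j * y j - q (\<phi> y) j)\<^sup>2) \<partial>(\<Pi>\<^sub>M j\<in>UNIV. gauss (s j)))"
proof -
  let ?P = "\<Pi>\<^sub>M j\<in>UNIV. gauss (s j)"
  have sP: "sets ?P = sets (\<Pi>\<^sub>M j\<in>UNIV. borel)" by (rule sets_PiM_cong) auto
  note [measurable_cong] = sP
  note meas [measurable]
  interpret P: prob_space ?P using s by (intro prob_space_PiM prob_space_gauss)
  define D where "D y = (\<Sum>j<n. (\<gamma> j * y j - q (\<phi> y) j)\<^sup>2)" for y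
  \<comment> \<open>\<open>g i j\<close> is the density, relative to \<open>gauss (s j)\<close>, of
    the normal law with mean \<open>q i j / \<gamma> j\<close> and standard deviation
    \<open>sqrt \<nu> / \<gamma> j\<close>; under that law \<open>\<gamma> j * y\<close> has
    variance \<open>\<nu>\<close> around the code word. Hence its integral is 1.\<close>
  define g where "g i j y = \<gamma> j * s j / sqrt \<nu> * exp (y\<^sup>2 / (2 * (s j)\<^sup>2) - (\<gamma> j * y - q i j)\<^sup>2 / (2 * \<nu>))"
    for i j y
  have N: "N > 0" using \<phi>[of undefined] by simp
  have [measurable]: "D \<in> borel_measurable ?P" unfolding D_def by measurable
  have [measurable]: "g i j \<in> borel_measurable borel" for i j unfolding g_def by measurable
  have g_nn: "g i j y \<ge> 0" if "j < n" for i j y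
    unfolding g_def using \<gamma>[OF that] s[of j] \<nu> by simp
  have g1: "(\<integral>\<^sup>+y. ennreal (g i j y) \<partial>gauss (s j)) = 1" if j: "j < n" for i j
  proof -
    have *: "normal_density 0 (s j) y * g i j y = normal_density (q i j / \<gamma> j) (sqrt \<nu> / \<gamma> j) y" for y
    proof -
      have "(\<gamma> j * y - q i j)\<^sup>2 / (2 * \<nu>) = (y - q i j / \<gamma> j)\<^sup>2 / (2 * (sqrt \<nu> / \<gamma> j)\<^sup>2)"
      proof -
        have "\<gamma> j * y - q i j = \<gamma> j * (y - q i j / \<gamma> j)" using \<gamma>[OF j] by (simp add: field_simps)
        then show ?thesis using \<nu> by (simp add: power_mult_distrib power_divide)
      qed
      moreover have "1 / sqrt (2 * pi * (s j)\<^sup>2) * (\<gamma> j * s j / sqrt \<nu>) = 1 / sqrt (2 * pi * (sqrt \<nu> / \<gamma> j)\<^sup>2)"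
        using \<gamma>[OF j] s[of j] \<nu> by (simp add: real_sqrt_mult real_sqrt_divide power_divide)
      moreover have "exp (- (y\<^sup>2 / (2 * (s j)\<^sup>2))) * exp (y\<^sup>2 / (2 * (s j)\<^sup>2) - (\<gamma> j * y - q i j)\<^sup>2 / (2 * \<nu>)) =
          exp (- ((\<gamma> j * y - q i j)\<^sup>2 / (2 * \<nu>)))"
        by (simp add: exp_add[symmetric])
      moreover have "normal_density 0 (s j) y * g i j y =
          (1 / sqrt (2 * pi * (s j)\<^sup>2) * (\<gamma> j * s j / sqrt \<nu>)) *
          (exp (- (y\<^sup>2 / (2 * (s j)\<^sup>2))) * exp (y\<^sup>2 / (2 * (s j)\<^sup>2) - (\<gamma> j * y - q i j)\<^sup>2 / (2 * \<nu>)))"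
        unfolding g_def normal_density_def by simp
      ultimately show ?thesis by (simp add: normal_density_def)
    qed
    have "(\<integral>\<^sup>+y. ennreal (g i j y) \<partial>gauss (s j)) =
        (\<integral>\<^sup>+y. ennreal (normal_density 0 (s j) y * g i j y) \<partial>lborel)"
      using g_nn[OF j] by (simp add: nn_integral_gauss ennreal_mult)
    also have "\<dots> = 1" unfolding * using \<gamma>[OF j] \<nu> by (intro nn_integral_normal_density) simp
    finally show ?thesis .
  qed
  \<comment> \<open>The hypothesis \<open>prod\<close> fixes \<open>\<nu>\<close> so that the
    prefactors of \<open>g\<close> multiply to exactly \<open>N\<close>. The exponential for the
    chosen code word is therefore one summand of the mixture with weights \<open>1 / N\<close>. The
    inequality is arranged with nonnegative terms on both sides, so that it can be integrated
    without integrability conditions.\<close>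
  have le: "(\<Sum>j<n. (y j)\<^sup>2 / (2 * (s j)\<^sup>2)) + 1 \<le> (\<Sum>i<N. (\<Prod>j<n. g i j (y j))) / N + D y / (2 * \<nu>)" for y
  proof -
    define A where "A = (\<Sum>j<n. (y j)\<^sup>2 / (2 * (s j)\<^sup>2)) - D y / (2 * \<nu>)"
    have "1 + A \<le> exp A" by (rule exp_ge_add_one_self)
    also have "exp A = (\<Prod>j<n. exp ((y j)\<^sup>2 / (2 * (s j)\<^sup>2) - (\<gamma> j * y j - q (\<phi> y) j)\<^sup>2 / (2 * \<nu>)))"
      by (simp add: A_def D_def exp_sum[symmetric] sum_subtractf sum_divide_distrib)
    also have "\<dots> = (\<Prod>j<n. g (\<phi> y) j (y j)) / N"
    proof -
      have "(\<Prod>j<n. g (\<phi> y) j (y j)) = (\<Prod>j<n. \<gamma> j * s j) / sqrt \<nu> ^ n *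
          (\<Prod>j<n. exp ((y j)\<^sup>2 / (2 * (s j)\<^sup>2) - (\<gamma> j * y j - q (\<phi> y) j)\<^sup>2 / (2 * \<nu>)))"
        by (simp add: g_def prod.distrib prod_dividef)
      then show ?thesis using N \<nu> unfolding prod by simp
    qed
    also have "\<dots> \<le> (\<Sum>i<N. (\<Prod>j<n. g i j (y j))) / N"
      using \<phi>[of y] g_nn by (intro divide_right_mono member_le_sum[of "\<phi> y" _ "\<lambda>i. \<Prod>j<n. g i j (y j)"] prod_nonneg) auto
    finally show ?thesis by (simp add: A_def)
  qed
  have L: "(\<integral>\<^sup>+y. ennreal ((\<Sum>j<n. (y j)\<^sup>2 / (2 * (s j)\<^sup>2)) + 1) \<partial>?P) = ennreal (real n / 2) + 1"
  proof -
    have "(\<integral>\<^sup>+y. ennreal ((y j)\<^sup>2 / (2 * (s j)\<^sup>2)) \<partial>?P) = ennreal (1 / 2)" for j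
    proof -
      have "(\<integral>\<^sup>+y. ennreal ((y j)\<^sup>2 / (2 * (s j)\<^sup>2)) \<partial>?P) = (\<integral>\<^sup>+x. ennreal (x\<^sup>2 / (2 * (s j)\<^sup>2)) \<partial>gauss (s j))"
        using s by (intro nn_integral_PiM_component prob_space_gauss) auto
      also have "\<dots> = (\<integral>\<^sup>+x. ennreal (1 / (2 * (s j)\<^sup>2)) * ennreal ((0 + x)\<^sup>2) \<partial>gauss (s j))"
        by (intro nn_integral_cong) (simp add: ennreal_mult[symmetric])
      also have "\<dots> = ennreal (1 / (2 * (s j)\<^sup>2)) * ennreal ((s j)\<^sup>2)"
        using nn_integral_gauss_power2[OF s[of j], of 0] by (subst nn_integral_cmult) auto
      also have "\<dots> = ennreal (1 / 2)" using s[of j] by (simp add: ennreal_mult[symmetric])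
      finally show ?thesis .
    qed
    then have "(\<integral>\<^sup>+y. (\<Sum>j<n. ennreal ((y j)\<^sup>2 / (2 * (s j)\<^sup>2))) + 1 \<partial>?P) = (\<Sum>j<n. ennreal (1 / 2)) + 1"
      by (subst nn_integral_add; (subst nn_integral_sum)?) (auto simp: P.emeasure_space_1)
    moreover have "(\<Sum>j<n. ennreal (1 / 2)) = ennreal (real n / 2)"
      by (subst sum_ennreal) auto
    ultimately show ?thesis
      by (simp add: sum_nonneg)
  qed
  have R: "(\<integral>\<^sup>+y. ennreal ((\<Sum>i<N. (\<Prod>j<n. g i j (y j))) / N) \<partial>?P) = 1"
  proof -
    have "(\<integral>\<^sup>+y. ennreal ((\<Sum>i<N. (\<Prod>j<n. g i j (y j))) / N) \<partial>?P) =
        (\<integral>\<^sup>+y. ennreal (1 / N) * (\<Sum>i<N. \<Prod>j<n. ennreal (g i j (y j))) \<partial>?P)"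
    proof (rule nn_integral_cong)
      fix y
      have "(\<Sum>i<N. \<Prod>j<n. ennreal (g i j (y j))) = (\<Sum>i<N. ennreal (\<Prod>j<n. g i j (y j)))"
        using g_nn by (intro sum.cong prod_ennreal) auto
      also have "\<dots> = ennreal (\<Sum>i<N. \<Prod>j<n. g i j (y j))"
        using g_nn by (intro sum_ennreal prod_nonneg) auto
      finally show "ennreal ((\<Sum>i<N. (\<Prod>j<n. g i j (y j))) / N) =
          ennreal (1 / N) * (\<Sum>i<N. \<Prod>j<n. ennreal (g i j (y j)))"
        by (simp add: ennreal_mult'[symmetric])
    qed
    also have "\<dots> = ennreal (1 / N) * (\<Sum>i<N. \<integral>\<^sup>+y. (\<Prod>j<n. ennreal (g i j (y j))) \<partial>?P)"
      by (subst nn_integral_cmult; (subst nn_integral_sum)?) auto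
    also have "\<dots> = ennreal (1 / N) * (\<Sum>i<N. 1)"
    proof -
      have "(\<integral>\<^sup>+y. (\<Prod>j<n. ennreal (g i j (y j))) \<partial>?P) = (\<Prod>j<n. \<integral>\<^sup>+y. ennreal (g i j y) \<partial>gauss (s j))" for i
        using s by (intro nn_integral_PiM_prod prob_space_gauss) auto
      then show ?thesis using g1 by simp
    qed
    also have "\<dots> = 1" using N by (simp add: ennreal_of_nat_eq_real_of_nat flip: ennreal_mult)
    finally show ?thesis .
  qed
  \<comment> \<open>Integrating \<open>le\<close>: the mass 1 of the mixture cancels the 1 on the
    left, which leaves \<open>n / 2\<close> against the expected error divided by
    \<open>2 * \<nu>\<close>.\<close>
  have "ennreal (real n / 2) + 1 \<le>
      (\<integral>\<^sup>+y. ennreal ((\<Sum>i<N. (\<Prod>j<n. g i j (y j))) / N) + ennreal (D y / (2 * \<nu>)) \<partial>?P)"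
    unfolding L[symmetric]
  proof (intro nn_integral_mono)
    fix y
    show "ennreal ((\<Sum>j<n. (y j)\<^sup>2 / (2 * (s j)\<^sup>2)) + 1) \<le>
        ennreal ((\<Sum>i<N. (\<Prod>j<n. g i j (y j))) / N) + ennreal (D y / (2 * \<nu>))"
      using le[of y] g_nn \<nu> by (subst ennreal_plus[symmetric])
        (auto intro!: ennreal_leI divide_nonneg_nonneg sum_nonneg prod_nonneg simp: D_def)
  qed
  also have "\<dots> = 1 + (\<integral>\<^sup>+y. ennreal (D y / (2 * \<nu>)) \<partial>?P)"
    by (subst nn_integral_add) (auto simp: R)
  finally have "ennreal (real n / 2) \<le> (\<integral>\<^sup>+y. ennreal (D y / (2 * \<nu>)) \<partial>?P)"
    by (simp add: add.commute[of _ 1])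
  then have "ennreal (2 * \<nu>) * ennreal (real n / 2) \<le> ennreal (2 * \<nu>) * (\<integral>\<^sup>+y. ennreal (D y / (2 * \<nu>)) \<partial>?P)"
    by (rule mult_left_mono) simp
  also have "\<dots> = (\<integral>\<^sup>+y. ennreal (D y) \<partial>?P)"
    using \<nu> by (subst nn_integral_cmult[symmetric]) (auto intro!: nn_integral_cong simp: ennreal_mult'[symmetric])
  finally show ?thesis
    using \<nu> by (simp add: D_def mult.commute flip: ennreal_mult)
qed

text \<open>Given the observation, the parameter is the posterior mean plus a centred independent
  error, so the loss is the sum of posterior variances plus the error of quantizing the posterior
  mean. The latter has standard deviation \<open>(\<sigma> j)\<^sup>2 / sqrt ((\<sigma> j)\<^sup>2 +
  \<epsilon>\<^sup>2)\<close> in coordinate \<open>j\<close>, which is where the product in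
  \<open>prod\<close> comes from.\<close>

lemma bayes_quantization_risk_ge:
  fixes \<sigma> :: "nat \<Rightarrow> real" and q :: "nat \<Rightarrow> nat \<Rightarrow> real" and \<phi> :: "(nat \<Rightarrow> real) \<Rightarrow> nat"
  assumes \<sigma>: "\<And>j. \<sigma> j > 0" and \<epsilon>: "\<epsilon> > 0" and \<nu>: "\<nu> > 0" and \<phi>: "\<And>y. \<phi> y < N"
    and prod: "(\<Prod>j<n. (\<sigma> j)\<^sup>2 / sqrt ((\<sigma> j)\<^sup>2 + \<epsilon>\<^sup>2)) = real N * sqrt \<nu> ^ n"
    and meas: "\<And>j. (\<lambda>y. q (\<phi> y) j) \<in> borel_measurable (\<Pi>\<^sub>M j\<in>UNIV. borel)"
  shows "ennreal ((\<Sum>j<n. (\<sigma> j)\<^sup>2 * \<epsilon>\<^sup>2 / ((\<sigma> j)\<^sup>2 + \<epsilon>\<^sup>2)) + real n * \<nu>) \<le>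
    (\<integral>\<^sup>+x. \<integral>\<^sup>+w. ennreal (\<Sum>j<n. (x j - q (\<phi> (\<lambda>j. (if j < n then x j else 0) + w j)) j)\<^sup>2)
      \<partial>(\<Pi>\<^sub>M j\<in>UNIV. gauss \<epsilon>) \<partial>(\<Pi>\<^sub>M j\<in>UNIV. gauss (\<sigma> j)))"
proof -
  \<comment> \<open>A switch for the signal: from coordinate \<open>n\<close> on the posterior mean
    is 0 and the observation is noise, yet the whole sequence keeps one uniform form.\<close>
  define \<rho> :: "nat \<Rightarrow> real" where "\<rho> j = (if j < n then 1 else 0)" for j
  define s where "s j = sqrt ((\<rho> j)\<^sup>2 * (\<sigma> j)\<^sup>2 + \<epsilon>\<^sup>2)" for j
  define \<gamma> where "\<gamma> j = \<rho> j * (\<sigma> j)\<^sup>2 / (s j)\<^sup>2" for j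
  define v where "v j = \<sigma> j * \<epsilon> / s j" for j
  have "(\<rho> j)\<^sup>2 * (\<sigma> j)\<^sup>2 + \<epsilon>\<^sup>2 > 0" for j
    using \<epsilon> by (intro add_nonneg_pos) auto
  then have s: "s j > 0" and s2: "(s j)\<^sup>2 = (\<rho> j)\<^sup>2 * (\<sigma> j)\<^sup>2 + \<epsilon>\<^sup>2" for j
    by (auto simp: s_def less_imp_le)
  have \<gamma>: "\<gamma> j > 0" if "j < n" for j
    using that \<sigma>[of j] s[of j] by (simp add: \<gamma>_def \<rho>_def)
  have v: "v j > 0" for j using \<sigma>[of j] s[of j] \<epsilon> by (simp add: v_def)
  have \<gamma>s: "(\<Prod>j<n. \<gamma> j * s j) = real N * sqrt \<nu> ^ n"
    unfolding prod[symmetric]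
  proof (rule prod.cong)
    fix j assume "j \<in> {..<n}"
    then have 1: "s j = sqrt ((\<sigma> j)\<^sup>2 + \<epsilon>\<^sup>2)" and 2: "\<gamma> j = (\<sigma> j)\<^sup>2 / (s j)\<^sup>2"
      by (simp_all only: s_def \<gamma>_def \<rho>_def lessThan_iff if_True power_one mult_1)
    have "\<gamma> j * s j = (\<sigma> j)\<^sup>2 / s j"
      unfolding 2 using s[of j] by (simp add: power2_eq_square[of "s j"])
    then show "\<gamma> j * s j = (\<sigma> j)\<^sup>2 / sqrt ((\<sigma> j)\<^sup>2 + \<epsilon>\<^sup>2)" by (simp only: 1)
  qed simp
  let ?Y = "\<Pi>\<^sub>M j\<in>UNIV. gauss (s j)" and ?V = "\<Pi>\<^sub>M j\<in>UNIV. gauss (v j)"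
  have sY: "sets ?Y = sets (\<Pi>\<^sub>M j\<in>UNIV. borel)" and sV: "sets ?V = sets (\<Pi>\<^sub>M j\<in>UNIV. borel)"
    by (rule sets_PiM_cong; simp)+
  note [measurable_cong] = sY sV
  note meas [measurable]
  interpret Y: prob_space ?Y using s by (intro prob_space_PiM prob_space_gauss)
  interpret V: prob_space ?V using v by (intro prob_space_PiM prob_space_gauss)
  define F :: "(nat \<Rightarrow> real \<times> real) \<Rightarrow> ennreal"
    where "F z = ennreal (\<Sum>j<n. (fst (z j) - q (\<phi> (\<lambda>j. snd (z j))) j)\<^sup>2)" for z
  have snd: "(\<lambda>z j. snd (z j)) \<in> measurable (\<Pi>\<^sub>M j\<in>UNIV. borel \<Otimes>\<^sub>M borel) (\<Pi>\<^sub>M j\<in>UNIV. borel :: real measure)"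
    by (rule measurable_PiM_single') auto
  have [measurable]: "(\<lambda>z. q (\<phi> (\<lambda>j. snd (z j))) j) \<in> borel_measurable (\<Pi>\<^sub>M j\<in>UNIV. borel \<Otimes>\<^sub>M borel)" for j
    using measurable_compose[OF snd meas[of j]] by simp
  have F: "F \<in> borel_measurable (\<Pi>\<^sub>M j\<in>UNIV. borel \<Otimes>\<^sub>M borel)"
    unfolding F_def by measurable
  have "ennreal ((\<Sum>j<n. (\<sigma> j)\<^sup>2 * \<epsilon>\<^sup>2 / ((\<sigma> j)\<^sup>2 + \<epsilon>\<^sup>2)) + real n * \<nu>) =
      ennreal (\<Sum>j<n. (v j)\<^sup>2) + ennreal (real n * \<nu>)"
  proof -
    have "(\<Sum>j<n. (\<sigma> j)\<^sup>2 * \<epsilon>\<^sup>2 / ((\<sigma> j)\<^sup>2 + \<epsilon>\<^sup>2)) = (\<Sum>j<n. (v j)\<^sup>2)"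
      by (intro sum.cong) (auto simp: v_def power_divide power_mult_distrib s2 \<rho>_def)
    then show ?thesis using \<nu> by (simp add: sum_nonneg)
  qed
  also have "\<dots> \<le> ennreal (\<Sum>j<n. (v j)\<^sup>2) + (\<integral>\<^sup>+y. ennreal (\<Sum>j<n. (\<gamma> j * y j - q (\<phi> y) j)\<^sup>2) \<partial>?Y)"
    by (intro add_left_mono quantization_error_ge[OF s \<gamma> \<nu> \<phi> \<gamma>s meas])
  also have "\<dots> = (\<integral>\<^sup>+y. ennreal (\<Sum>j<n. (v j)\<^sup>2) + ennreal (\<Sum>j<n. (\<gamma> j * y j - q (\<phi> y) j)\<^sup>2) \<partial>?Y)"
    by (subst nn_integral_add) (auto simp: Y.emeasure_space_1)
  also have "\<dots> = (\<integral>\<^sup>+y. \<integral>\<^sup>+u. F (\<lambda>j. (\<gamma> j * y j + u j, y j)) \<partial>?V \<partial>?Y)"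
  \<comment> \<open>For fixed \<open>y\<close> the code word is a constant, and the centred
    \<open>u\<close> leaves no cross term: squared bias plus variance in every coordinate.\<close>
  proof (intro nn_integral_cong)
    fix y
    have "(\<integral>\<^sup>+u. F (\<lambda>j. (\<gamma> j * y j + u j, y j)) \<partial>?V) =
        (\<integral>\<^sup>+u. (\<Sum>j<n. ennreal (((\<gamma> j * y j - q (\<phi> y) j) + u j)\<^sup>2)) \<partial>?V)"
      unfolding F_def by (intro nn_integral_cong) (simp add: algebra_simps)
    also have "\<dots> = (\<Sum>j<n. \<integral>\<^sup>+u. ennreal (((\<gamma> j * y j - q (\<phi> y) j) + u j)\<^sup>2) \<partial>?V)"
      by (rule nn_integral_sum) measurable
    also have "\<dots> = (\<Sum>j<n. \<integral>\<^sup>+u. ennreal (((\<gamma> j * y j - q (\<phi> y) j) + u)\<^sup>2) \<partial>gauss (v j))"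
    proof (rule sum.cong[OF refl])
      fix j
      show "(\<integral>\<^sup>+u. ennreal (((\<gamma> j * y j - q (\<phi> y) j) + u j)\<^sup>2) \<partial>?V) =
          (\<integral>\<^sup>+u. ennreal (((\<gamma> j * y j - q (\<phi> y) j) + u)\<^sup>2) \<partial>gauss (v j))"
        using v by (intro nn_integral_PiM_component[where M = "\<lambda>j. gauss (v j)" and f = "\<lambda>u. ennreal (((\<gamma> j * y j - q (\<phi> y) j) + u)\<^sup>2)"] prob_space_gauss) auto
    qed
    also have "\<dots> = (\<Sum>j<n. ennreal ((\<gamma> j * y j - q (\<phi> y) j)\<^sup>2 + (v j)\<^sup>2))"
      using v by (simp add: nn_integral_gauss_power2)
    also have "\<dots> = ennreal (\<Sum>j<n. (v j)\<^sup>2) + ennreal (\<Sum>j<n. (\<gamma> j * y j - q (\<phi> y) j)\<^sup>2)"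
      by (simp add: sum.distrib sum_nonneg add.commute flip: ennreal_plus)
    finally show "ennreal (\<Sum>j<n. (v j)\<^sup>2) + ennreal (\<Sum>j<n. (\<gamma> j * y j - q (\<phi> y) j)\<^sup>2) =
        (\<integral>\<^sup>+u. F (\<lambda>j. (\<gamma> j * y j + u j, y j)) \<partial>?V)" ..
  qed
  also have "\<dots> = (\<integral>\<^sup>+x. \<integral>\<^sup>+w. F (\<lambda>j. (x j, \<rho> j * x j + w j)) \<partial>(\<Pi>\<^sub>M j\<in>UNIV. gauss \<epsilon>) \<partial>(\<Pi>\<^sub>M j\<in>UNIV. gauss (\<sigma> j)))"
    using nn_integral_gauss_posterior[OF \<sigma> \<epsilon> s s2 F] by (simp add: \<gamma>_def v_def)
  also have "\<dots> = (\<integral>\<^sup>+x. \<integral>\<^sup>+w. ennreal (\<Sum>j<n. (x j - q (\<phi> (\<lambda>j. (if j < n then x j else 0) + w j)) j)\<^sup>2)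
      \<partial>(\<Pi>\<^sub>M j\<in>UNIV. gauss \<epsilon>) \<partial>(\<Pi>\<^sub>M j\<in>UNIV. gauss (\<sigma> j)))"
  proof -
    have "\<rho> j * t = (if j < n then t else 0)" for j t by (simp add: \<rho>_def)
    then show ?thesis by (simp add: F_def)
  qed
  finally show ?thesis .
qed

subsection \<open>Passing from the Gaussian prior to the ellipsoid\<close>

lemma nn_integral_gauss_exp_power2:
  assumes \<sigma>: "\<sigma> > 0" and t: "2 * t * \<sigma>\<^sup>2 < 1"
  shows "(\<integral>\<^sup>+x. ennreal (exp (t * x\<^sup>2)) \<partial>gauss \<sigma>) = ennreal (1 / sqrt (1 - 2 * t * \<sigma>\<^sup>2))"
proof -
  define r where "r = sqrt (1 - 2 * t * \<sigma>\<^sup>2)"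
  have r: "r > 0" and r2: "r\<^sup>2 = 1 - 2 * t * \<sigma>\<^sup>2" using t by (auto simp: r_def)
  have *: "normal_density 0 \<sigma> x * exp (t * x\<^sup>2) = 1 / r * normal_density 0 (\<sigma> / r) x" for x
  proof -
    have "t * x\<^sup>2 + - (x\<^sup>2 / (2 * \<sigma>\<^sup>2)) = - (x\<^sup>2 / (2 * (\<sigma> / r)\<^sup>2))"
      unfolding power_divide r2 using \<sigma> t by (simp add: field_simps)
    then have "exp (t * x\<^sup>2) * exp (- (x\<^sup>2 / (2 * \<sigma>\<^sup>2))) = exp (- (x\<^sup>2 / (2 * (\<sigma> / r)\<^sup>2)))"
      by (simp only: exp_add[symmetric])
    moreover have "1 / sqrt (2 * pi * \<sigma>\<^sup>2) = 1 / r * (1 / sqrt (2 * pi * (\<sigma> / r)\<^sup>2))"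
      using r \<sigma> by (simp add: real_sqrt_mult power_divide real_sqrt_divide)
    ultimately show ?thesis
      unfolding normal_density_def by (simp add: mult_ac)
  qed
  have "(\<integral>\<^sup>+x. ennreal (exp (t * x\<^sup>2)) \<partial>gauss \<sigma>) =
      (\<integral>\<^sup>+x. ennreal (normal_density 0 \<sigma> x * exp (t * x\<^sup>2)) \<partial>lborel)"
    by (simp add: nn_integral_gauss ennreal_mult)
  also have "\<dots> = (\<integral>\<^sup>+x. ennreal (1 / r) * ennreal (normal_density 0 (\<sigma> / r) x) \<partial>lborel)"
    unfolding * using r by (intro nn_integral_cong ennreal_mult) auto
  also have "\<dots> = ennreal (1 / r)"
    using r \<sigma> by (subst nn_integral_cmult) (auto simp: nn_integral_normal_density)
  finally show ?thesis by (simp add: r_def)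
qed

text \<open>With \<open>w = 2 * t * \<sigma>\<^sup>2\<close> the left side is the exponential moment
  of \<open>t * x\<^sup>2\<close>; \<open>w / 2\<close> is the mean of that variable and
  \<open>w\<^sup>2\<close> a second-order surcharge. The range of \<open>w\<close> matches the bound
  \<open>1 / 4\<close> in \<open>nn_integral_PiM_gauss_exp_le\<close>.\<close>

lemma inverse_sqrt_one_minus_le_exp:
  fixes w :: real
  assumes "0 \<le> w" "w \<le> 1 / 2"
  shows "1 / sqrt (1 - w) \<le> exp (w / 2 + w\<^sup>2)"
proof -
  have "- w - 2 * w\<^sup>2 \<le> ln (1 - w)"
    using ln_one_minus_pos_lower_bound[of w] assms by simp
  then have "exp (- w - 2 * w\<^sup>2) \<le> 1 - w"
    using assms ln_ge_iff[of "1 - w" "- w - 2 * w\<^sup>2"] by simp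
  then have "sqrt (exp (- w - 2 * w\<^sup>2)) \<le> sqrt (1 - w)" by simp
  moreover have "sqrt (exp (- w - 2 * w\<^sup>2)) = exp (- (w / 2 + w\<^sup>2))"
    by (rule real_sqrt_unique) (auto simp: power2_eq_square[of "exp _"] exp_add[symmetric])
  ultimately have "1 / sqrt (1 - w) \<le> 1 / exp (- (w / 2 + w\<^sup>2))"
    using assms by (intro divide_left_mono) auto
  then show ?thesis by (simp add: exp_minus field_simps)
qed

lemma nn_integral_PiM_gauss_exp_le:
  fixes a \<sigma> :: "nat \<Rightarrow> real"
  assumes \<sigma>: "\<And>j. \<sigma> j > 0" and t: "t \<ge> 0" and a: "\<And>j. j < n \<Longrightarrow> a j \<ge> 0"
    and small: "\<And>j. j < n \<Longrightarrow> t * (a j * (\<sigma> j)\<^sup>2) \<le> 1 / 4"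
  shows "(\<integral>\<^sup>+x. ennreal (exp (t * (\<Sum>j<n. a j * (x j)\<^sup>2))) \<partial>(\<Pi>\<^sub>M j\<in>UNIV. gauss (\<sigma> j))) \<le>
    ennreal (exp (t * (\<Sum>j<n. a j * (\<sigma> j)\<^sup>2) + 4 * t\<^sup>2 * (\<Sum>j<n. (a j * (\<sigma> j)\<^sup>2)\<^sup>2)))"
proof -
  let ?P = "\<Pi>\<^sub>M j\<in>UNIV. gauss (\<sigma> j)"
  have "(\<integral>\<^sup>+x. ennreal (exp (t * (\<Sum>j<n. a j * (x j)\<^sup>2))) \<partial>?P) =
      (\<integral>\<^sup>+x. (\<Prod>j<n. ennreal (exp ((t * a j) * (x j)\<^sup>2))) \<partial>?P)"
    by (intro nn_integral_cong) (simp add: prod_ennreal exp_sum[symmetric] sum_distrib_left mult.assoc)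
  also have "\<dots> = (\<Prod>j<n. \<integral>\<^sup>+x. ennreal (exp ((t * a j) * x\<^sup>2)) \<partial>gauss (\<sigma> j))"
    using \<sigma> by (intro nn_integral_PiM_prod prob_space_gauss) auto
  also have "\<dots> \<le> (\<Prod>j<n. ennreal (exp (t * (a j * (\<sigma> j)\<^sup>2) + 4 * t\<^sup>2 * (a j * (\<sigma> j)\<^sup>2)\<^sup>2)))"
  proof (rule prod_mono_ennreal)
    fix j assume j: "j \<in> {..<n}"
    define w where "w = 2 * (t * a j) * (\<sigma> j)\<^sup>2"
    have w: "0 \<le> w" "w \<le> 1 / 2"
      using t a[of j] small[of j] j by (auto simp: w_def mult.assoc)
    have "(\<integral>\<^sup>+x. ennreal (exp ((t * a j) * x\<^sup>2)) \<partial>gauss (\<sigma> j)) = ennreal (1 / sqrt (1 - w))"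
      using nn_integral_gauss_exp_power2[OF \<sigma>[of j], of "t * a j"] w by (simp add: w_def)
    also have "\<dots> \<le> ennreal (exp (w / 2 + w\<^sup>2))"
      using inverse_sqrt_one_minus_le_exp[OF w] by (rule ennreal_leI)
    also have "w / 2 + w\<^sup>2 = t * (a j * (\<sigma> j)\<^sup>2) + 4 * t\<^sup>2 * (a j * (\<sigma> j)\<^sup>2)\<^sup>2"
      by (simp add: w_def power_mult_distrib)
    finally show "(\<integral>\<^sup>+x. ennreal (exp ((t * a j) * x\<^sup>2)) \<partial>gauss (\<sigma> j)) \<le>
      ennreal (exp (t * (a j * (\<sigma> j)\<^sup>2) + 4 * t\<^sup>2 * (a j * (\<sigma> j)\<^sup>2)\<^sup>2))" .
  qed
  also have "\<dots> = ennreal (exp (t * (\<Sum>j<n. a j * (\<sigma> j)\<^sup>2) + 4 * t\<^sup>2 * (\<Sum>j<n. (a j * (\<sigma> j)\<^sup>2)\<^sup>2)))"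
    by (simp add: prod_ennreal exp_sum[symmetric] sum.distrib sum_distrib_left)
  finally show ?thesis .
qed

section \<open>From Bayes risk to the supremum over the ellipsoid\<close>

lemma ell2_diff:
  assumes "f \<in> ell2" "g \<in> ell2"
  shows "summable (\<lambda>j. (f j - g j)\<^sup>2)"
proof (rule summable_comparison_test')
  show "summable (\<lambda>j. 2 * (f j)\<^sup>2 + 2 * (g j)\<^sup>2)"
    using assms by (intro summable_add summable_mult) (auto simp: ell2_def)
  fix j :: nat assume "0 \<le> j"
  have "0 \<le> (f j + g j)\<^sup>2" by simp
  then have "(f j - g j)\<^sup>2 \<le> 2 * (f j)\<^sup>2 + 2 * (g j)\<^sup>2"
    by (simp add: power2_eq_square algebra_simps)
  then show "norm ((f j - g j)\<^sup>2) \<le> 2 * (f j)\<^sup>2 + 2 * (g j)\<^sup>2" by simp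
qed

lemma finite_support_in_sobolev_ellipsoid:
  assumes "(\<Sum>j<n. (sobolev_weight m j)\<^sup>2 * (x j)\<^sup>2) \<le> c\<^sup>2 / pi powr (2 * m)"
  shows "(\<lambda>j. if j < n then x j else 0) \<in> sobolev_ellipsoid m c"
proof -
  let ?\<theta> = "\<lambda>j. if j < n then x j else 0"
  have "(\<lambda>j. (?\<theta> j)\<^sup>2) sums (\<Sum>j<n. (?\<theta> j)\<^sup>2)"
    by (rule sums_finite) auto
  moreover have *: "(\<lambda>j. (sobolev_weight m j)\<^sup>2 * (?\<theta> j)\<^sup>2) sums
      (\<Sum>j<n. (sobolev_weight m j)\<^sup>2 * (?\<theta> j)\<^sup>2)"
    by (rule sums_finite) auto
  ultimately show ?thesis
    using assms by (auto simp: sobolev_ellipsoid_def ell2_def sums_iff)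
qed

lemma sobolev_weight_ge_1: "m \<ge> 0 \<Longrightarrow> sobolev_weight m j \<ge> 1"
  by (auto simp: sobolev_weight_def intro: ge_one_powr_ge_zero)

text \<open>The Bayes risk is split by whether the prior draw lies in the ellipsoid: inside, the
  supremum of the risk dominates; outside, the loss is integrated against a Chernoff weight.
  \<open>\<delta>\<close> is the slack of the expected weighted norm below the squared radius
  \<open>C\<close>, and \<open>K / n\<close> caps the share of one coordinate, which makes the
  deviation exponentially unlikely in \<open>n\<close>.\<close>

lemma quantized_minimax_risk_ge:
  fixes \<sigma> :: "nat \<Rightarrow> real" and m c :: real
  defines "u \<equiv> \<lambda>j. (sobolev_weight m j)\<^sup>2 * (\<sigma> j)\<^sup>2"
    and "C \<equiv> c\<^sup>2 / pi powr (2 * m)"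
  assumes m: "m \<ge> 0" and c: "c \<noteq> 0" and \<epsilon>: "\<epsilon> > 0" and \<sigma>: "\<And>j. \<sigma> j > 0"
    and \<delta>: "0 < \<delta>" "\<delta> \<le> 1" and K: "K > 0" and n: "n > 0" "real n \<ge> 8 * K / (\<delta> * C)"
    and u: "\<And>j. j < n \<Longrightarrow> u j \<le> K / n" and U: "(\<Sum>j<n. u j) \<le> (1 - \<delta>) * C"
  shows "ennreal ((\<Sum>j<n. (\<sigma> j)\<^sup>2 * \<epsilon>\<^sup>2 / ((\<sigma> j)\<^sup>2 + \<epsilon>\<^sup>2)) +
      real n * exp ((\<Sum>j<n. ln (((\<sigma> j)\<^sup>2)\<^sup>2 / ((\<sigma> j)\<^sup>2 + \<epsilon>\<^sup>2))) / n - 2 * B * ln 2 / n)) \<le>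
    quantized_minimax_risk \<epsilon> m c B +
      ennreal ((2 * C + 2 * real n * C) * exp (- (C * \<delta>\<^sup>2 / (16 * K)) * n))" (is "?L \<le> _ + ?err")
proof -
  \<comment> \<open>The Chernoff tilt. As the sum of \<open>(u j)\<^sup>2\<close> is at most
    \<open>K / n * C\<close>, this value makes the quadratic term at most
    \<open>t * C * \<delta> / 2\<close>, half of the linear gain \<open>t * C * \<delta>\<close>;
    the other half is the exponent in \<open>?err\<close>. The lower bound on \<open>n\<close> says
    precisely \<open>t \<ge> 1 / C\<close>, used for draws outside the ellipsoid.\<close>
  define t where "t = \<delta> / (8 * K) * n"
  have C: "C > 0" using c by (simp add: C_def)
  have t: "t > 0" "t \<ge> 1 / C"
    using \<delta> K n C by (auto simp: t_def field_simps)
  let ?a = "\<lambda>j. (sobolev_weight m j)\<^sup>2"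
  let ?X = "\<Pi>\<^sub>M j\<in>UNIV. gauss (\<sigma> j)" and ?W = "\<Pi>\<^sub>M j\<in>(UNIV :: nat set). gauss \<epsilon>"
  have sX: "sets ?X = sets (\<Pi>\<^sub>M j\<in>UNIV. borel)" and sW: "sets ?W = sets (\<Pi>\<^sub>M j\<in>UNIV. borel)"
    by (rule sets_PiM_cong; simp)+
  note [measurable_cong] = sX sW
  interpret X: prob_space ?X using \<sigma> by (intro prob_space_PiM prob_space_gauss)
  interpret W: prob_space ?W using \<epsilon> by (intro prob_space_PiM prob_space_gauss)
  have a1: "?a j \<ge> 1" for j using sobolev_weight_ge_1[OF m, of j] by simp
  have u0: "u j \<ge> 0" for j by (simp add: u_def)
  define S where "S x = (\<Sum>j<n. ?a j * (x j)\<^sup>2)" for x :: "nat \<Rightarrow> real"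
  have [measurable]: "S \<in> borel_measurable ?X" unfolding S_def by measurable
  have chernoff: "(\<integral>\<^sup>+x. ennreal ((2 * C + 2 * real n * C) * exp (t * (S x - C))) \<partial>?X) \<le> ?err"
  proof -
    have tu: "t * u j \<le> 1 / 4" if "j < n" for j
    proof -
      have "t * u j \<le> t * (K / n)" using u[OF that] t by (intro mult_left_mono) auto
      also have "\<dots> \<le> 1 / 4" using \<delta> K n by (simp add: t_def)
      finally show ?thesis .
    qed
    have "(\<Sum>j<n. (u j)\<^sup>2) \<le> (\<Sum>j<n. K / n * u j)"
      unfolding power2_eq_square using u u0 by (intro sum_mono mult_right_mono) auto
    also have "\<dots> \<le> K / n * C"
      unfolding sum_distrib_left[symmetric] using U K \<delta> C
      by (intro mult_left_mono order_trans[OF U]) (auto simp: mult_left_le_one_le)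
    finally have "4 * t\<^sup>2 * (\<Sum>j<n. (u j)\<^sup>2) \<le> 4 * t\<^sup>2 * (K / n * C)" by (intro mult_left_mono) auto
    also have "\<dots> = t * C * \<delta> / 2"
      using K n by (simp add: t_def power2_eq_square)
    finally have 1: "4 * t\<^sup>2 * (\<Sum>j<n. (u j)\<^sup>2) \<le> t * C * \<delta> / 2" .
    have 2: "t * (\<Sum>j<n. u j) \<le> t * ((1 - \<delta>) * C)" using U t by (intro mult_left_mono) auto
    have 3: "t * C * \<delta> / 2 = C * \<delta>\<^sup>2 / (16 * K) * n" by (simp add: t_def power2_eq_square)
    have 4: "t * (\<Sum>j<n. u j) + 4 * t\<^sup>2 * (\<Sum>j<n. (u j)\<^sup>2) - t * C \<le> - (C * \<delta>\<^sup>2 / (16 * K)) * n"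
      using 1 2 3 by (simp add: algebra_simps)
    have "(\<integral>\<^sup>+x. ennreal ((2 * C + 2 * real n * C) * exp (t * (S x - C))) \<partial>?X) =
        (\<integral>\<^sup>+x. ennreal ((2 * C + 2 * real n * C) * exp (- (t * C))) * ennreal (exp (t * S x)) \<partial>?X)"
      using C by (intro nn_integral_cong) (simp add: right_diff_distrib exp_diff exp_minus field_simps flip: ennreal_mult)
    also have "\<dots> = ennreal ((2 * C + 2 * real n * C) * exp (- (t * C))) * (\<integral>\<^sup>+x. ennreal (exp (t * S x)) \<partial>?X)"
      by (rule nn_integral_cmult) measurable
    also have "\<dots> \<le> ennreal ((2 * C + 2 * real n * C) * exp (- (t * C))) *
        ennreal (exp (t * (\<Sum>j<n. u j) + 4 * t\<^sup>2 * (\<Sum>j<n. (u j)\<^sup>2)))"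
      unfolding S_def u_def using \<sigma> t tu a1
      by (intro mult_left_mono nn_integral_PiM_gauss_exp_le) (auto simp: u_def)
    also have "\<dots> = ennreal ((2 * C + 2 * real n * C) * exp (t * (\<Sum>j<n. u j) + 4 * t\<^sup>2 * (\<Sum>j<n. (u j)\<^sup>2) - t * C))"
      using C by (simp add: exp_diff exp_minus field_simps flip: ennreal_mult)
    also have "\<dots> \<le> ?err"
      using 4 C by (intro ennreal_leI mult_left_mono) auto
    finally show ?thesis .
  qed
  have "?L \<le> (SUP \<theta> \<in> sobolev_ellipsoid m c. sq_risk \<epsilon> est \<theta>) + ?err"
    if est: "est \<in> estimators" "within_budget B est" for est
  proof -
    define R where "R = (SUP \<theta> \<in> sobolev_ellipsoid m c. sq_risk \<epsilon> est \<theta>)"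
    from est(2) obtain N :: nat and \<phi> \<psi> where N: "real N \<le> 2 powr B" and \<phi>: "\<And>y. \<phi> y < N"
      and \<psi>: "est = \<psi> \<circ> \<phi>"
      by (auto simp: within_budget_def)
    have N0: "N > 0" using \<phi>[of undefined] by simp
    have "est \<in> measurable (\<Pi>\<^sub>M j\<in>UNIV. borel) (\<Pi>\<^sub>M j\<in>UNIV. borel)"
      using est(1) by (simp add: estimators_def)
    then have est_meas: "(\<lambda>y. est y j) \<in> borel_measurable (\<Pi>\<^sub>M j\<in>UNIV. borel)" for j
      by (rule measurable_compose[OF _ measurable_component_singleton]) simp
    have est_ell2: "est y \<in> ell2" for y using est(1) by (auto simp: estimators_def)
    note est_meas [measurable]
    \<comment> \<open>All weights are at least 1, so the ellipsoid lies in the box of half-width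
      \<open>sqrt C\<close>. Clipping never increases the error for a parameter in the box, keeps
      the loss under control elsewhere, and acts on code words, so their number stays
      \<open>N\<close>.\<close>
    define q where "q i j = max (- sqrt C) (min (sqrt C) (\<psi> i j))" for i j
    have q_est: "q (\<phi> y) j = max (- sqrt C) (min (sqrt C) (est y j))" for y j
      by (simp add: q_def \<psi>)
    have q2: "(q i j)\<^sup>2 \<le> C" for i j
    proof -
      have "0 \<le> sqrt C" using C by simp
      then have "\<bar>q i j\<bar> \<le> sqrt C" unfolding q_def by linarith
      then show ?thesis using C by (metis abs_ge_zero power2_abs power_mono real_sqrt_pow2 less_imp_le)
    qed
    have q_meas: "(\<lambda>y. q (\<phi> y) j) \<in> borel_measurable (\<Pi>\<^sub>M j\<in>UNIV. borel)" for j
      unfolding q_est by measurable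
    note q_meas [measurable]
    define \<theta> where "\<theta> x j = (if j < n then x j else 0)" for x :: "nat \<Rightarrow> real" and j
    have shift: "(\<lambda>w j. \<theta> x j + w j) \<in> measurable ?W (\<Pi>\<^sub>M j\<in>UNIV. borel)" for x
      by (rule measurable_PiM_single') auto
    define I where "I x = (\<integral>\<^sup>+w. ennreal (\<Sum>j<n. (x j - q (\<phi> (\<lambda>j. \<theta> x j + w j)) j)\<^sup>2) \<partial>?W)" for x
    have I1: "I x \<le> R" if Sx: "S x \<le> C" for x
    proof -
      have \<theta>: "\<theta> x \<in> sobolev_ellipsoid m c"
        using finite_support_in_sobolev_ellipsoid[of m x n c] Sx unfolding S_def C_def \<theta>_def by simp
      have xC: "\<bar>x j\<bar> \<le> sqrt C" if "j < n" for j
      proof -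
        have "(x j)\<^sup>2 \<le> ?a j * (x j)\<^sup>2" using a1[of j] by (simp add: mult_left_le mult_right_le_one_le mult_le_cancel_right1)
        also have "\<dots> \<le> S x" unfolding S_def using that
          by (intro member_le_sum[of j _ "\<lambda>j. ?a j * (x j)\<^sup>2"]) auto
        finally show ?thesis using Sx by (intro real_le_rsqrt) simp
      qed
      have "I x \<le> (\<integral>\<^sup>+w. ennreal (\<Sum>j. (\<theta> x j - est (\<lambda>j. \<theta> x j + w j) j)\<^sup>2) \<partial>?W)"
        unfolding I_def
      proof (intro nn_integral_mono ennreal_leI)
        fix w
        let ?y = "\<lambda>j. \<theta> x j + w j"
        have "(\<Sum>j<n. (x j - q (\<phi> ?y) j)\<^sup>2) \<le> (\<Sum>j<n. (\<theta> x j - est ?y j)\<^sup>2)"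
        proof (rule sum_mono)
          fix j assume "j \<in> {..<n}"
          then have "\<bar>x j - q (\<phi> ?y) j\<bar> \<le> \<bar>\<theta> x j - est ?y j\<bar>"
            using xC[of j] C unfolding q_est by (auto simp: \<theta>_def max_def min_def)
          then show "(x j - q (\<phi> ?y) j)\<^sup>2 \<le> (\<theta> x j - est ?y j)\<^sup>2" by (simp add: abs_le_square_iff)
        qed
        also have "\<dots> \<le> (\<Sum>j. (\<theta> x j - est ?y j)\<^sup>2)"
          using \<theta> est_ell2 by (intro sum_le_suminf ell2_diff) (auto simp: sobolev_ellipsoid_def)
        finally show "(\<Sum>j<n. (x j - q (\<phi> ?y) j)\<^sup>2) \<le> (\<Sum>j. (\<theta> x j - est ?y j)\<^sup>2)" .
      qed
      also have "\<dots> = sq_risk \<epsilon> est (\<theta> x)"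
        unfolding sq_risk_def gaussian_sequence_eq_distr[OF \<epsilon>]
        by (subst nn_integral_distr[OF shift]) auto
      also have "\<dots> \<le> R" unfolding R_def using \<theta> by (rule SUP_upper)
      finally show ?thesis .
    qed
    \<comment> \<open>Outside the ellipsoid the loss is at most \<open>2 * S x + 2 * n * C\<close>.
      Since \<open>t \<ge> 1 / C\<close>, the linear growth in \<open>S x\<close> is absorbed by
      \<open>C * exp (t * (S x - C))\<close>, so the deviation probability and the size of the loss
      are handled by a single exponential moment.\<close>
    have I2: "I x \<le> ennreal ((2 * C + 2 * real n * C) * exp (t * (S x - C)))" if Sx: "S x > C" for x
    proof -
      have "(\<Sum>j<n. (x j - q i j)\<^sup>2) \<le> (2 * C + 2 * real n * C) * exp (t * (S x - C))" for i
      proof -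
        have "(\<Sum>j<n. (x j - q i j)\<^sup>2) \<le> (\<Sum>j<n. 2 * (?a j * (x j)\<^sup>2) + 2 * C)"
        proof (rule sum_mono)
          fix j
          have "0 \<le> (x j + q i j)\<^sup>2" by simp
          then have "(x j - q i j)\<^sup>2 \<le> 2 * (x j)\<^sup>2 + 2 * (q i j)\<^sup>2" by (simp add: power2_eq_square algebra_simps)
          moreover have "(x j)\<^sup>2 \<le> ?a j * (x j)\<^sup>2" using a1[of j] by (simp add: mult_le_cancel_right1)
          ultimately show "(x j - q i j)\<^sup>2 \<le> 2 * (?a j * (x j)\<^sup>2) + 2 * C" using q2[of i j] by simp
        qed
        also have "\<dots> = 2 * S x + 2 * real n * C" by (simp add: S_def sum.distrib sum_distrib_left)
        also have "\<dots> \<le> 2 * (C * exp (t * (S x - C))) + 2 * real n * C * exp (t * (S x - C))"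
        proof (intro add_mono mult_left_mono)
          have "S x / C = 1 + (1 / C) * (S x - C)" using C by (simp add: field_simps)
          also have "\<dots> \<le> 1 + t * (S x - C)" using t Sx by (intro add_left_mono mult_right_mono) auto
          also have "\<dots> \<le> exp (t * (S x - C))" by (rule exp_ge_add_one_self)
          finally show "S x \<le> C * exp (t * (S x - C))" using C by (simp add: field_simps)
          show "2 * real n * C \<le> 2 * real n * C * exp (t * (S x - C))"
            using t Sx C mult_left_mono[of 1 "exp (t * (S x - C))" "2 * real n * C"] by simp
        qed simp
        finally show ?thesis by (simp add: algebra_simps)
      qed
      then have "I x \<le> (\<integral>\<^sup>+w. ennreal ((2 * C + 2 * real n * C) * exp (t * (S x - C))) \<partial>?W)"
        unfolding I_def by (intro nn_integral_mono ennreal_leI)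
      then show ?thesis by (simp add: W.emeasure_space_1)
    qed
    \<comment> \<open>The solution of the calibration \<open>prod\<close> of
      \<open>bayes_quantization_risk_ge\<close> for the actual number \<open>N\<close> of code
      words; the budget enters afterwards through \<open>ln N \<le> B * ln 2\<close>.\<close>
    define \<nu> where "\<nu> = exp (((\<Sum>j<n. ln (((\<sigma> j)\<^sup>2)\<^sup>2 / ((\<sigma> j)\<^sup>2 + \<epsilon>\<^sup>2))) - 2 * ln N) / n)"
    have s0: "(\<sigma> j)\<^sup>2 + \<epsilon>\<^sup>2 > 0" for j using \<epsilon> by (intro add_nonneg_pos) auto
    have "?L \<le> ennreal ((\<Sum>j<n. (\<sigma> j)\<^sup>2 * \<epsilon>\<^sup>2 / ((\<sigma> j)\<^sup>2 + \<epsilon>\<^sup>2)) + real n * \<nu>)"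
    proof (intro ennreal_leI add_left_mono mult_left_mono)
      have "ln N \<le> B * ln 2" using N N0 by (metis ln_powr ln_mono of_nat_0_less_iff zero_less_numeral zero_neq_numeral)
      then have "2 * ln N / n \<le> 2 * B * ln 2 / n" by (intro divide_right_mono) auto
      then show "exp ((\<Sum>j<n. ln (((\<sigma> j)\<^sup>2)\<^sup>2 / ((\<sigma> j)\<^sup>2 + \<epsilon>\<^sup>2))) / n - 2 * B * ln 2 / n) \<le> \<nu>"
        by (simp add: \<nu>_def diff_divide_distrib)
    qed simp
    also have "\<dots> \<le> (\<integral>\<^sup>+x. I x \<partial>?X)"
      unfolding I_def \<theta>_def
    proof (rule bayes_quantization_risk_ge[OF \<sigma> \<epsilon> _ \<phi> _ q_meas])
      show "\<nu> > 0" by (simp add: \<nu>_def)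
      have "sqrt \<nu> = exp (((\<Sum>j<n. ln ((\<sigma> j)\<^sup>2 / sqrt ((\<sigma> j)\<^sup>2 + \<epsilon>\<^sup>2))) - ln N) / n)"
      proof (rule real_sqrt_unique)
        have "2 * ln ((\<sigma> j)\<^sup>2 / sqrt ((\<sigma> j)\<^sup>2 + \<epsilon>\<^sup>2)) = ln (((\<sigma> j)\<^sup>2)\<^sup>2 / ((\<sigma> j)\<^sup>2 + \<epsilon>\<^sup>2))" for j
        proof -
          have "((\<sigma> j)\<^sup>2 / sqrt ((\<sigma> j)\<^sup>2 + \<epsilon>\<^sup>2))\<^sup>2 = ((\<sigma> j)\<^sup>2)\<^sup>2 / ((\<sigma> j)\<^sup>2 + \<epsilon>\<^sup>2)"
            using s0[of j] by (simp add: power_divide)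
          then show ?thesis
            using \<sigma>[of j] s0[of j] ln_realpow[of "(\<sigma> j)\<^sup>2 / sqrt ((\<sigma> j)\<^sup>2 + \<epsilon>\<^sup>2)" 2] by simp
        qed
        then have "(\<Sum>j<n. ln (((\<sigma> j)\<^sup>2)\<^sup>2 / ((\<sigma> j)\<^sup>2 + \<epsilon>\<^sup>2))) = 2 * (\<Sum>j<n. ln ((\<sigma> j)\<^sup>2 / sqrt ((\<sigma> j)\<^sup>2 + \<epsilon>\<^sup>2)))"
          by (simp add: sum_distrib_left)
        then show "(exp (((\<Sum>j<n. ln ((\<sigma> j)\<^sup>2 / sqrt ((\<sigma> j)\<^sup>2 + \<epsilon>\<^sup>2))) - ln N) / n))\<^sup>2 = \<nu>"
          unfolding \<nu>_def by (simp add: power2_eq_square exp_add[symmetric] add_divide_distrib[symmetric])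
      qed simp
      then have "sqrt \<nu> ^ n = exp ((\<Sum>j<n. ln ((\<sigma> j)\<^sup>2 / sqrt ((\<sigma> j)\<^sup>2 + \<epsilon>\<^sup>2))) - ln N)"
        using n by (simp add: exp_of_nat_mult[symmetric])
      also have "\<dots> = (\<Prod>j<n. (\<sigma> j)\<^sup>2 / sqrt ((\<sigma> j)\<^sup>2 + \<epsilon>\<^sup>2)) / N"
      proof -
        have "exp (ln ((\<sigma> j)\<^sup>2 / sqrt ((\<sigma> j)\<^sup>2 + \<epsilon>\<^sup>2))) = (\<sigma> j)\<^sup>2 / sqrt ((\<sigma> j)\<^sup>2 + \<epsilon>\<^sup>2)" for j
          using \<sigma>[of j] s0[of j] by (intro exp_ln divide_pos_pos) auto
        then show ?thesis using N0 by (simp add: exp_diff exp_sum)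
      qed
      finally show "(\<Prod>j<n. (\<sigma> j)\<^sup>2 / sqrt ((\<sigma> j)\<^sup>2 + \<epsilon>\<^sup>2)) = real N * sqrt \<nu> ^ n"
        using N0 by simp
    qed
    also have "\<dots> \<le> (\<integral>\<^sup>+x. R + ennreal ((2 * C + 2 * real n * C) * exp (t * (S x - C))) \<partial>?X)"
    proof (rule nn_integral_mono)
      fix x
      show "I x \<le> R + ennreal ((2 * C + 2 * real n * C) * exp (t * (S x - C)))"
        using I1[of x] I2[of x] by (cases "S x \<le> C") (auto intro: add_increasing add_increasing2)
    qed
    also have "\<dots> = R + (\<integral>\<^sup>+x. ennreal ((2 * C + 2 * real n * C) * exp (t * (S x - C))) \<partial>?X)"
      by (subst nn_integral_add) (auto simp: X.emeasure_space_1)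
    also have "\<dots> \<le> R + ?err" using chernoff by (rule add_left_mono)
    finally show ?thesis unfolding R_def .
  qed
  \<comment> \<open>The finite error moves to the left so that the infimum over estimators can be
    taken on the right; truncated subtraction is then undone.\<close>
  then have "?L - ?err \<le> quantized_minimax_risk \<epsilon> m c B"
    unfolding quantized_minimax_risk_def by (intro INF_greatest) (auto simp: ennreal_minus_le_iff add.commute)
  then show ?thesis by (auto simp: ennreal_minus_le_iff add.commute)
qed

subsection \<open>Discretized profiles\<close>

lemma set_integrable_bounded:
  fixes f :: "real \<Rightarrow> real"
  assumes "f \<in> borel_measurable borel" "\<And>x. x \<in> {a<..b} \<Longrightarrow> \<bar>f x\<bar> \<le> M"
  shows "set_integrable lborel {a<..b} f"
  unfolding set_integrable_def
proof (rule integrableI_bounded_set_indicator[where B = M])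
  show "emeasure lborel {a<..b} < \<infinity>" by (cases "a \<le> b") auto
qed (use assms in auto)

lemma set_integral_ge_const:
  fixes f :: "real \<Rightarrow> real"
  assumes f: "set_integrable lborel {a<..b} f" and "a \<le> b" "\<And>x. x \<in> {a<..b} \<Longrightarrow> k \<le> f x"
  shows "(b - a) * k \<le> (LBINT x:{a<..b}. f x)"
proof -
  have "(LBINT x:{a<..b}. k) \<le> (LBINT x:{a<..b}. f x)"
  proof (rule set_integral_mono[OF _ f])
    show "set_integrable lborel {a<..b} (\<lambda>_. k)" by (rule set_integrable_bounded[where M = "\<bar>k\<bar>"]) auto
  qed (use assms in auto)
  then show ?thesis using \<open>a \<le> b\<close> by (simp add: set_integral_const)
qed

lemma riemann_sum_le_integral:
  fixes f :: "real \<Rightarrow> real"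
  assumes h: "h \<ge> 0" and f: "set_integrable lborel {a<..a + real n * h} f"
    and le: "\<And>j x. j < n \<Longrightarrow> a + real j * h < x \<Longrightarrow> x \<le> a + real (Suc j) * h \<Longrightarrow> k j \<le> f x"
  shows "h * (\<Sum>j<n. k j) \<le> (LBINT x:{a<..a + real n * h}. f x)"
  using f le
proof (induction n)
  case (Suc n)
  let ?A = "{a<..a + real n * h}" and ?B = "{a + real n * h<..a + real (Suc n) * h}"
  have AB: "{a<..a + real (Suc n) * h} = ?A \<union> ?B"
    using h by (intro ivl_disj_un_two(6)[symmetric]) (auto intro: mult_right_mono)
  have fA: "set_integrable lborel ?A f" and fB: "set_integrable lborel ?B f"
    using Suc.prems(1) unfolding AB by (auto intro: set_integrable_subset)
  have "h * (\<Sum>j<n. k j) \<le> (LBINT x:?A. f x)"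
    using Suc.IH fA Suc.prems(2) by simp
  moreover have "h * k n \<le> (LBINT x:?B. f x)"
    using set_integral_ge_const[OF fB, of "k n"] Suc.prems(2)[of n] h by (simp add: algebra_simps)
  moreover have "(LBINT x:{a<..a + real (Suc n) * h}. f x) = (LBINT x:?A. f x) + (LBINT x:?B. f x)"
    unfolding AB using fA fB by (intro set_integral_Un) auto
  ultimately show ?case by (simp add: algebra_simps)
qed (simp add: set_lebesgue_integral_def)

lemma borel_measurable_antimono:
  fixes f :: "real \<Rightarrow> real"
  assumes "antimono f" shows "f \<in> borel_measurable borel"
proof -
  have "mono (\<lambda>x. - f x)" using assms by (auto simp: mono_def antimono_def)
  from borel_measurable_uminus[OF borel_measurable_mono[OF this]] show ?thesis by simp
qed

text \<open>Left endpoints of a decreasing function overestimate its integral over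
  \<open>{2 * h<..(n + 2) * h}\<close>. The missing piece \<open>{0<..2 * h}\<close> costs at most
  \<open>2 * h * M\<close> and the overshoot beyond \<open>x0\<close> at most \<open>h * M\<close>,
  whence the 3.\<close>

lemma antimono_riemann_sum_ge:
  fixes f :: "real \<Rightarrow> real"
  assumes f: "antimono f" "\<And>x. \<bar>f x\<bar> \<le> M" and h: "h > 0" "2 * h \<le> x0"
    and n: "x0 \<le> real (n + 2) * h" "real (n + 2) * h \<le> x0 + h"
  shows "(LBINT x:{0<..x0}. f x) - 3 * h * M \<le> h * (\<Sum>j<n. f (real (j + 2) * h))"
proof -
  let ?e = "2 * h + real n * h"
  have fi: "set_integrable lborel {a<..b} f" for a b
    using borel_measurable_antimono[OF f(1)] f(2) by (rule set_integrable_bounded)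
  have M: "f x \<le> M" "- M \<le> f x" for x using f(2)[of x] by auto
  have e: "x0 \<le> ?e" "?e \<le> x0 + h" using n by (auto simp: algebra_simps)
  have "h * (\<Sum>j<n. - f (real (j + 2) * h)) \<le> (LBINT x:{2 * h<..?e}. - f x)"
  proof (rule riemann_sum_le_integral)
    show "set_integrable lborel {2 * h<..?e} (\<lambda>x. - f x)"
      using fi by (simp add: set_integrable_def)
    fix j x assume "2 * h + real j * h < x"
    then show "- f (real (j + 2) * h) \<le> - f x"
      using antimonoD[OF f(1), of "real (j + 2) * h" x] by (simp add: algebra_simps)
  qed (use h in auto)
  then have 1: "(LBINT x:{2 * h<..?e}. f x) \<le> h * (\<Sum>j<n. f (real (j + 2) * h))"
    by (simp add: set_integral_uminus fi sum_negf)
  have 2: "(LBINT x:{2 * h<..?e}. f x) = (LBINT x:{2 * h<..x0}. f x) + (LBINT x:{x0<..?e}. f x)"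
    using fi h e by (subst set_integral_Un[symmetric]) (auto simp: ivl_disj_un)
  have 3: "(LBINT x:{0<..x0}. f x) = (LBINT x:{0<..2 * h}. f x) + (LBINT x:{2 * h<..x0}. f x)"
    using fi h by (subst set_integral_Un[symmetric]) (auto simp: ivl_disj_un)
  have 4: "h * - M \<le> (LBINT x:{x0<..?e}. f x)"
  proof -
    have "h * - M \<le> (?e - x0) * - M" using e M[of 0] by (intro mult_right_mono_neg) auto
    also have "\<dots> \<le> (LBINT x:{x0<..?e}. f x)" using e M by (intro set_integral_ge_const fi) auto
    finally show ?thesis .
  qed
  have 5: "(2 * h - 0) * - M \<le> (LBINT x:{0<..2 * h}. - f x)"
    using h M fi by (intro set_integral_ge_const) (auto simp: set_integrable_def)
  show ?thesis using 1 2 3 4 5 by (simp add: set_integral_uminus fi)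
qed

text \<open>\<open>a\<^sup>2 / (a + 1)\<close> is the variance of the posterior mean, in units of
  the noise variance, for a prior variance \<open>a\<close> in the same units. Its monotonicity
  makes the logarithmic integrand of a decreasing profile decreasing.\<close>

lemma ln_square_quotient_mono:
  fixes a b :: real
  assumes "0 < a" "a \<le> b"
  shows "ln (a\<^sup>2 / (a + 1)) \<le> ln (b\<^sup>2 / (b + 1))"
proof (rule ln_mono)
  have "a / (a + 1) \<le> b / (b + 1)" using assms by (simp add: field_simps)
  then have "a * (a / (a + 1)) \<le> b * (b / (b + 1))" using assms by (intro mult_mono) auto
  then show "a\<^sup>2 / (a + 1) \<le> b\<^sup>2 / (b + 1)" by (simp add: power2_eq_square)
qed (use assms in auto)

lemma set_integrable_powr_mult_bounded:
  fixes s :: "real \<Rightarrow> real"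
  assumes "s \<in> borel_measurable borel" "\<And>x. \<bar>s x\<bar> \<le> M" "p \<ge> 0"
  shows "set_integrable lborel {0<..b} (\<lambda>x. x powr p * s x)"
proof (rule set_integrable_bounded)
  fix x assume "x \<in> {0<..b}"
  then show "\<bar>x powr p * s x\<bar> \<le> b powr p * M"
    using assms(2)[of x] assms(3) by (auto simp: abs_mult intro!: mult_mono powr_mono2)
qed (use assms(1) in measurable)

text \<open>The noise level is parametrized by the grid width \<open>h = \<epsilon> powr (2 / (2 * m + 1))\<close>. Sampling the
  decreasing profile one step to the right of the weight bounds the Riemann sum of the moment by its
  integral.\<close>

lemma discretized_risk_ge:
  fixes s :: "real \<Rightarrow> real" and m c h x0 M s0 \<delta> B :: real
  defines "C \<equiv> c\<^sup>2 / pi powr (2 * m)" and "n \<equiv> nat \<lfloor>x0 / h\<rfloor> - 1"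
    and "K \<equiv> x0 powr (2 * m) * M * x0"
    and "L \<equiv> max \<bar>ln (s0\<^sup>2 / (s0 + 1))\<bar> \<bar>ln (M\<^sup>2 / (M + 1))\<bar>"
  assumes m: "m \<ge> 0" and c: "c \<noteq> 0" and h: "h > 0" and x0: "x0 > 0"
    and s: "antimono s" "s0 > 0" "\<And>x. s0 \<le> s x" "\<And>x. s x \<le> M"
    and \<delta>: "0 < \<delta>" "\<delta> \<le> 1"
    and moment: "(LBINT x:{0<..x0}. x powr (2 * m) * s x) \<le> (1 - \<delta>) * C"
    and n: "n > 0" "real n \<ge> 8 * K / (\<delta> * C)"
  shows "ennreal (h powr (2 * m) * ((LBINT x:{0<..x0}. s x / (s x + 1)) - 3 * h +
      real n * h * exp (((LBINT x:{0<..x0}. ln ((s x)\<^sup>2 / (s x + 1))) - 3 * h * L) / (real n * h)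
        - 2 * (B * h) * ln 2 / (real n * h)))) \<le>
    quantized_minimax_risk (h powr ((2 * m + 1) / 2)) m c B +
      ennreal ((2 * C + 2 * real n * C) * exp (- (C * \<delta>\<^sup>2 / (16 * K)) * n))"
proof -
  define \<epsilon> where "\<epsilon> = h powr ((2 * m + 1) / 2)"
  have \<epsilon>: "\<epsilon> > 0" using h by (simp add: \<epsilon>_def)
  \<comment> \<open>The reason for this grid width: of the \<open>2 * m + 1\<close> powers of
    \<open>h\<close>, \<open>2 * m\<close> form the rate of the risk and the last one is the mesh of
    the Riemann sums.\<close>
  have \<epsilon>2: "\<epsilon>\<^sup>2 = h powr (2 * m) * h"
  proof -
    have "\<epsilon>\<^sup>2 = h powr (2 * m + 1)"
      by (simp add: \<epsilon>_def power2_eq_square powr_add[symmetric])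
    then show ?thesis using h by (simp add: powr_add)
  qed
  \<comment> \<open>Index \<open>j\<close> stands for coordinate \<open>j + 1\<close>, whose weight
    is read at \<open>(j + 1) * h\<close>. Between this point and \<open>(j + 2) * h\<close> both
    weight and profile value are underestimates.\<close>
  define t where "t j = s (real (j + 2) * h)" for j
  define \<sigma> where "\<sigma> j = \<epsilon> * sqrt (t j)" for j
  have s_pos: "s x > 0" for x using s(2,3) less_le_trans by blast
  have M: "M > 0" using s(2-4) by (meson less_le_trans order_trans)
  have t: "t j > 0" for j by (simp add: t_def s_pos)
  have \<sigma>: "\<sigma> j > 0" for j using t \<epsilon> by (simp add: \<sigma>_def)
  have \<sigma>2: "(\<sigma> j)\<^sup>2 = \<epsilon>\<^sup>2 * t j" for j using t[of j] by (simp add: \<sigma>_def power_mult_distrib)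
  have K: "K > 0" using x0 M by (simp add: K_def)
  have nat_floor: "real (nat \<lfloor>x0 / h\<rfloor>) = of_int \<lfloor>x0 / h\<rfloor>" using x0 h by simp
  \<comment> \<open>\<open>n\<close> is one less than the number of grid points in
    \<open>{0<..x0}\<close>, so that the last sampling point \<open>(n + 1) * h\<close> still lies
    in the interval.\<close>
  have "real (n + 1) = of_int \<lfloor>x0 / h\<rfloor>" using n nat_floor unfolding n_def by linarith
  then have "real (n + 1) \<le> x0 / h" "x0 / h < real (n + 2)" by linarith+
  then have n1: "real (n + 1) * h \<le> x0" and n2: "x0 \<le> real (n + 2) * h"
    using h by (auto simp: field_simps)
  have n3: "real (n + 2) * h \<le> x0 + h" using n1 by (simp add: algebra_simps)
  have h2: "2 * h \<le> x0"
  proof -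
    have "2 * h \<le> real (n + 1) * h" using h n by (intro mult_right_mono) auto
    then show ?thesis using n1 by simp
  qed
  have u_eq: "(sobolev_weight m j)\<^sup>2 * (\<sigma> j)\<^sup>2 = h * ((real (Suc j) * h) powr (2 * m) * t j)" for j
  proof -
    have "(sobolev_weight m j)\<^sup>2 = real (Suc j) powr (2 * m)"
      by (simp add: sobolev_weight_def power2_eq_square powr_add[symmetric])
    then show ?thesis using h by (simp add: \<sigma>2 \<epsilon>2 powr_mult)
  qed
  have smeas: "s \<in> borel_measurable borel" by (rule borel_measurable_antimono) fact
  have int: "set_integrable lborel {0<..x0} (\<lambda>x. x powr (2 * m) * s x)"
    using smeas s(4) s_pos m by (intro set_integrable_powr_mult_bounded[where M = M]) (auto simp: less_imp_le)
  have main: "ennreal ((\<Sum>j<n. (\<sigma> j)\<^sup>2 * \<epsilon>\<^sup>2 / ((\<sigma> j)\<^sup>2 + \<epsilon>\<^sup>2)) +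
      real n * exp ((\<Sum>j<n. ln (((\<sigma> j)\<^sup>2)\<^sup>2 / ((\<sigma> j)\<^sup>2 + \<epsilon>\<^sup>2))) / n - 2 * B * ln 2 / n)) \<le>
    quantized_minimax_risk \<epsilon> m c B + ennreal ((2 * C + 2 * real n * C) * exp (- (C * \<delta>\<^sup>2 / (16 * K)) * n))"
    unfolding C_def
  proof (rule quantized_minimax_risk_ge[OF m c \<epsilon> \<sigma> \<delta> K n(1)])
    show "real n \<ge> 8 * K / (\<delta> * (c\<^sup>2 / pi powr (2 * m)))" using n by (simp add: C_def)
    fix j assume j: "j < n"
    have "real (Suc j) * h \<le> x0"
      using n1 j h by (intro order_trans[OF _ n1] mult_right_mono) auto
    then have "(sobolev_weight m j)\<^sup>2 * (\<sigma> j)\<^sup>2 \<le> h * (x0 powr (2 * m) * M)"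
      unfolding u_eq using h m t[of j] s(4)
      by (intro mult_left_mono mult_mono powr_mono2) (auto simp: t_def)
    also have "\<dots> = h * n * (x0 powr (2 * m) * M) / n" using n by simp
    also have "\<dots> \<le> x0 * (x0 powr (2 * m) * M) / n"
    proof (intro divide_right_mono mult_right_mono)
      show "h * n \<le> x0" using n1 h by (simp add: algebra_simps)
    qed (use M in auto)
    finally show "(sobolev_weight m j)\<^sup>2 * (\<sigma> j)\<^sup>2 \<le> K / n" by (simp add: K_def mult_ac)
  next
    have x0': "h + real n * h \<le> x0" using n1 by (simp add: algebra_simps)
    have int': "set_integrable lborel {h<..h + real n * h} (\<lambda>x. x powr (2 * m) * s x)"
      using int h x0' by (rule_tac set_integrable_subset) auto
    have "(\<Sum>j<n. (sobolev_weight m j)\<^sup>2 * (\<sigma> j)\<^sup>2) =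
        h * (\<Sum>j<n. (real (Suc j) * h) powr (2 * m) * t j)"
      by (simp add: u_eq sum_distrib_left)
    also have "\<dots> \<le> (LBINT x:{h<..h + real n * h}. x powr (2 * m) * s x)"
    proof (rule riemann_sum_le_integral[OF _ int'])
      fix j x assume "h + real j * h < x" "x \<le> h + real (Suc j) * h"
      then have "real (Suc j) * h \<le> x" "x \<le> real (j + 2) * h" by (auto simp: algebra_simps)
      then show "(real (Suc j) * h) powr (2 * m) * t j \<le> x powr (2 * m) * s x"
        using h m t[of j] antimonoD[OF s(1), of x "real (j + 2) * h"]
        by (intro mult_mono powr_mono2) (auto simp: t_def)
    qed (use h in simp)
    also have "\<dots> \<le> (LBINT x:{0<..x0}. x powr (2 * m) * s x)"
      using int' int h x0' s_pos unfolding set_lebesgue_integral_def set_integrable_def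
      by (intro integral_mono) (auto simp: indicator_def less_imp_le)
    also have "\<dots> \<le> (1 - \<delta>) * C" by (rule moment)
    finally show "(\<Sum>j<n. (sobolev_weight m j)\<^sup>2 * (\<sigma> j)\<^sup>2) \<le> (1 - \<delta>) * (c\<^sup>2 / pi powr (2 * m))"
      by (simp add: C_def)
  qed
  have F: "(LBINT x:{0<..x0}. s x / (s x + 1)) - 3 * h * 1 \<le> h * (\<Sum>j<n. t j / (t j + 1))"
    unfolding t_def
  proof (rule antimono_riemann_sum_ge[OF _ _ h h2 n2 n3])
    show "antimono (\<lambda>x. s x / (s x + 1))"
    proof (rule antimonoI)
      fix x y :: real assume "x \<le> y"
      then have "s y \<le> s x" by (rule antimonoD[OF s(1)])
      then show "s y / (s y + 1) \<le> s x / (s x + 1)"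
        using s_pos[of x] s_pos[of y] by (simp add: field_simps)
    qed
    show "\<bar>s x / (s x + 1)\<bar> \<le> 1" for x using s_pos[of x] by simp
  qed
  have G: "(LBINT x:{0<..x0}. ln ((s x)\<^sup>2 / (s x + 1))) - 3 * h * L \<le> h * (\<Sum>j<n. ln ((t j)\<^sup>2 / (t j + 1)))"
    unfolding t_def
  proof (rule antimono_riemann_sum_ge[OF _ _ h h2 n2 n3])
    show "antimono (\<lambda>x. ln ((s x)\<^sup>2 / (s x + 1)))"
      using s(1) s_pos by (intro antimonoI ln_square_quotient_mono) (auto dest: antimonoD)
    show "\<bar>ln ((s x)\<^sup>2 / (s x + 1))\<bar> \<le> L" for x
    proof -
      have "ln (s0\<^sup>2 / (s0 + 1)) \<le> ln ((s x)\<^sup>2 / (s x + 1))" using s by (intro ln_square_quotient_mono)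
      moreover have "ln ((s x)\<^sup>2 / (s x + 1)) \<le> ln (M\<^sup>2 / (M + 1))" using s s_pos by (intro ln_square_quotient_mono)
      ultimately show ?thesis unfolding L_def by linarith
    qed
  qed
  let ?A = "(LBINT x:{0<..x0}. s x / (s x + 1)) - 3 * h"
  let ?E = "((LBINT x:{0<..x0}. ln ((s x)\<^sup>2 / (s x + 1))) - 3 * h * L) / (real n * h) - 2 * (B * h) * ln 2 / (real n * h)"
  have "h powr (2 * m) * (?A + real n * h * exp ?E) = h powr (2 * m) * ?A + real n * (\<epsilon>\<^sup>2 * exp ?E)"
    by (simp add: \<epsilon>2 algebra_simps)
  also have "\<dots> \<le> (\<Sum>j<n. (\<sigma> j)\<^sup>2 * \<epsilon>\<^sup>2 / ((\<sigma> j)\<^sup>2 + \<epsilon>\<^sup>2)) +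
      real n * exp ((\<Sum>j<n. ln (((\<sigma> j)\<^sup>2)\<^sup>2 / ((\<sigma> j)\<^sup>2 + \<epsilon>\<^sup>2))) / n - 2 * B * ln 2 / n)"
  proof (intro add_mono mult_left_mono)
    have "(\<sigma> j)\<^sup>2 * \<epsilon>\<^sup>2 / ((\<sigma> j)\<^sup>2 + \<epsilon>\<^sup>2) = \<epsilon>\<^sup>2 * (t j / (t j + 1))" for j
    proof -
      have "(\<sigma> j)\<^sup>2 + \<epsilon>\<^sup>2 = \<epsilon>\<^sup>2 * (t j + 1)" by (simp add: \<sigma>2 algebra_simps)
      then show ?thesis using \<epsilon> by (simp add: \<sigma>2)
    qed
    then have "(\<Sum>j<n. (\<sigma> j)\<^sup>2 * \<epsilon>\<^sup>2 / ((\<sigma> j)\<^sup>2 + \<epsilon>\<^sup>2)) = h powr (2 * m) * (h * (\<Sum>j<n. t j / (t j + 1)))"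
      by (simp add: \<epsilon>2 sum_distrib_left mult_ac)
    then show "h powr (2 * m) * ?A \<le> (\<Sum>j<n. (\<sigma> j)\<^sup>2 * \<epsilon>\<^sup>2 / ((\<sigma> j)\<^sup>2 + \<epsilon>\<^sup>2))"
      using F by (simp add: mult_left_mono)
    \<comment> \<open>The noise variance is common to all coordinates, so it leaves the geometric
      mean as a factor.\<close>
    have "ln (((\<sigma> j)\<^sup>2)\<^sup>2 / ((\<sigma> j)\<^sup>2 + \<epsilon>\<^sup>2)) = ln (\<epsilon>\<^sup>2) + ln ((t j)\<^sup>2 / (t j + 1))" for j
    proof -
      have "((\<sigma> j)\<^sup>2)\<^sup>2 / ((\<sigma> j)\<^sup>2 + \<epsilon>\<^sup>2) = (\<epsilon>\<^sup>2 * \<epsilon>\<^sup>2 * (t j)\<^sup>2) / (\<epsilon>\<^sup>2 * (t j + 1))"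
        unfolding \<sigma>2 by (intro arg_cong2[where f = "(/)"]) (simp_all add: power2_eq_square algebra_simps)
      also have "\<dots> = \<epsilon>\<^sup>2 * ((t j)\<^sup>2 / (t j + 1))"
      proof -
        have cancel: "e * e * a / (e * b) = e * (a / b)" if "e \<noteq> 0" for e a b :: real using that by simp
        show ?thesis by (rule cancel) (use \<epsilon> in simp)
      qed
      finally have "((\<sigma> j)\<^sup>2)\<^sup>2 / ((\<sigma> j)\<^sup>2 + \<epsilon>\<^sup>2) = \<epsilon>\<^sup>2 * ((t j)\<^sup>2 / (t j + 1))" .
      moreover have "(t j)\<^sup>2 / (t j + 1) > 0" using t[of j] by (intro divide_pos_pos) auto
      ultimately show ?thesis using \<epsilon> by (simp only: ln_mult_pos zero_less_power)
    qed
    then have *: "(\<Sum>j<n. ln (((\<sigma> j)\<^sup>2)\<^sup>2 / ((\<sigma> j)\<^sup>2 + \<epsilon>\<^sup>2))) / n = ln (\<epsilon>\<^sup>2) + (h * (\<Sum>j<n. ln ((t j)\<^sup>2 / (t j + 1)))) / (real n * h)"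
      using n h by (simp add: sum.distrib add_divide_distrib)
    have "?E \<le> (h * (\<Sum>j<n. ln ((t j)\<^sup>2 / (t j + 1)))) / (real n * h) - 2 * B * ln 2 / n"
      using h G by (intro diff_mono divide_right_mono) auto
    then have "exp (ln (\<epsilon>\<^sup>2) + ?E) \<le> exp ((\<Sum>j<n. ln (((\<sigma> j)\<^sup>2)\<^sup>2 / ((\<sigma> j)\<^sup>2 + \<epsilon>\<^sup>2))) / n - 2 * B * ln 2 / n)"
      unfolding * by simp
    then show "\<epsilon>\<^sup>2 * exp ?E \<le> exp ((\<Sum>j<n. ln (((\<sigma> j)\<^sup>2)\<^sup>2 / ((\<sigma> j)\<^sup>2 + \<epsilon>\<^sup>2))) / n - 2 * B * ln 2 / n)"
      using \<epsilon> by (simp only: exp_add exp_ln zero_less_power)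
  qed simp
  finally show ?thesis
    using main unfolding \<epsilon>_def[symmetric] by (meson ennreal_leI order_trans)
qed

section \<open>Passage to the limit in the noise level\<close>

lemma Liminf_weighted_risk_ge:
  fixes R :: "'a \<Rightarrow> ennreal" and l e w :: "'a \<Rightarrow> real"
  assumes F: "F \<noteq> bot"
    and ev: "eventually (\<lambda>x. w x > 0 \<and> e x \<ge> 0 \<and> ennreal (l x) \<le> R x + ennreal (e x)) F"
    and l: "((\<lambda>x. w x * l x) \<longlongrightarrow> L) F" and e: "((\<lambda>x. w x * e x) \<longlongrightarrow> 0) F"
  shows "ereal L \<le> Liminf F (\<lambda>x. ereal (w x) * enn2ereal (R x))"
proof -
  have "((\<lambda>x. ereal (w x * l x - w x * e x)) \<longlongrightarrow> ereal (L - 0)) F"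
    by (intro tendsto_ereal tendsto_diff l e)
  then have "ereal L = Liminf F (\<lambda>x. ereal (w x * l x - w x * e x))"
    by (subst lim_imp_Liminf[OF F]) auto
  also have "\<dots> \<le> Liminf F (\<lambda>x. ereal (w x) * enn2ereal (R x))"
  proof (rule Liminf_mono)
    show "eventually (\<lambda>x. ereal (w x * l x - w x * e x) \<le> ereal (w x) * enn2ereal (R x)) F"
      using ev
    proof (rule eventually_mono)
      fix x assume *: "w x > 0 \<and> e x \<ge> 0 \<and> ennreal (l x) \<le> R x + ennreal (e x)"
      show "ereal (w x * l x - w x * e x) \<le> ereal (w x) * enn2ereal (R x)"
      \<comment> \<open>The risk may be infinite; as \<open>w x > 0\<close> the claim is then
        trivial.\<close>
      proof (cases "R x")
        case (real r)
        then have "ennreal (l x) \<le> ennreal (r + e x)" using * by simp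
        then have "l x \<le> r + e x" using real * by (subst (asm) ennreal_le_iff) auto
        then have "w x * l x \<le> w x * (r + e x)" using * by (intro mult_left_mono) auto
        then show ?thesis using real by (simp add: enn2ereal_ennreal algebra_simps)
      qed (use * in auto)
    qed
  qed
  finally show ?thesis .
qed

lemma discretization_size_tendsto:
  fixes x0 :: real
  assumes "x0 > 0"
  shows "((\<lambda>h. real (nat \<lfloor>x0 / h\<rfloor> - 1) * h) \<longlongrightarrow> x0) (at_right 0)"
    and "filterlim (\<lambda>h. real (nat \<lfloor>x0 / h\<rfloor> - 1)) at_top (at_right 0)"
proof -
  have ev: "eventually (\<lambda>h. h > 0 \<and> x0 / h - 2 \<le> real (nat \<lfloor>x0 / h\<rfloor> - 1) \<and> real (nat \<lfloor>x0 / h\<rfloor> - 1) \<le> x0 / h) (at_right 0)"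
    using eventually_at_right_less[of "0 :: real"]
  proof (rule eventually_mono)
    fix h :: real assume h: "0 < h"
    then have "x0 / h > 0" using assms by simp
    then show "h > 0 \<and> x0 / h - 2 \<le> real (nat \<lfloor>x0 / h\<rfloor> - 1) \<and> real (nat \<lfloor>x0 / h\<rfloor> - 1) \<le> x0 / h"
      using h by linarith
  qed
  show "((\<lambda>h. real (nat \<lfloor>x0 / h\<rfloor> - 1) * h) \<longlongrightarrow> x0) (at_right 0)"
  proof (rule tendsto_sandwich)
    show "eventually (\<lambda>h. x0 - 2 * h \<le> real (nat \<lfloor>x0 / h\<rfloor> - 1) * h) (at_right 0)"
      using ev by (rule eventually_mono) (auto simp: field_simps)
    show "eventually (\<lambda>h. real (nat \<lfloor>x0 / h\<rfloor> - 1) * h \<le> x0) (at_right 0)"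
      using ev by (rule eventually_mono) (auto simp: field_simps)
    show "((\<lambda>h. x0 - 2 * h) \<longlongrightarrow> x0) (at_right 0)" by real_asymp
  qed simp
  have "filterlim (\<lambda>h. x0 / h - 2) at_top (at_right 0)" using assms by real_asymp
  then show "filterlim (\<lambda>h. real (nat \<lfloor>x0 / h\<rfloor> - 1)) at_top (at_right 0)"
    by (rule filterlim_at_top_mono) (use ev in \<open>auto elim: eventually_mono\<close>)
qed

lemma powr_times_exp_tendsto_0:
  fixes a b :: real
  assumes "b > 0"
  shows "((\<lambda>x. x powr a * exp (- b * x)) \<longlongrightarrow> 0) at_top"
proof -
  obtain k :: nat where k: "a \<le> real k" using real_arch_simple by blast
  have "((\<lambda>x::real. x ^ k / exp x) \<longlongrightarrow> 0) at_top" by (rule tendsto_power_div_exp_0)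
  moreover have "filterlim (\<lambda>x. b * x) at_top at_top"
    by (rule filterlim_tendsto_pos_mult_at_top[OF tendsto_const assms filterlim_ident])
  ultimately have "((\<lambda>x. (b * x) ^ k / exp (b * x)) \<longlongrightarrow> 0) at_top" by (rule filterlim_compose)
  from tendsto_mult[OF tendsto_const[of "1 / b ^ k"] this]
  have lim: "((\<lambda>x. x ^ k * exp (- b * x)) \<longlongrightarrow> 0) at_top"
    using assms by (simp add: power_mult_distrib exp_minus field_simps)
  show ?thesis
  proof (rule tendsto_sandwich[OF _ _ tendsto_const lim])
    show "eventually (\<lambda>x. x powr a * exp (- b * x) \<le> x ^ k * exp (- b * x)) at_top"
      using eventually_ge_at_top[of 1]
    proof (rule eventually_mono)
      fix x :: real assume x: "1 \<le> x"
      then have "x powr a \<le> x powr real k" using k by (intro powr_mono) auto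
      then show "x powr a * exp (- b * x) \<le> x ^ k * exp (- b * x)"
        using x by (simp add: powr_realpow)
    qed
  qed simp
qed

text \<open>In \<open>discretized_risk_ge\<close> with \<open>h = H \<epsilon>\<close> the weight
  removes \<open>h powr (2 * m)\<close>, the Riemann errors are of order \<open>h\<close>, and the
  remainder decays exponentially in \<open>n h\<close>, about \<open>x0 / h\<close>. The bounds on
  \<open>s\<close> keep the constants \<open>K\<close> and \<open>L\<close> finite. The first
  conclusion discards the nonnegative quantization term, the second retains its limit.\<close>

lemma bounded_profile_liminf_ge:
  fixes s :: "real \<Rightarrow> real" and m c x0 M s0 \<delta> :: real and B :: "real \<Rightarrow> real"
  assumes m: "m > 0" and c: "c \<noteq> 0" and x0: "x0 > 0"
    and s: "antimono s" "s0 > 0" "\<And>x. s0 \<le> s x" "\<And>x. s x \<le> M"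
    and \<delta>: "0 < \<delta>" "\<delta> \<le> 1"
    and moment: "(LBINT x:{0<..x0}. x powr (2 * m) * s x) \<le> (1 - \<delta>) * (c\<^sup>2 / pi powr (2 * m))"
  defines "W \<equiv> Liminf (at_right 0) (\<lambda>\<epsilon>. ereal (\<epsilon> powr (- (4 * m / (2 * m + 1)))) *
               enn2ereal (quantized_minimax_risk \<epsilon> m c (B \<epsilon>)))"
  shows "ereal (LBINT x:{0<..x0}. s x / (s x + 1)) \<le> W"
    and "((\<lambda>\<epsilon>. B \<epsilon> * \<epsilon> powr (2 / (2 * m + 1))) \<longlongrightarrow> d) (at_right 0) \<Longrightarrow> d \<ge> 0 \<Longrightarrow>
      ereal (variational_objective d x0 s) \<le> W"
proof -
  define C where "C = c\<^sup>2 / pi powr (2 * m)"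
  define L where "L = max \<bar>ln (s0\<^sup>2 / (s0 + 1))\<bar> \<bar>ln (M\<^sup>2 / (M + 1))\<bar>"
  define K where "K = x0 powr (2 * m) * M * x0"
  define n where "n h = nat \<lfloor>x0 / h\<rfloor> - 1" for h :: real
  define I where "I = (LBINT x:{0<..x0}. s x / (s x + 1))"
  define J where "J = (LBINT x:{0<..x0}. ln ((s x)\<^sup>2 / (s x + 1)))"
  define b where "b = C * \<delta>\<^sup>2 / (16 * K)"
  define H where "H \<epsilon> = \<epsilon> powr (2 / (2 * m + 1))" for \<epsilon> :: real
  have M: "M > 0" using s(2-4) by (meson less_le_trans order_trans)
  have C: "C > 0" using c by (simp add: C_def)
  have K: "K > 0" using x0 M by (simp add: K_def)
  have b: "b > 0" using C K \<delta> by (simp add: b_def)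
  let ?E = "\<lambda>h \<beta>. exp ((J - 3 * h * L) / (real (n h) * h) - 2 * \<beta> * ln 2 / (real (n h) * h))"
  let ?l = "\<lambda>h \<beta>. I - 3 * h + real (n h) * h * ?E h \<beta>"
  let ?e = "\<lambda>h. (2 * C + 2 * real (n h) * C) * exp (- b * real (n h))"
  have H_lim: "filterlim H (at_right 0) (at_right 0)"
    unfolding H_def using m by real_asymp
  note n_lim = discretization_size_tendsto[OF x0, folded n_def]
  have H_pos: "H \<epsilon> > 0" if "\<epsilon> > 0" for \<epsilon> using that by (simp add: H_def)
  have H_inv: "H \<epsilon> powr ((2 * m + 1) / 2) = \<epsilon>" if "\<epsilon> > 0" for \<epsilon>
    using that m by (simp add: H_def powr_powr)
  have H_w: "\<epsilon> powr (- (4 * m / (2 * m + 1))) = H \<epsilon> powr (- (2 * m))" for \<epsilon>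
    by (simp add: H_def powr_powr)
  have e_lim: "((\<lambda>h. h powr (- (2 * m)) * ?e h) \<longlongrightarrow> 0) (at_right 0)"
  proof -
    have 1: "((\<lambda>k. (2 * C) * (k powr (2 * m) * exp (- b * k)) + (2 * C) * (k powr (2 * m + 1) * exp (- b * k))) \<longlongrightarrow>
        (2 * C) * 0 + (2 * C) * 0) at_top"
      by (intro tendsto_add tendsto_mult tendsto_const powr_times_exp_tendsto_0 b)
    \<comment> \<open>\<open>h powr (- (2 * m))\<close> is written as
      \<open>(n h * h) powr (- (2 * m)) * n h powr (2 * m)\<close>: the first factor converges, the
      second is a power of \<open>n h\<close> and loses against the exponential.\<close>
    have 2: "((\<lambda>h. (real (n h) * h) powr (- (2 * m)) *
        ((2 * C) * (real (n h) powr (2 * m) * exp (- b * real (n h))) +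
         (2 * C) * (real (n h) powr (2 * m + 1) * exp (- b * real (n h))))) \<longlongrightarrow>
        x0 powr (- (2 * m)) * ((2 * C) * 0 + (2 * C) * 0)) (at_right 0)"
      using x0 by (intro tendsto_mult tendsto_powr n_lim(1) tendsto_const filterlim_compose[OF 1 n_lim(2)]) auto
    have "eventually (\<lambda>h. h > 0 \<and> n h > 0) (at_right 0)"
      using eventually_at_right_less[of "0 :: real"] n_lim(2)[unfolded filterlim_at_top_dense, rule_format, of 0]
      by eventually_elim auto
    then have "eventually (\<lambda>h. (real (n h) * h) powr (- (2 * m)) *
        ((2 * C) * (real (n h) powr (2 * m) * exp (- b * real (n h))) +
         (2 * C) * (real (n h) powr (2 * m + 1) * exp (- b * real (n h)))) =
        h powr (- (2 * m)) * ?e h) (at_right 0)"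
    proof (rule eventually_mono)
      fix h assume "h > 0 \<and> n h > 0"
      then show "(real (n h) * h) powr (- (2 * m)) *
        ((2 * C) * (real (n h) powr (2 * m) * exp (- b * real (n h))) +
         (2 * C) * (real (n h) powr (2 * m + 1) * exp (- b * real (n h)))) =
        h powr (- (2 * m)) * ?e h"
        by (simp add: powr_mult powr_add powr_minus field_simps)
    qed
    from tendsto_cong[THEN iffD1, OF this 2] show ?thesis by simp
  qed
  have ev: "eventually (\<lambda>\<epsilon>. \<epsilon> powr (- (4 * m / (2 * m + 1))) > 0 \<and> ?e (H \<epsilon>) \<ge> 0 \<and>
      ennreal (H \<epsilon> powr (2 * m) * ?l (H \<epsilon>) (B \<epsilon> * H \<epsilon>)) \<le>
      quantized_minimax_risk \<epsilon> m c (B \<epsilon>) + ennreal (?e (H \<epsilon>))) (at_right 0)"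
  proof -
    have "eventually (\<lambda>h. n h > 0 \<and> real (n h) \<ge> 8 * K / (\<delta> * C)) (at_right 0)"
      using n_lim(2)[unfolded filterlim_at_top_dense, rule_format, of 0]
        n_lim(2)[unfolded filterlim_at_top, rule_format, of "8 * K / (\<delta> * C)"]
      by eventually_elim auto
    from eventually_compose_filterlim[OF this H_lim] eventually_at_right_less[of "0 :: real"]
    show ?thesis
    proof eventually_elim
      case (elim \<epsilon>)
      then show ?case
        using discretized_risk_ge[OF less_imp_le[OF m] c H_pos x0 s \<delta> moment, of \<epsilon> "B \<epsilon>"] C H_inv
        unfolding n_def K_def C_def I_def J_def L_def b_def by (simp add: mult.assoc)
    qed
  qed
  have wl: "eventually (\<lambda>\<epsilon>. ?l (H \<epsilon>) (B \<epsilon> * H \<epsilon>) =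
      \<epsilon> powr (- (4 * m / (2 * m + 1))) * (H \<epsilon> powr (2 * m) * ?l (H \<epsilon>) (B \<epsilon> * H \<epsilon>))) (at_right 0)"
    using eventually_at_right_less[of "0 :: real"]
  proof (rule eventually_mono)
    fix \<epsilon> :: real assume "0 < \<epsilon>"
    then have "H \<epsilon> powr (- (2 * m)) * H \<epsilon> powr (2 * m) = 1"
      using H_pos[of \<epsilon>] by (simp add: powr_add[symmetric])
    then show "?l (H \<epsilon>) (B \<epsilon> * H \<epsilon>) =
      \<epsilon> powr (- (4 * m / (2 * m + 1))) * (H \<epsilon> powr (2 * m) * ?l (H \<epsilon>) (B \<epsilon> * H \<epsilon>))"
      unfolding H_w by (simp only: mult.assoc[symmetric] mult_1_left)
  qed
  have we: "((\<lambda>\<epsilon>. \<epsilon> powr (- (4 * m / (2 * m + 1))) * ?e (H \<epsilon>)) \<longlongrightarrow> 0) (at_right 0)"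
    unfolding H_w using filterlim_compose[OF e_lim H_lim] .
  have H0: "(H \<longlongrightarrow> 0) (at_right 0)"
    using H_lim by (simp add: filterlim_at)
  show "ereal I \<le> W"
    unfolding W_def
  proof (rule Liminf_weighted_risk_ge[where e = "\<lambda>\<epsilon>. ?e (H \<epsilon>)" and l = "\<lambda>\<epsilon>. H \<epsilon> powr (2 * m) * (I - 3 * H \<epsilon>)"])
    show "eventually (\<lambda>\<epsilon>. \<epsilon> powr (- (4 * m / (2 * m + 1))) > 0 \<and> ?e (H \<epsilon>) \<ge> 0 \<and>
      ennreal (H \<epsilon> powr (2 * m) * (I - 3 * H \<epsilon>)) \<le>
      quantized_minimax_risk \<epsilon> m c (B \<epsilon>) + ennreal (?e (H \<epsilon>))) (at_right 0)"
      using ev eventually_at_right_less[of "0 :: real"]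
    proof eventually_elim
      case (elim \<epsilon>)
      have "ennreal (H \<epsilon> powr (2 * m) * (I - 3 * H \<epsilon>)) \<le> ennreal (H \<epsilon> powr (2 * m) * ?l (H \<epsilon>) (B \<epsilon> * H \<epsilon>))"
        using H_pos[of \<epsilon>] elim by (intro ennreal_leI mult_left_mono) auto
      then show ?case using elim by (meson order_trans)
    qed
    have "((\<lambda>\<epsilon>. I - 3 * H \<epsilon>) \<longlongrightarrow> I - 3 * 0) (at_right 0)"
      by (intro tendsto_intros H0)
    then have lim: "((\<lambda>\<epsilon>. I - 3 * H \<epsilon>) \<longlongrightarrow> I) (at_right 0)" by simp
    have "eventually (\<lambda>\<epsilon>. I - 3 * H \<epsilon> =
        \<epsilon> powr (- (4 * m / (2 * m + 1))) * (H \<epsilon> powr (2 * m) * (I - 3 * H \<epsilon>))) (at_right 0)"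
      using eventually_at_right_less[of "0 :: real"]
    proof (rule eventually_mono)
      fix \<epsilon> :: real assume "0 < \<epsilon>"
      then have "H \<epsilon> powr (- (2 * m)) * H \<epsilon> powr (2 * m) = 1"
        using H_pos[of \<epsilon>] by (simp add: powr_add[symmetric])
      then show "I - 3 * H \<epsilon> = \<epsilon> powr (- (4 * m / (2 * m + 1))) * (H \<epsilon> powr (2 * m) * (I - 3 * H \<epsilon>))"
        unfolding H_w by (simp only: mult.assoc[symmetric] mult_1_left)
    qed
    from tendsto_cong[THEN iffD1, OF this lim]
    show "((\<lambda>\<epsilon>. \<epsilon> powr (- (4 * m / (2 * m + 1))) * (H \<epsilon> powr (2 * m) * (I - 3 * H \<epsilon>))) \<longlongrightarrow> I) (at_right 0)" .
  qed (use we in auto)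
  assume d: "((\<lambda>\<epsilon>. B \<epsilon> * \<epsilon> powr (2 / (2 * m + 1))) \<longlongrightarrow> d) (at_right 0)" and d0: "d \<ge> 0"
  have nH: "((\<lambda>\<epsilon>. real (n (H \<epsilon>)) * H \<epsilon>) \<longlongrightarrow> x0) (at_right 0)"
    using filterlim_compose[OF n_lim(1) H_lim] .
  have "((\<lambda>\<epsilon>. ?l (H \<epsilon>) (B \<epsilon> * H \<epsilon>)) \<longlongrightarrow>
      I - 3 * 0 + x0 * exp ((J - 3 * 0 * L) / x0 - 2 * d * ln 2 / x0)) (at_right 0)"
    using x0 d unfolding H_def[symmetric] by (intro tendsto_intros H0 nH) auto
  from tendsto_cong[THEN iffD1, OF wl this]
  have "ereal (I + x0 * exp (J / x0 - 2 * d * ln 2 / x0)) \<le> W"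
    unfolding W_def by (intro Liminf_weighted_risk_ge[OF _ ev _ we]) auto
  \<comment> \<open>Counting bits gives \<open>d * ln 2\<close> in the limit where the objective has
    \<open>d\<close>; since \<open>ln 2 \<le> 1\<close> the limit is the larger one.\<close>
  moreover have "variational_objective d x0 s \<le> I + x0 * exp (J / x0 - 2 * d * ln 2 / x0)"
  proof -
    have "ln 2 \<le> (1 :: real)" using ln_2_less_1 by simp
    then have "2 * d * ln 2 \<le> 2 * d" using d0 by (simp add: mult_left_le)
    then have "J / x0 - 2 * d / x0 \<le> J / x0 - 2 * d * ln 2 / x0"
      using x0 by (intro diff_mono divide_right_mono) auto
    then show ?thesis
      using x0 by (simp add: variational_objective_def quantization_level_def I_def J_def)
  qed
  ultimately show "ereal (variational_objective d x0 s) \<le> W"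
    by (meson ereal_less_eq(3) order_trans)
qed

subsection \<open>General profiles and the Pinsker constant\<close>

lemma set_integral_dominated_tendsto:
  fixes f :: "nat \<Rightarrow> real \<Rightarrow> real"
  assumes A: "A \<in> sets borel" and f: "\<And>k. f k \<in> borel_measurable borel"
    and w: "set_integrable lborel A w"
    and lim: "\<And>x. x \<in> A \<Longrightarrow> (\<lambda>k. f k x) \<longlonglongrightarrow> g x"
    and bound: "\<And>k x. x \<in> A \<Longrightarrow> \<bar>f k x\<bar> \<le> w x"
  shows "(\<lambda>k. LBINT x:A. f k x) \<longlonglongrightarrow> (LBINT x:A. g x)"
proof -
  have fA: "(\<lambda>x. indicator A x *\<^sub>R f k x) \<in> borel_measurable lborel" for k
    using A f by measurable
  have lim': "(\<lambda>k. indicator A x *\<^sub>R f k x) \<longlonglongrightarrow> indicator A x *\<^sub>R g x" for x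
    using lim by (cases "x \<in> A") auto
  \<comment> \<open>Measurability of the limit on \<open>A\<close> comes from the convergence; a
    profile is only known to be decreasing on its interval.\<close>
  have gA: "(\<lambda>x. indicator A x *\<^sub>R g x) \<in> borel_measurable lborel"
    by (rule borel_measurable_LIMSEQ_real[OF lim' fA])
  show ?thesis
    unfolding set_lebesgue_integral_def
    by (rule integral_dominated_convergence[OF gA fA w[unfolded set_integrable_def]])
      (use lim' bound in \<open>auto simp: indicator_def\<close>)
qed

lemma
  fixes a b :: real
  assumes a: "a > - 1" and b: "b \<ge> 0"
  shows set_integrable_powr_from_0: "set_integrable lborel {0<..b} (\<lambda>x. x powr a)"
    and set_integral_powr_from_0: "(LBINT x:{0<..b}. x powr a) = b powr (a + 1) / (a + 1)"
proof -
  have hk: "((\<lambda>x. x powr a) has_integral (b powr (a + 1) / (a + 1))) {0..b}"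
    using a b by (rule has_integral_powr_from_0)
  have hk': "((\<lambda>x. x powr a) has_integral (b powr (a + 1) / (a + 1))) {0<..b}"
    using hk by (subst has_integral_spike_set_eq[where T = "{0..b}"]) (auto intro: negligible_subset[of "{0}"])
  then have "(\<lambda>x. x powr a) absolutely_integrable_on {0<..b}"
    by (intro nonnegative_absolutely_integrable_1) (auto simp: has_integral_integrable)
  then show int: "set_integrable lborel {0<..b} (\<lambda>x. x powr a)"
    unfolding set_integrable_def by (subst (asm) integrable_completion) auto
  show "(LBINT x:{0<..b}. x powr a) = b powr (a + 1) / (a + 1)"
    using set_borel_integral_eq_integral(2)[OF int] hk' by (simp add: integral_unique)
qed

text \<open>A general profile may be unbounded near 0 and may exhaust the moment constraint.
  Freezing it near 0 and shrinking it slightly gives globally decreasing bounded profiles with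
  slack, to which \<open>bounded_profile_liminf_ge\<close> applies; the lower bounds converge to the
  claimed ones.\<close>

lemma profile_liminf_ge:
  fixes s :: "real \<Rightarrow> real" and m c x0 :: real and B :: "real \<Rightarrow> real"
  assumes m: "m > 0" and c: "c \<noteq> 0" and x0: "x0 > 0"
    and pos: "\<And>x. x \<in> {0<..x0} \<Longrightarrow> s x > 0" and anti: "antimono_on {0<..x0} s"
    and int: "set_integrable lborel {0<..x0} (\<lambda>x. x powr (2 * m) * s x)"
    and moment: "(LBINT x:{0<..x0}. x powr (2 * m) * s x) \<le> c\<^sup>2 / pi powr (2 * m)"
  defines "W \<equiv> Liminf (at_right 0) (\<lambda>\<epsilon>. ereal (\<epsilon> powr (- (4 * m / (2 * m + 1)))) *
               enn2ereal (quantized_minimax_risk \<epsilon> m c (B \<epsilon>)))"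
  shows "ereal (LBINT x:{0<..x0}. s x / (s x + 1)) \<le> W"
    and "((\<lambda>\<epsilon>. B \<epsilon> * \<epsilon> powr (2 / (2 * m + 1))) \<longlongrightarrow> d) (at_right 0) \<Longrightarrow> d \<ge> 0 \<Longrightarrow>
      ereal (variational_objective d x0 s) \<le> W"
proof -
  let ?C = "c\<^sup>2 / pi powr (2 * m)"
  \<comment> \<open>Shrinking by \<open>r k\<close> creates the slack
    \<open>\<delta> = 1 / (k + 2)\<close>. The 2 keeps \<open>r k \<ge> 1 / 2\<close>, so that half
    of \<open>s x0\<close> bounds all approximants from below.\<close>
  define r where "r k = 1 - 1 / (real k + 2)" for k
  \<comment> \<open>Clamping the argument to the interval from \<open>x0 / (k + 1)\<close> to
    \<open>x0\<close> caps the profile near 0 and extends it to a decreasing function on the whole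
    line.\<close>
  define p where "p k x = max (x0 / (real k + 1)) (min x x0)" for k x
  define sk where "sk k x = r k * s (p k x)" for k x
  define s0 where "s0 = s x0 / 2"
  have r: "1 / 2 \<le> r k" "r k \<le> 1" for k by (simp_all add: r_def field_simps)
  have p: "p k x \<in> {0<..x0}" for k x
  proof -
    have "0 < x0 / (real k + 1)" "x0 / (real k + 1) \<le> x0" using x0 by (auto simp: field_simps)
    then show ?thesis by (auto simp: p_def less_max_iff_disj)
  qed
  have s_le: "s y \<le> s x" if "x \<in> {0<..x0}" "y \<in> {0<..x0}" "x \<le> y" for x y
    using monotone_onD[OF anti that] .
  have s0: "s0 > 0" using pos[of x0] x0 by (simp add: s0_def)
  have sk_anti: "antimono (sk k)" for k
  proof (rule antimonoI)
    fix x y :: real assume "x \<le> y"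
    then have "p k x \<le> p k y" by (auto simp: p_def)
    then show "sk k y \<le> sk k x" unfolding sk_def using r[of k] p by (intro mult_left_mono s_le) auto
  qed
  have sk_ge: "s0 \<le> sk k x" for k x
  proof -
    have "s x0 \<le> s (p k x)" using p[of k x] x0 by (intro s_le) auto
    then have "1 / 2 * s x0 \<le> r k * s (p k x)" using r[of k] pos[of x0] x0 by (intro mult_mono) auto
    then show ?thesis by (simp add: s0_def sk_def)
  qed
  have sk_pos: "sk k x > 0" for k x using sk_ge[of k x] s0 by linarith
  have sk_le: "sk k x \<le> s (x0 / (real k + 1))" for k x
  proof -
    have "s (p k x) \<le> s (x0 / (real k + 1))"
      using p[of k x] x0 by (intro s_le) (auto simp: p_def field_simps)
    then have "r k * s (p k x) \<le> 1 * s (x0 / (real k + 1))"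
      using r[of k] pos[OF p[of k x]] by (intro mult_mono) auto
    then show ?thesis by (simp add: sk_def)
  qed
  have sk_meas [measurable]: "sk k \<in> borel_measurable borel" for k by (rule borel_measurable_antimono) (rule sk_anti)
  have sk_le_s: "sk k x \<le> r k * s x" if x: "x \<in> {0<..x0}" for k x
    unfolding sk_def using r[of k] p x by (intro mult_left_mono s_le) (auto simp: p_def)
  have sk_lim: "(\<lambda>k. sk k x) \<longlonglongrightarrow> s x" if x: "x \<in> {0<..x0}" for x
  proof -
    have "r \<longlonglongrightarrow> 1" unfolding r_def by real_asymp
    from tendsto_mult[OF this tendsto_const[of "s x"]]
    have lim: "(\<lambda>k. r k * s x) \<longlonglongrightarrow> s x" by simp
    have "(\<lambda>k. x0 / (real k + 1)) \<longlonglongrightarrow> 0" by real_asymp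
    then have "eventually (\<lambda>k. x0 / (real k + 1) < x) sequentially"
      using x by (intro order_tendstoD) auto
    then have "eventually (\<lambda>k. r k * s x = sk k x) sequentially"
      by (rule eventually_mono) (use x in \<open>auto simp: sk_def p_def\<close>)
    from tendsto_cong[THEN iffD1, OF this lim] show ?thesis .
  qed
  have mom: "(LBINT x:{0<..x0}. x powr (2 * m) * sk k x) \<le> (1 - 1 / (real k + 2)) * ?C" for k
  proof -
    have "(LBINT x:{0<..x0}. x powr (2 * m) * sk k x) \<le> (LBINT x:{0<..x0}. r k * (x powr (2 * m) * s x))"
    proof (rule set_integral_mono)
      show "set_integrable lborel {0<..x0} (\<lambda>x. x powr (2 * m) * sk k x)"
        using sk_le sk_pos m
        by (intro set_integrable_powr_mult_bounded[where M = "s (x0 / (real k + 1))"]) (auto simp: less_imp_le)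
      show "set_integrable lborel {0<..x0} (\<lambda>x. r k * (x powr (2 * m) * s x))"
        using int by (rule set_integrable_mult_right)
      fix x assume "x \<in> {0<..x0}"
      then show "x powr (2 * m) * sk k x \<le> r k * (x powr (2 * m) * s x)"
        using mult_left_mono[OF sk_le_s[of x k], of "x powr (2 * m)"] by (simp add: mult_ac)
    qed
    also have "\<dots> = r k * (LBINT x:{0<..x0}. x powr (2 * m) * s x)" by simp
    also have "\<dots> \<le> r k * ?C" using moment r[of k] by (intro mult_left_mono) auto
    finally show ?thesis by (simp add: r_def)
  qed
  have \<delta>: "0 < 1 / (real k + 2)" "1 / (real k + 2) \<le> 1" for k by auto
  note bounded = bounded_profile_liminf_ge[OF m c x0 sk_anti s0 sk_ge sk_le \<delta> mom, where B = B, folded W_def]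
  have I: "(\<lambda>k. LBINT x:{0<..x0}. sk k x / (sk k x + 1)) \<longlonglongrightarrow> (LBINT x:{0<..x0}. s x / (s x + 1))"
  proof (rule set_integral_dominated_tendsto)
    show "set_integrable lborel {0<..x0} (\<lambda>_. 1 :: real)"
      by (rule set_integrable_bounded[where M = 1]) auto
    fix x assume x: "x \<in> {0<..x0}"
    then show "(\<lambda>k. sk k x / (sk k x + 1)) \<longlonglongrightarrow> s x / (s x + 1)"
      using pos[OF x] by (intro tendsto_intros sk_lim) auto
    show "\<bar>sk k x / (sk k x + 1)\<bar> \<le> 1" for k using sk_pos[of k x] by simp
  qed auto
  show "ereal (LBINT x:{0<..x0}. s x / (s x + 1)) \<le> W"
    using tendsto_ereal[OF I] bounded(1) by (rule LIMSEQ_le_const2[OF _ exI, OF _ allI, OF _ impI])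
  have J: "(\<lambda>k. LBINT x:{0<..x0}. ln ((sk k x)\<^sup>2 / (sk k x + 1))) \<longlonglongrightarrow> (LBINT x:{0<..x0}. ln ((s x)\<^sup>2 / (s x + 1)))"
  proof (rule set_integral_dominated_tendsto)
    \<comment> \<open>Below, the logarithm is bounded by its value at \<open>s0\<close>. Above, it
      is at most \<open>ln (s x) = ln (x powr (2 * m) * s x) - 2 * m * ln x\<close>, and
      \<open>ln z \<le> z - 1\<close>, applied to \<open>x powr (2 * m) * s x\<close> and to
      \<open>x powr (- 1 / 2)\<close>, yields integrable bounds: the first by the moment
      constraint.\<close>
    let ?l = "\<bar>ln (s0\<^sup>2 / (s0 + 1))\<bar>"
    show "set_integrable lborel {0<..x0} (\<lambda>x. ?l + (x powr (2 * m) * s x + (4 * m) * x powr (- 1 / 2)))"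
      using x0 by (intro set_integral_add(1) int set_integrable_mult_right set_integrable_powr_from_0
          set_integrable_bounded[where M = ?l]) auto
    fix x assume x: "x \<in> {0<..x0}"
    have "(s x)\<^sup>2 / (s x + 1) > 0" using pos[OF x] by (intro divide_pos_pos) auto
    then show "(\<lambda>k. ln ((sk k x)\<^sup>2 / (sk k x + 1))) \<longlonglongrightarrow> ln ((s x)\<^sup>2 / (s x + 1))"
      using pos[OF x] x by (intro tendsto_intros sk_lim) auto
    fix k
    have "ln ((sk k x)\<^sup>2 / (sk k x + 1)) \<le> ln (s x)"
    proof (rule ln_mono)
      have "sk k x * (sk k x / (sk k x + 1)) \<le> s x * 1"
      proof (rule mult_mono)
        have "r k * s x \<le> 1 * s x" using r[of k] pos[OF x] by (intro mult_right_mono) auto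
        then show "sk k x \<le> s x" using sk_le_s[OF x, of k] by simp
      qed (use sk_pos[of k x] pos[OF x] in auto)
      then show "(sk k x)\<^sup>2 / (sk k x + 1) \<le> s x" by (simp add: power2_eq_square)
      show "0 < (sk k x)\<^sup>2 / (sk k x + 1)" using sk_pos[of k x] by (intro divide_pos_pos) auto
    qed
    also have "\<dots> \<le> x powr (2 * m) * s x + (4 * m) * x powr (- 1 / 2)"
    proof -
      have "ln (x powr (2 * m) * s x) \<le> x powr (2 * m) * s x - 1"
        using x pos[OF x] by (intro ln_le_minus_one) auto
      moreover have "ln (x powr (2 * m) * s x) = 2 * m * ln x + ln (s x)"
        using x pos[OF x] by (simp add: ln_mult_pos ln_powr)
      moreover have "ln (x powr (- 1 / 2)) \<le> x powr (- 1 / 2) - 1"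
        using x by (intro ln_le_minus_one) auto
      then have "(4 * m) * (- 1 / 2 * ln x) \<le> (4 * m) * x powr (- 1 / 2)"
        using x m by (intro mult_left_mono) (auto simp: ln_powr)
      ultimately show ?thesis by simp
    qed
    finally have "ln ((sk k x)\<^sup>2 / (sk k x + 1)) \<le> x powr (2 * m) * s x + (4 * m) * x powr (- 1 / 2)" .
    moreover have "ln (s0\<^sup>2 / (s0 + 1)) \<le> ln ((sk k x)\<^sup>2 / (sk k x + 1))"
      using s0 sk_ge by (rule ln_square_quotient_mono)
    moreover have "x powr (2 * m) * s x \<ge> 0" "(4 * m) * x powr (- 1 / 2) \<ge> 0"
      using pos[OF x] m by auto
    ultimately show "\<bar>ln ((sk k x)\<^sup>2 / (sk k x + 1))\<bar> \<le> ?l + (x powr (2 * m) * s x + (4 * m) * x powr (- 1 / 2))"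
      by linarith
  qed auto
  assume d: "((\<lambda>\<epsilon>. B \<epsilon> * \<epsilon> powr (2 / (2 * m + 1))) \<longlongrightarrow> d) (at_right 0)" "d \<ge> 0"
  have "(\<lambda>k. variational_objective d x0 (sk k)) \<longlonglongrightarrow> variational_objective d x0 s"
    unfolding variational_objective_def quantization_level_def by (intro tendsto_intros I J)
  from tendsto_ereal[OF this] bounded(2)[OF d] show "ereal (variational_objective d x0 s) \<le> W"
    by (rule LIMSEQ_le_const2[OF _ exI, OF _ allI, OF _ impI])
qed

text \<open>For \<open>s x = (y / x) powr m - 1\<close> one has
  \<open>s x / (s x + 1) = 1 - (x / y) powr m\<close>, whose integral up to \<open>y\<close> is
  \<open>y - y / (m + 1)\<close>, the Pinsker constant. Only the bound without quantization term
  enters.\<close>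

lemma pinsker_const_le_liminf:
  fixes m c :: real and B :: "real \<Rightarrow> real"
  assumes m: "m > 0" and c: "c \<noteq> 0"
  shows "ereal (pinsker_const m c) \<le> Liminf (at_right 0) (\<lambda>\<epsilon>. ereal (\<epsilon> powr (- (4 * m / (2 * m + 1)))) *
               enn2ereal (quantized_minimax_risk \<epsilon> m c (B \<epsilon>)))" (is "_ \<le> ?W")
proof -
  define C where "C = c\<^sup>2 / pi powr (2 * m)"
  define D where "D = C * (2 * m + 1)"
  \<comment> \<open>Chosen to meet the moment constraint with equality: the moment up to
    \<open>y\<close> is \<open>y powr (2 * m + 1) * (1 / (m + 1) - 1 / (2 * m + 1))\<close>, which
    must equal \<open>C\<close>.\<close>
  define y where "y = (D * ((m + 1) / m)) powr (1 / (2 * m + 1))"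
  have C: "C > 0" using c by (simp add: C_def)
  have D: "D > 0" using C m by (simp add: D_def)
  have y: "y > 0" using D m by (simp add: y_def)
  have y_pow: "y powr (2 * m + 1) = D * ((m + 1) / m)"
    using D m by (simp add: y_def powr_powr)
  have pinsker: "pinsker_const m c = y - y / (m + 1)"
  proof -
    have "((m + 1) / m) powr (1 / (2 * m + 1)) * (m / (m + 1)) = (m / (m + 1)) powr (2 * m / (2 * m + 1))"
    proof -
      have "2 * m / (2 * m + 1) = 1 - 1 / (2 * m + 1)" using m by (simp add: field_simps)
      then have "(m / (m + 1)) powr (2 * m / (2 * m + 1)) = (m / (m + 1)) / (m / (m + 1)) powr (1 / (2 * m + 1))"
        using m by (simp add: powr_diff)
      also have "\<dots> = ((m + 1) / m) powr (1 / (2 * m + 1)) * (m / (m + 1))"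
        using m by (simp add: powr_divide mult.commute)
      finally show ?thesis ..
    qed
    moreover have "y = D powr (1 / (2 * m + 1)) * ((m + 1) / m) powr (1 / (2 * m + 1))"
      unfolding y_def using D m by (intro powr_mult)
    ultimately have "y * (m / (m + 1)) = D powr (1 / (2 * m + 1)) * (m / (m + 1)) powr (2 * m / (2 * m + 1))"
      by (simp only: mult.assoc)
    also have "D = c\<^sup>2 * (2 * m + 1) / pi powr (2 * m)" by (simp add: D_def C_def)
    finally have "pinsker_const m c = y * (m / (m + 1))" by (simp add: pinsker_const_def)
    also have "\<dots> = y - y / (m + 1)" using m by (simp add: field_simps)
    finally show ?thesis .
  qed
  \<comment> \<open>The profile vanishes at \<open>y\<close>, while \<open>profile_liminf_ge\<close>
    asks for positivity up to the right endpoint; hence the interval ends at \<open>r * y\<close>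
    with \<open>r < 1\<close>, and \<open>r\<close> tends to 1 at the end.\<close>
  have le: "ereal (r * y - y powr (- m) * ((r * y) powr (m + 1) / (m + 1))) \<le> ?W" if r: "0 < r" "r < 1" for r
  proof -
    define b where "b = r * y"
    have b: "0 < b" "b < y" using r y by (auto simp: b_def)
    define s where "s x = (y / x) powr m - 1" for x
    have weighted: "x powr (2 * m) * s x = y powr m * x powr m - x powr (2 * m)" if "x > 0" for x
    proof -
      have "x powr (2 * m) = x powr m * x powr m" by (simp add: powr_add[symmetric])
      then show ?thesis using that y by (simp add: s_def powr_divide right_diff_distrib)
    qed
    have int: "set_integrable lborel {0<..z} (\<lambda>x. y powr m * x powr m - x powr (2 * m))" if "z \<ge> 0" for z
      using m that by (intro set_integral_diff(1) set_integrable_mult_right set_integrable_powr_from_0) auto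
    have nonneg: "0 \<le> y powr m * x powr m - x powr (2 * m)" if "0 < x" "x \<le> y" for x
    proof -
      have "x powr m * x powr m \<le> y powr m * x powr m" using that m by (intro mult_right_mono powr_mono2) auto
      then show ?thesis by (simp add: powr_add[symmetric])
    qed
    have "ereal (LBINT x:{0<..b}. s x / (s x + 1)) \<le> ?W"
    proof (rule profile_liminf_ge(1)[OF m c b(1)])
      show "s x > 0" if "x \<in> {0<..b}" for x
      proof -
        have "1 < y / x" using that b by (auto simp: field_simps)
        then have "1 powr m < (y / x) powr m" using m by (intro powr_less_mono2) auto
        then show ?thesis by (simp add: s_def)
      qed
      show "antimono_on {0<..b} s"
        using m y by (intro monotone_onI) (auto simp: s_def intro!: powr_mono2 divide_left_mono)
      have eq: "indicator {0<..b} x *\<^sub>R (x powr (2 * m) * s x) =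
          indicator {0<..b} x *\<^sub>R (y powr m * x powr m - x powr (2 * m))" for x
        using weighted[of x] by (auto simp: indicator_def)
      show "set_integrable lborel {0<..b} (\<lambda>x. x powr (2 * m) * s x)"
        using int[of b] b unfolding set_integrable_def eq by simp
      have "(LBINT x:{0<..b}. x powr (2 * m) * s x) = (LBINT x:{0<..b}. y powr m * x powr m - x powr (2 * m))"
        unfolding set_lebesgue_integral_def eq ..
      also have "\<dots> \<le> (LBINT x:{0<..y}. y powr m * x powr m - x powr (2 * m))"
        using int[of b] int[of y] b y nonneg unfolding set_lebesgue_integral_def set_integrable_def
        by (intro integral_mono) (auto simp: indicator_def)
      also have "\<dots> = y powr m * (LBINT x:{0<..y}. x powr m) - (LBINT x:{0<..y}. x powr (2 * m))"
        using m y by (subst set_integral_diff(2)) (auto intro!: set_integrable_mult_right set_integrable_powr_from_0)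
      also have "\<dots> = y powr m * (y powr (m + 1) / (m + 1)) - y powr (2 * m + 1) / (2 * m + 1)"
        using m y by (simp add: set_integral_powr_from_0)
      also have "y powr m * (y powr (m + 1) / (m + 1)) = y powr (2 * m + 1) / (m + 1)"
      proof -
        have "y powr m * y powr (m + 1) = y powr (2 * m + 1)" by (simp add: powr_add[symmetric])
        then show ?thesis by simp
      qed
      also have "y powr (2 * m + 1) / (m + 1) - y powr (2 * m + 1) / (2 * m + 1) = C"
        unfolding y_pow D_def using m by (simp add: divide_simps) (simp add: algebra_simps)
      finally show "(LBINT x:{0<..b}. x powr (2 * m) * s x) \<le> c\<^sup>2 / pi powr (2 * m)" by (simp add: C_def)
    qed
    moreover have "(LBINT x:{0<..b}. s x / (s x + 1)) = b - y powr (- m) * (b powr (m + 1) / (m + 1))"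
    proof -
      have eq: "indicator {0<..b} x *\<^sub>R (s x / (s x + 1)) = indicator {0<..b} x *\<^sub>R (1 - y powr (- m) * x powr m)" for x
        using y by (auto simp: indicator_def s_def powr_divide powr_minus field_simps)
      have "(LBINT x:{0<..b}. s x / (s x + 1)) = (LBINT x:{0<..b}. 1 - y powr (- m) * x powr m)"
        unfolding set_lebesgue_integral_def eq ..
      also have "\<dots> = (LBINT x:{0<..b}. 1) - y powr (- m) * (LBINT x:{0<..b}. x powr m)"
      proof (subst set_integral_diff(2))
        show "set_integrable lborel {0<..b} (\<lambda>_. 1 :: real)" by (rule set_integrable_bounded[where M = 1]) auto
        show "set_integrable lborel {0<..b} (\<lambda>x. y powr (- m) * x powr m)"
          using m b by (intro set_integrable_mult_right set_integrable_powr_from_0) auto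
      qed simp
      also have "\<dots> = b - y powr (- m) * (b powr (m + 1) / (m + 1))"
        using m b by (simp add: set_integral_powr_from_0 set_integral_const)
      finally show ?thesis .
    qed
    ultimately show ?thesis by (simp add: b_def)
  qed
  have "((\<lambda>r. r * y - y powr (- m) * ((r * y) powr (m + 1) / (m + 1))) \<longlongrightarrow>
      1 * y - y powr (- m) * ((1 * y) powr (m + 1) / (m + 1))) (at_left 1)"
    using m y by (intro tendsto_intros) auto
  moreover have "1 * y - y powr (- m) * ((1 * y) powr (m + 1) / (m + 1)) = pinsker_const m c"
    using y by (simp add: pinsker powr_add powr_minus field_simps)
  ultimately have "((\<lambda>r. ereal (r * y - y powr (- m) * ((r * y) powr (m + 1) / (m + 1)))) \<longlongrightarrow>
      ereal (pinsker_const m c)) (at_left 1)"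
    by (intro tendsto_ereal) simp
  then show ?thesis
  proof (rule tendsto_upperbound)
    show "eventually (\<lambda>r. ereal (r * y - y powr (- m) * ((r * y) powr (m + 1) / (m + 1))) \<le> ?W) (at_left 1)"
      using eventually_at_left_real[OF zero_less_one] by (rule eventually_mono) (use le in auto)
  qed simp
qed

subsection \<open>Small budgets\<close>

text \<open>One half of Stirling's formula: the right side is the integral of \<open>ln\<close> from
  1 to \<open>n + 1\<close>. The precision suffices because only \<open>ln (n!) / n\<close> up to a
  vanishing error is used.\<close>

lemma sum_ln_Suc_le:
  "(\<Sum>j<n. ln (real (Suc j))) \<le> (real n + 1) * ln (real n + 1) - real n"
proof (induction n)
  case (Suc n)
  define a where "a = real n + 1"
  have a: "a > 0" by (simp add: a_def)
  have "ln (a / (a + 1)) \<le> a / (a + 1) - 1" using a by (intro ln_le_minus_one) auto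
  then have "ln a - ln (a + 1) \<le> - (1 / (a + 1))" using a by (simp add: ln_div field_simps)
  then have "(a + 1) * (ln a - ln (a + 1)) \<le> (a + 1) * - (1 / (a + 1))"
    using a by (intro mult_left_mono) auto
  then have "(a + 1) * ln a + 1 \<le> (a + 1) * ln (a + 1)" using a by (simp add: right_diff_distrib)
  moreover have "(\<Sum>j<Suc n. ln (real (Suc j))) \<le> a * ln a - real n + ln a"
    using Suc.IH by (simp add: a_def add.commute)
  ultimately have "(\<Sum>j<Suc n. ln (real (Suc j))) \<le> (a + 1) * ln (a + 1) - (real n + 1)"
    by (simp only: distrib_right)
  then show ?case by (simp only: a_def of_nat_Suc add_ac)
qed simp

text \<open>Variances proportional to \<open>(j + 1) powr (- 2 * m)\<close> give every coordinate
  the same share \<open>K / n\<close> of the weighted norm, and their geometric mean involves only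
  \<open>ln (n!)\<close>. The factor involving \<open>\<epsilon>\<close> accounts for the noise; the
  posterior variances are dropped.\<close>

lemma low_noise_risk_ge:
  fixes m c \<epsilon> \<delta> B :: real and n :: nat
  defines "C \<equiv> c\<^sup>2 / pi powr (2 * m)"
  assumes m: "m \<ge> 0" and c: "c \<noteq> 0" and \<epsilon>: "\<epsilon> > 0" and \<delta>: "0 < \<delta>" "\<delta> < 1"
    and n: "n > 0" "real n \<ge> 8 * (1 - \<delta>) / \<delta>"
  shows "ennreal ((1 - \<delta>) * C / (1 + \<epsilon>\<^sup>2 * real n powr (2 * m + 1) / ((1 - \<delta>) * C)) *
      exp (2 * m - 2 * m * ((real n + 1) * ln (real n + 1) / n) - 2 * B * ln 2 / n)) \<le>
    quantized_minimax_risk \<epsilon> m c B +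
      ennreal ((2 * C + 2 * real n * C) * exp (- (\<delta>\<^sup>2 / (16 * (1 - \<delta>))) * n))"
proof -
  define K where "K = (1 - \<delta>) * C"
  \<comment> \<open>The largest ratio of noise variance to prior variance, attained at the last
    coordinate. It gives \<open>(v j)\<^sup>2 / (v j + \<epsilon>\<^sup>2) \<ge> v j / (1 +
    \<rho>)\<close> for all \<open>j < n\<close>.\<close>
  define \<rho> where "\<rho> = \<epsilon>\<^sup>2 * real n powr (2 * m + 1) / K"
  define v where "v j = K / n / real (Suc j) powr (2 * m)" for j
  define \<sigma> where "\<sigma> j = sqrt (v j)" for j
  have C: "C > 0" using c by (simp add: C_def)
  have K: "K > 0" using C \<delta> by (simp add: K_def)
  have \<rho>: "\<rho> \<ge> 0" using K by (simp add: \<rho>_def)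
  have v: "v j > 0" for j using K n by (simp add: v_def)
  have \<sigma>: "\<sigma> j > 0" for j using v by (simp add: \<sigma>_def)
  have \<sigma>2: "(\<sigma> j)\<^sup>2 = v j" for j using v[of j] by (simp add: \<sigma>_def)
  have u: "(sobolev_weight m j)\<^sup>2 * (\<sigma> j)\<^sup>2 = K / n" for j
  proof -
    have "(sobolev_weight m j)\<^sup>2 = real (Suc j) powr (2 * m)"
      by (simp add: sobolev_weight_def power2_eq_square powr_add[symmetric])
    then show ?thesis by (simp add: \<sigma>2 v_def)
  qed
  have main: "ennreal ((\<Sum>j<n. (\<sigma> j)\<^sup>2 * \<epsilon>\<^sup>2 / ((\<sigma> j)\<^sup>2 + \<epsilon>\<^sup>2)) +
      real n * exp ((\<Sum>j<n. ln (((\<sigma> j)\<^sup>2)\<^sup>2 / ((\<sigma> j)\<^sup>2 + \<epsilon>\<^sup>2))) / n - 2 * B * ln 2 / n)) \<le>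
    quantized_minimax_risk \<epsilon> m c B + ennreal ((2 * C + 2 * real n * C) * exp (- (C * \<delta>\<^sup>2 / (16 * K)) * n))"
    unfolding C_def
  proof (rule quantized_minimax_risk_ge[OF m c \<epsilon> \<sigma> \<delta>(1) _ K n(1)])
    have "8 * K / (\<delta> * C) = 8 * (1 - \<delta>) / \<delta>" using C by (simp add: K_def)
    then show "real n \<ge> 8 * K / (\<delta> * (c\<^sup>2 / pi powr (2 * m)))" using n by (simp add: C_def)
    show "(\<Sum>j<n. (sobolev_weight m j)\<^sup>2 * (\<sigma> j)\<^sup>2) \<le> (1 - \<delta>) * (c\<^sup>2 / pi powr (2 * m))"
      using n by (simp add: u K_def C_def)
  qed (use \<delta> u in auto)
  have ln_ge: "ln (K / n) - 2 * m * ln (real (Suc j)) - ln (1 + \<rho>) \<le> ln (((\<sigma> j)\<^sup>2)\<^sup>2 / ((\<sigma> j)\<^sup>2 + \<epsilon>\<^sup>2))"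
    if j: "j < n" for j
  proof -
    have "real (Suc j) powr (2 * m) \<le> real n powr (2 * m)" using j m by (intro powr_mono2) auto
    then have "\<epsilon>\<^sup>2 * n * real (Suc j) powr (2 * m) / K \<le> \<epsilon>\<^sup>2 * n * real n powr (2 * m) / K"
      using K by (intro divide_right_mono mult_left_mono) auto
    moreover have "\<epsilon>\<^sup>2 * n * real (Suc j) powr (2 * m) / K = \<epsilon>\<^sup>2 / v j" using K n by (simp add: v_def)
    moreover have "\<epsilon>\<^sup>2 * n * real n powr (2 * m) / K = \<rho>" using n by (simp add: \<rho>_def powr_add)
    ultimately have "\<epsilon>\<^sup>2 / v j \<le> \<rho>" by simp
    then have "\<epsilon>\<^sup>2 \<le> \<rho> * v j" using v[of j] by (simp add: field_simps)
    then have "v j + \<epsilon>\<^sup>2 \<le> (1 + \<rho>) * v j" by (simp add: algebra_simps)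
    then have "v j * (v j + \<epsilon>\<^sup>2) \<le> v j * ((1 + \<rho>) * v j)" using v[of j] by (intro mult_left_mono) auto
    moreover have "v j + \<epsilon>\<^sup>2 > 0" using v[of j] by (intro add_pos_nonneg) auto
    ultimately have "v j / (1 + \<rho>) \<le> (v j)\<^sup>2 / (v j + \<epsilon>\<^sup>2)"
      using \<rho> by (simp add: divide_simps power2_eq_square mult_ac)
    then have "ln (v j / (1 + \<rho>)) \<le> ln ((v j)\<^sup>2 / (v j + \<epsilon>\<^sup>2))"
      using v[of j] \<rho> by (intro ln_mono) auto
    moreover have "ln (v j / (1 + \<rho>)) = ln (v j) - ln (1 + \<rho>)" using v[of j] \<rho> by (simp add: ln_div)
    moreover have "ln (v j) = ln (K / n) - ln (real (Suc j) powr (2 * m))"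
      unfolding v_def using K n by (subst ln_div) auto
    moreover have "ln (real (Suc j) powr (2 * m)) = 2 * m * ln (real (Suc j))" by (simp add: ln_powr)
    ultimately show ?thesis unfolding \<sigma>2 by simp
  qed
  have "real n * (ln (K / n) - ln (1 + \<rho>)) - 2 * m * ((real n + 1) * ln (real n + 1) - real n) \<le>
      real n * (ln (K / n) - ln (1 + \<rho>)) - 2 * m * (\<Sum>j<n. ln (real (Suc j)))"
    using m by (intro diff_left_mono mult_left_mono sum_ln_Suc_le) auto
  also have "\<dots> = (\<Sum>j<n. ln (K / n) - 2 * m * ln (real (Suc j)) - ln (1 + \<rho>))"
    by (simp only: sum_subtractf sum_distrib_left[symmetric] sum_constant card_lessThan of_nat_mult) (simp add: algebra_simps)
  also have "\<dots> \<le> (\<Sum>j<n. ln (((\<sigma> j)\<^sup>2)\<^sup>2 / ((\<sigma> j)\<^sup>2 + \<epsilon>\<^sup>2)))"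
    using ln_ge by (intro sum_mono) auto
  finally have "(real n * (ln (K / n) - ln (1 + \<rho>)) - 2 * m * ((real n + 1) * ln (real n + 1) - real n)) / n \<le>
      (\<Sum>j<n. ln (((\<sigma> j)\<^sup>2)\<^sup>2 / ((\<sigma> j)\<^sup>2 + \<epsilon>\<^sup>2))) / n"
    by (rule divide_right_mono) simp
  moreover have "(real n * (ln (K / n) - ln (1 + \<rho>)) - 2 * m * ((real n + 1) * ln (real n + 1) - real n)) / n =
      ln (K / n) - ln (1 + \<rho>) + (2 * m - 2 * m * ((real n + 1) * ln (real n + 1) / n))"
    using n by (simp add: diff_divide_distrib right_diff_distrib)
  ultimately have E: "ln (K / n) - ln (1 + \<rho>) + (2 * m - 2 * m * ((real n + 1) * ln (real n + 1) / n)) - 2 * B * ln 2 / n \<le>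
      (\<Sum>j<n. ln (((\<sigma> j)\<^sup>2)\<^sup>2 / ((\<sigma> j)\<^sup>2 + \<epsilon>\<^sup>2))) / n - 2 * B * ln 2 / n" (is "?E1 \<le> ?E2")
    by simp
  have "K / (1 + \<rho>) * exp (2 * m - 2 * m * ((real n + 1) * ln (real n + 1) / n) - 2 * B * ln 2 / n) =
      real n * exp ?E1"
  proof -
    have "?E1 = (ln (K / n) - ln (1 + \<rho>)) + (2 * m - 2 * m * ((real n + 1) * ln (real n + 1) / n) - 2 * B * ln 2 / n)"
      by simp
    moreover have "exp (ln (K / n) - ln (1 + \<rho>)) = K / n / (1 + \<rho>)"
      using K n \<rho> by (simp add: exp_diff)
    ultimately show ?thesis using n by (simp only: exp_add) simp
  qed
  also have "\<dots> \<le> real n * exp ?E2" using E by (intro mult_left_mono) auto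
  also have "\<dots> \<le> (\<Sum>j<n. (\<sigma> j)\<^sup>2 * \<epsilon>\<^sup>2 / ((\<sigma> j)\<^sup>2 + \<epsilon>\<^sup>2)) + real n * exp ?E2"
    by (simp add: sum_nonneg)
  finally have "ennreal (K / (1 + \<rho>) * exp (2 * m - 2 * m * ((real n + 1) * ln (real n + 1) / n) - 2 * B * ln 2 / n)) \<le>
      quantized_minimax_risk \<epsilon> m c B + ennreal ((2 * C + 2 * real n * C) * exp (- (C * \<delta>\<^sup>2 / (16 * K)) * n))"
    using main by (meson ennreal_leI order_trans)
  moreover have "C * \<delta>\<^sup>2 / (16 * K) = \<delta>\<^sup>2 / (16 * (1 - \<delta>))" using C by (simp add: K_def)
  ultimately show ?thesis by (simp add: K_def \<rho>_def)
qed

lemma low_noise_liminf_ge: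
  fixes m c :: real and B :: "real \<Rightarrow> real"
  assumes m: "m > 0" and c: "c \<noteq> 0"
    and Bh: "((\<lambda>\<epsilon>. B \<epsilon> * \<epsilon> powr (2 / (2 * m + 1))) \<longlongrightarrow> 0) (at_right 0)"
    and B: "filterlim B at_top (at_right 0)"
  shows "ereal (c\<^sup>2 * m powr (2 * m) / pi powr (2 * m)) \<le> Liminf (at_right 0)
          (\<lambda>\<epsilon>. ereal (B \<epsilon> powr (2 * m)) * enn2ereal (quantized_minimax_risk \<epsilon> m c (B \<epsilon>)))"
proof -
  define C where "C = c\<^sup>2 / pi powr (2 * m)"
  \<comment> \<open>As the budget counts bits, there is a factor \<open>exp (2 * m * (1 - ln 2)) > 1\<close> to spare, and
    this choice of \<open>\<delta>\<close> uses it up.\<close>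
  define \<delta> where "\<delta> = 1 - exp (- (2 * m * (1 - ln 2)))"
  define n where "n \<epsilon> = nat \<lfloor>B \<epsilon> / m\<rfloor>" for \<epsilon>
  have ln2: "ln 2 < (1 :: real)" by (rule ln_2_less_1)
  have \<delta>: "0 < \<delta>" "\<delta> < 1" using m ln2 by (auto simp: \<delta>_def)
  have C: "C > 0" using c by (simp add: C_def)
  define K where "K = (1 - \<delta>) * C"
  have K: "K > 0" using C \<delta> by (simp add: K_def)
  define b where "b = \<delta>\<^sup>2 / (16 * (1 - \<delta>))"
  have b: "b > 0" using \<delta> by (simp add: b_def)
  have evB: "eventually (\<lambda>\<epsilon>. B \<epsilon> > 2 * m) (at_right 0)"
    using B by (simp add: filterlim_at_top_dense)
  have n_bounds: "0 < n \<epsilon>" "real (n \<epsilon>) \<le> B \<epsilon> / m" "B \<epsilon> / m - 1 \<le> real (n \<epsilon>)" if "B \<epsilon> > 2 * m" for \<epsilon>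
  proof -
    have "B \<epsilon> / m > 2" using that m by (simp add: field_simps)
    then show "0 < n \<epsilon>" "real (n \<epsilon>) \<le> B \<epsilon> / m" "B \<epsilon> / m - 1 \<le> real (n \<epsilon>)" unfolding n_def by linarith+
  qed
  have n_lim: "filterlim (\<lambda>\<epsilon>. real (n \<epsilon>)) at_top (at_right 0)"
  proof (rule filterlim_at_top_mono)
    have "filterlim (\<lambda>x. x / m - 1) at_top at_top" using m by real_asymp
    then show "filterlim (\<lambda>\<epsilon>. B \<epsilon> / m - 1) at_top (at_right 0)" using B by (rule filterlim_compose)
    show "eventually (\<lambda>\<epsilon>. B \<epsilon> / m - 1 \<le> real (n \<epsilon>)) (at_right 0)"
      using evB by (rule eventually_mono) (rule n_bounds)
  qed
  have ratio: "((\<lambda>\<epsilon>. B \<epsilon> / real (n \<epsilon>)) \<longlongrightarrow> m) (at_right 0)"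
  proof (rule tendsto_sandwich)
    show "eventually (\<lambda>\<epsilon>. m \<le> B \<epsilon> / real (n \<epsilon>)) (at_right 0)"
      using evB
    proof (rule eventually_mono)
      fix \<epsilon> assume *: "B \<epsilon> > 2 * m"
      have "m * real (n \<epsilon>) \<le> B \<epsilon>" using n_bounds(2)[OF *] m by (simp add: field_simps)
      then show "m \<le> B \<epsilon> / real (n \<epsilon>)" using n_bounds(1)[OF *] by (simp add: field_simps)
    qed
    show "eventually (\<lambda>\<epsilon>. B \<epsilon> / real (n \<epsilon>) \<le> B \<epsilon> / (B \<epsilon> / m - 1)) (at_right 0)"
      using evB
    proof (rule eventually_mono)
      fix \<epsilon> assume *: "B \<epsilon> > 2 * m"
      then have "B \<epsilon> / m > 2" using m by (simp add: field_simps)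
      then show "B \<epsilon> / real (n \<epsilon>) \<le> B \<epsilon> / (B \<epsilon> / m - 1)"
        using n_bounds[OF *] * m by (intro divide_left_mono mult_pos_pos) auto
    qed
    have "((\<lambda>x. inverse (1 / m - 1 / x)) \<longlongrightarrow> inverse (1 / m - 0)) at_top"
      using m by (intro tendsto_intros tendsto_divide_0[OF tendsto_const filterlim_at_top_imp_at_infinity] filterlim_ident) auto
    moreover have "eventually (\<lambda>x. inverse (1 / m - 1 / x) = x / (x / m - 1)) at_top"
      using eventually_gt_at_top[of 0] by (rule eventually_mono) (use m in \<open>simp add: field_simps\<close>)
    ultimately have "((\<lambda>x. x / (x / m - 1)) \<longlongrightarrow> m) at_top"
      using tendsto_cong[of "\<lambda>x. inverse (1 / m - 1 / x)" "\<lambda>x. x / (x / m - 1)" at_top] by simp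
    then show "((\<lambda>\<epsilon>. B \<epsilon> / (B \<epsilon> / m - 1)) \<longlongrightarrow> m) (at_right 0)" using B by (rule filterlim_compose)
  qed simp
  \<comment> \<open>This is the place of the hypothesis \<open>Bh\<close>: with
    \<open>n \<epsilon> \<le> B \<epsilon> / m\<close> the noise ratio is at most a constant times
    the power \<open>2 * m + 1\<close> of
    \<open>B \<epsilon> * \<epsilon> powr (2 / (2 * m + 1))\<close>.\<close>
  define \<rho> where "\<rho> \<epsilon> = \<epsilon>\<^sup>2 * real (n \<epsilon>) powr (2 * m + 1) / K" for \<epsilon>
  have \<rho>_lim: "(\<rho> \<longlongrightarrow> 0) (at_right 0)"
  proof (rule tendsto_sandwich[OF _ _ tendsto_const])
    show "eventually (\<lambda>\<epsilon>. 0 \<le> \<rho> \<epsilon>) (at_right 0)" using K by (auto simp: \<rho>_def)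
    show "eventually (\<lambda>\<epsilon>. \<rho> \<epsilon> \<le> (B \<epsilon> * \<epsilon> powr (2 / (2 * m + 1)) / m) powr (2 * m + 1) / K) (at_right 0)"
      using evB eventually_at_right_less[of "0 :: real"]
    proof eventually_elim
      case (elim \<epsilon>)
      have "(\<epsilon> powr (2 / (2 * m + 1))) powr (2 * m + 1) = \<epsilon>\<^sup>2"
      proof -
        have "2 / (2 * m + 1) * (2 * m + 1) = 2" using m by (simp add: field_simps)
        then show ?thesis using elim by (simp only: powr_powr) simp
      qed
      then have "(B \<epsilon> * \<epsilon> powr (2 / (2 * m + 1)) / m) powr (2 * m + 1) = \<epsilon>\<^sup>2 * (B \<epsilon> / m) powr (2 * m + 1)"
        using elim m by (simp add: powr_mult powr_divide)
      moreover have "real (n \<epsilon>) powr (2 * m + 1) \<le> (B \<epsilon> / m) powr (2 * m + 1)"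
        using n_bounds[OF elim(1)] m by (intro powr_mono2) auto
      ultimately show ?case
        using K unfolding \<rho>_def by (simp add: divide_right_mono mult_left_mono)
    qed
    have "((\<lambda>\<epsilon>. (B \<epsilon> * \<epsilon> powr (2 / (2 * m + 1)) / m) powr (2 * m + 1)) \<longlongrightarrow> 0) (at_right 0)"
    proof (rule tendsto_zero_powrI)
      show "((\<lambda>\<epsilon>. B \<epsilon> * \<epsilon> powr (2 / (2 * m + 1)) / m) \<longlongrightarrow> 0) (at_right 0)"
        using tendsto_divide[OF Bh tendsto_const[of m]] m by simp
      show "eventually (\<lambda>\<epsilon>. 0 \<le> B \<epsilon> * \<epsilon> powr (2 / (2 * m + 1)) / m) (at_right 0)"
        using evB by (rule eventually_mono) (use m in auto)
      show "((\<lambda>\<epsilon>. 2 * m + 1) \<longlongrightarrow> 2 * m + 1) (at_right 0)" by simp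
    qed (use m in simp)
    from tendsto_divide[OF this tendsto_const[of K]]
    show "((\<lambda>\<epsilon>. (B \<epsilon> * \<epsilon> powr (2 / (2 * m + 1)) / m) powr (2 * m + 1) / K) \<longlongrightarrow> 0) (at_right 0)"
      using K by simp
  qed
  let ?l = "\<lambda>\<epsilon>. K / (1 + \<rho> \<epsilon>) * exp (2 * m - 2 * m * ((real (n \<epsilon>) + 1) * ln (real (n \<epsilon>) + 1) / real (n \<epsilon>)) - 2 * B \<epsilon> * ln 2 / real (n \<epsilon>))"
  let ?e = "\<lambda>\<epsilon>. (2 * C + 2 * real (n \<epsilon>) * C) * exp (- b * real (n \<epsilon>))"
  show ?thesis
  proof (rule Liminf_weighted_risk_ge[where l = ?l and e = ?e])
    have "eventually (\<lambda>\<epsilon>. real (n \<epsilon>) \<ge> 8 * (1 - \<delta>) / \<delta>) (at_right 0)"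
      using n_lim by (simp add: filterlim_at_top)
    then show "eventually (\<lambda>\<epsilon>. B \<epsilon> powr (2 * m) > 0 \<and> ?e \<epsilon> \<ge> 0 \<and>
        ennreal (?l \<epsilon>) \<le> quantized_minimax_risk \<epsilon> m c (B \<epsilon>) + ennreal (?e \<epsilon>)) (at_right 0)"
      using evB eventually_at_right_less[of "0 :: real"]
    proof eventually_elim
      case (elim \<epsilon>)
      then show ?case
        using low_noise_risk_ge[OF less_imp_le[OF m] c _ \<delta>, of \<epsilon> "n \<epsilon>" "B \<epsilon>"] n_bounds(1)[of \<epsilon>] m C
        unfolding K_def C_def \<rho>_def b_def by simp
    qed
    \<comment> \<open>\<open>(n + 1) * ln (n + 1) / n\<close> is
      \<open>ln (n + 1) + ln (n + 1) / n\<close>. The first part turns the weight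
      \<open>B \<epsilon> powr (2 * m)\<close> into a power of this ratio; the second part vanishes
      in the limit.\<close>
    have ratio': "((\<lambda>\<epsilon>. B \<epsilon> / (real (n \<epsilon>) + 1)) \<longlongrightarrow> m) (at_right 0)"
    proof -
      have "((\<lambda>x::real. x / (x + 1)) \<longlongrightarrow> 1) at_top" by real_asymp
      from tendsto_mult[OF ratio filterlim_compose[OF this n_lim]]
      have lim: "((\<lambda>\<epsilon>. B \<epsilon> / real (n \<epsilon>) * (real (n \<epsilon>) / (real (n \<epsilon>) + 1))) \<longlongrightarrow> m) (at_right 0)" by simp
      have "eventually (\<lambda>\<epsilon>. B \<epsilon> / real (n \<epsilon>) * (real (n \<epsilon>) / (real (n \<epsilon>) + 1)) = B \<epsilon> / (real (n \<epsilon>) + 1)) (at_right 0)"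
        using evB by (rule eventually_mono) (use n_bounds(1) in auto)
      from tendsto_cong[THEN iffD1, OF this lim] show ?thesis .
    qed
    have "((\<lambda>x::real. ln (x + 1) / x) \<longlongrightarrow> 0) at_top" by real_asymp
    note ln_lim = filterlim_compose[OF this n_lim]
    have "((\<lambda>\<epsilon>. K / (1 + \<rho> \<epsilon>) * ((B \<epsilon> / (real (n \<epsilon>) + 1)) powr (2 * m) *
        exp (2 * m - 2 * m * (ln (real (n \<epsilon>) + 1) / real (n \<epsilon>)) - 2 * ln 2 * (B \<epsilon> / real (n \<epsilon>))))) \<longlongrightarrow>
        K / (1 + 0) * (m powr (2 * m) * exp (2 * m - 2 * m * 0 - 2 * ln 2 * m))) (at_right 0)"
      using m by (intro tendsto_intros \<rho>_lim ratio ratio' ln_lim) auto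
    also have "K / (1 + 0) * (m powr (2 * m) * exp (2 * m - 2 * m * 0 - 2 * ln 2 * m)) = c\<^sup>2 * m powr (2 * m) / pi powr (2 * m)"
    proof -
      have "(1 - \<delta>) * exp (2 * m - 2 * m * 0 - 2 * ln 2 * m) = 1"
        by (simp add: \<delta>_def exp_add[symmetric] algebra_simps)
      then have KC: "K * exp (2 * m - 2 * m * 0 - 2 * ln 2 * m) = C" by (simp add: K_def)
      have "K / (1 + 0) * (m powr (2 * m) * exp (2 * m - 2 * m * 0 - 2 * ln 2 * m)) =
          m powr (2 * m) * (K * exp (2 * m - 2 * m * 0 - 2 * ln 2 * m))" by simp
      also have "\<dots> = c\<^sup>2 * m powr (2 * m) / pi powr (2 * m)" unfolding KC by (simp add: C_def)
      finally show ?thesis .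
    qed
    finally have lim: "((\<lambda>\<epsilon>. K / (1 + \<rho> \<epsilon>) * ((B \<epsilon> / (real (n \<epsilon>) + 1)) powr (2 * m) *
        exp (2 * m - 2 * m * (ln (real (n \<epsilon>) + 1) / real (n \<epsilon>)) - 2 * ln 2 * (B \<epsilon> / real (n \<epsilon>))))) \<longlongrightarrow>
        c\<^sup>2 * m powr (2 * m) / pi powr (2 * m)) (at_right 0)" .
    have "eventually (\<lambda>\<epsilon>. K / (1 + \<rho> \<epsilon>) * ((B \<epsilon> / (real (n \<epsilon>) + 1)) powr (2 * m) *
        exp (2 * m - 2 * m * (ln (real (n \<epsilon>) + 1) / real (n \<epsilon>)) - 2 * ln 2 * (B \<epsilon> / real (n \<epsilon>)))) =
        B \<epsilon> powr (2 * m) * ?l \<epsilon>) (at_right 0)"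
      using evB
    proof (rule eventually_mono)
      fix \<epsilon> assume *: "B \<epsilon> > 2 * m"
      define k where "k = real (n \<epsilon>)"
      have k: "k > 0" using n_bounds(1)[OF *] by (simp add: k_def)
      have "(B \<epsilon> / (k + 1)) powr (2 * m) = B \<epsilon> powr (2 * m) * exp (- (2 * m * ln (k + 1)))"
      proof -
        have "0 < B \<epsilon>" using * m by simp
        then have "ln (B \<epsilon> / (k + 1)) = ln (B \<epsilon>) + - ln (k + 1)" using k by (simp add: ln_divide_pos)
        then have "2 * m * ln (B \<epsilon> / (k + 1)) = 2 * m * ln (B \<epsilon>) + - (2 * m * ln (k + 1))"
          by (simp only: distrib_left mult_minus_right)
        then show ?thesis using \<open>0 < B \<epsilon>\<close> k by (simp add: powr_def exp_add[symmetric])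
      qed
      moreover have "exp (- (2 * m * ln (k + 1))) * exp (2 * m - 2 * m * (ln (k + 1) / k) - 2 * ln 2 * (B \<epsilon> / k)) =
          exp (2 * m - 2 * m * ((k + 1) * ln (k + 1) / k) - 2 * B \<epsilon> * ln 2 / k)"
        using k by (simp add: exp_add[symmetric] field_simps)
      ultimately show "K / (1 + \<rho> \<epsilon>) * ((B \<epsilon> / (real (n \<epsilon>) + 1)) powr (2 * m) *
        exp (2 * m - 2 * m * (ln (real (n \<epsilon>) + 1) / real (n \<epsilon>)) - 2 * ln 2 * (B \<epsilon> / real (n \<epsilon>)))) =
        B \<epsilon> powr (2 * m) * ?l \<epsilon>"
        unfolding k_def[symmetric] by (simp add: mult_ac)
    qed
    from tendsto_cong[THEN iffD1, OF this lim]
    show "((\<lambda>\<epsilon>. B \<epsilon> powr (2 * m) * ?l \<epsilon>) \<longlongrightarrow> c\<^sup>2 * m powr (2 * m) / pi powr (2 * m)) (at_right 0)" .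
    have 1: "((\<lambda>k. (2 * C) * (k powr (2 * m) * exp (- b * k)) + (2 * C) * (k powr (2 * m + 1) * exp (- b * k))) \<longlongrightarrow>
        (2 * C) * 0 + (2 * C) * 0) at_top"
      by (intro tendsto_add tendsto_mult tendsto_const powr_times_exp_tendsto_0 b)
    have "((\<lambda>\<epsilon>. (B \<epsilon> / real (n \<epsilon>)) powr (2 * m) *
        ((2 * C) * (real (n \<epsilon>) powr (2 * m) * exp (- b * real (n \<epsilon>))) +
         (2 * C) * (real (n \<epsilon>) powr (2 * m + 1) * exp (- b * real (n \<epsilon>))))) \<longlongrightarrow>
        m powr (2 * m) * ((2 * C) * 0 + (2 * C) * 0)) (at_right 0)"
      using m by (intro tendsto_mult tendsto_powr ratio tendsto_const filterlim_compose[OF 1 n_lim]) auto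
    then have lim: "((\<lambda>\<epsilon>. (B \<epsilon> / real (n \<epsilon>)) powr (2 * m) *
        ((2 * C) * (real (n \<epsilon>) powr (2 * m) * exp (- b * real (n \<epsilon>))) +
         (2 * C) * (real (n \<epsilon>) powr (2 * m + 1) * exp (- b * real (n \<epsilon>))))) \<longlongrightarrow> 0) (at_right 0)"
      by simp
    have "eventually (\<lambda>\<epsilon>. (B \<epsilon> / real (n \<epsilon>)) powr (2 * m) *
        ((2 * C) * (real (n \<epsilon>) powr (2 * m) * exp (- b * real (n \<epsilon>))) +
         (2 * C) * (real (n \<epsilon>) powr (2 * m + 1) * exp (- b * real (n \<epsilon>)))) =
        B \<epsilon> powr (2 * m) * ?e \<epsilon>) (at_right 0)"
      using evB
    proof (rule eventually_mono)
      fix \<epsilon> assume *: "B \<epsilon> > 2 * m"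
      then show "(B \<epsilon> / real (n \<epsilon>)) powr (2 * m) *
        ((2 * C) * (real (n \<epsilon>) powr (2 * m) * exp (- b * real (n \<epsilon>))) +
         (2 * C) * (real (n \<epsilon>) powr (2 * m + 1) * exp (- b * real (n \<epsilon>)))) =
        B \<epsilon> powr (2 * m) * ?e \<epsilon>"
        using n_bounds(1)[OF *] m by (simp add: powr_divide powr_add field_simps)
    qed
    from tendsto_cong[THEN iffD1, OF this lim]
    show "((\<lambda>\<epsilon>. B \<epsilon> powr (2 * m) * ?e \<epsilon>) \<longlongrightarrow> 0) (at_right 0)" .
  qed simp
qed

theorem theorem3p1:
  fixes m c :: real and B :: "real \<Rightarrow> real"
  assumes "m > 0" and "c > 0" and "\<And>\<epsilon>. \<epsilon> > 0 \<Longrightarrow> B \<epsilon> > 0"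
  shows
    "(filterlim (\<lambda>\<epsilon>. B \<epsilon> * \<epsilon> powr (2 / (2 * m + 1))) at_top (at_right 0) \<longrightarrow>
        Liminf (at_right 0)
          (\<lambda>\<epsilon>. ereal (\<epsilon> powr (- (4 * m / (2 * m + 1)))) *
               enn2ereal (quantized_minimax_risk \<epsilon> m c (B \<epsilon>)))
        \<ge> ereal (pinsker_const m c)) \<and>
     (\<forall>d>0. ((\<lambda>\<epsilon>. B \<epsilon> * \<epsilon> powr (2 / (2 * m + 1))) \<longlongrightarrow> d) (at_right 0) \<longrightarrow>
        Liminf (at_right 0)
          (\<lambda>\<epsilon>. ereal (\<epsilon> powr (- (4 * m / (2 * m + 1)))) *
               enn2ereal (quantized_minimax_risk \<epsilon> m c (B \<epsilon>)))
        \<ge> ereal (pinsker_const m c) + quantization_excess m c d \<and>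
        ereal (pinsker_const m c) + quantization_excess m c d = variational_const m c d) \<and>
     (((\<lambda>\<epsilon>. B \<epsilon> * \<epsilon> powr (2 / (2 * m + 1))) \<longlongrightarrow> 0) (at_right 0) \<and>
      filterlim B at_top (at_right 0) \<longrightarrow>
        Liminf (at_right 0)
          (\<lambda>\<epsilon>. ereal (B \<epsilon> powr (2 * m)) *
               enn2ereal (quantized_minimax_risk \<epsilon> m c (B \<epsilon>)))
        \<ge> ereal (c\<^sup>2 * m powr (2 * m) / pi powr (2 * m)))"
proof (intro conjI impI allI)
  let ?W = "Liminf (at_right 0) (\<lambda>\<epsilon>. ereal (\<epsilon> powr (- (4 * m / (2 * m + 1)))) *
               enn2ereal (quantized_minimax_risk \<epsilon> m c (B \<epsilon>)))"
  have c: "c \<noteq> 0" using \<open>c > 0\<close> by simp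
  show "ereal (pinsker_const m c) \<le> ?W"
    using \<open>m > 0\<close> c by (rule pinsker_const_le_liminf)
  fix d :: real assume d: "d > 0" "((\<lambda>\<epsilon>. B \<epsilon> * \<epsilon> powr (2 / (2 * m + 1))) \<longlongrightarrow> d) (at_right 0)"
  have "variational_const m c d \<le> ?W"
    unfolding variational_const_def
  proof (rule SUP_least)
    fix p assume "p \<in> {(x0, s). variational_feasible m c d x0 s}"
    then obtain x0 s where p: "p = (x0, s)" and feasible: "variational_feasible m c d x0 s" by auto
    have "ereal (variational_objective d x0 s) \<le> ?W"
      using feasible d \<open>m > 0\<close> c unfolding variational_feasible_def by (intro profile_liminf_ge(2)) auto
    then show "(case p of (x0, s) \<Rightarrow> ereal (variational_objective d x0 s)) \<le> ?W" by (simp add: p)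
  qed
  \<comment> \<open>The supremum lives in the extended reals; the Pinsker constant is finite and
    cancels in the infinite cases too.\<close>
  moreover show eq: "ereal (pinsker_const m c) + quantization_excess m c d = variational_const m c d"
    unfolding quantization_excess_def by (cases "variational_const m c d") auto
  ultimately show "ereal (pinsker_const m c) + quantization_excess m c d \<le> ?W" by simp
next
  assume "((\<lambda>\<epsilon>. B \<epsilon> * \<epsilon> powr (2 / (2 * m + 1))) \<longlongrightarrow> 0) (at_right 0) \<and> filterlim B at_top (at_right 0)"
  then show "ereal (c\<^sup>2 * m powr (2 * m) / pi powr (2 * m)) \<le> Liminf (at_right 0)
          (\<lambda>\<epsilon>. ereal (B \<epsilon> powr (2 * m)) * enn2ereal (quantized_minimax_risk \<epsilon> m c (B \<epsilon>)))"
    using \<open>m > 0\<close> \<open>c > 0\<close> by (intro low_noise_liminf_ge) auto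
qed

end
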